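(* Let $C\subset\mathbb{P}^n$ be an $(n-k)$-rope supported on the line $L=\operatorname{Proj} S$. Then for every $d \in \mathbb{Z}$ its global sections of degree $d$ are $$H^0(C,\mathcal{O}_C(d))=\Big\{P+\sum_{i=0}^{r-k}Q_iz_i \ \Big|\ P,Q_i\in S \text{ homogeneous},\ \deg(P)=d,\ \deg(Q_i)=d+\alpha_i-1\Big\}.$$ Furthermore, $H^0_*(C,\mathcal{O}_C):=\bigoplus_{d\in\mathbb{Z}}H^0(C,\mathcal{O}_C(d))$ is, as an $S$-module, free with basis $\{1,z_0,\dots,z_{r-k}\}$.
   Context: $K$ is an arbitrary field, $n\ge 3$, $r:=n-2$, $R=K[x_0,\dots,x_r,t,u]$ is the coordinate ring of $\mathbb{P}^n$, $L$ is the line with $I_L=(x_0,\dots,x_r)$, and $S=K[t,u]\subset R$ is its coordinate ring. A curve is a closed locally Cohen-Macaulay projective subscheme of pure dimension one. A rope supported on $L$ is a curve $C$ with support $L$ whose homogeneous ideal $I_C$ contains $I_L^2$; an $(n-k)$-rope is a rope of degree $n-k$ (here $1\le k\le n-2$). To each $(n-k)$-rope on $L$ are associated matrices $A,B$ with homogeneous entries in $S$ such that $I_C=((I_L)^2,[x_0,\dots,x_r]B)$ and there is an exact sequence $$0\to\bigoplus_{j=1}^k\mathcal{O}_{\mathbb{P}^1}(-\beta_j-1)\xrightarrow{B}\mathcal{O}_{\mathbb{P}^1}^{r+1}(-1)\xrightarrow{A}\bigoplus_{i=0}^{r-k}\mathcal{O}_{\mathbb{P}^1}(\alpha_i-1)\to0$$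 with $\alpha_i,\beta_j\ge0$; thus $A=(a_{ij})$ is an $(r+1-k)\times(r+1)$ matrix with $\deg a_{ij}=\alpha_i$. The sections $z_i$: for a subset $J=\{j_0<\dots<j_{r-k}\}\subset\{0,\dots,r\}$ of $r+1-k$ elements let $A_J$ be the submatrix of $A$ formed by the columns with index in $J$ and let $U_J=\{p\in\mathbb{P}^n : \det A_J(p)\ne0\}$. On $C\cap U_J$ define $(z_0^J,\dots,z_{r-k}^J)=(x_{j_0},\dots,x_{j_{r-k}})A_J^{-1}$, where $z_i^J$ is a section of $\mathcal{O}_C(1-\alpha_i)$. The sets $U_J$ cover $C$, and for each $i$ the local sections $z_i^J$ glue to a global section $z_i\in H^0(C,\mathcal{O}_C(1-\alpha_i))$. The zero polynomial is regarded as homogeneous of every degree (polynomials of negative degree are zero). *)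

theory Defs
  imports
    "HOL-Library.Poly_Mapping"
    "HOL-Library.Extended_Nat"
    "HOL-Library.FuncSet"
    "HOL-Algebra.Module"
    "HOL-Algebra.Ideal_Product"
    "Jordan_Normal_Form.Determinant"
    "Jordan_Normal_Form.DL_Submatrix"
begin

section \<open>Graded polynomial rings\<close>

text \<open>Polynomials in the variables \<open>X\<^sub>0, X\<^sub>1, \<dots>\<close>; the ring \<open>K[X\<^sub>v : v \<in> V]\<close> is the subring
  \<open>mpoly_ring V\<close>.  The coordinate ring of \<open>\<P>\<^sup>n\<close> is \<open>mpoly_ring {..n}\<close>, where with \<open>r = n - 2\<close> the
  variables \<open>x\<^sub>0, \<dots>, x\<^sub>r, t, u\<close> are the ones numbered \<open>0, \<dots>, n - 2, n - 1, n\<close>.\<close>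

type_synonym 'k mpoly = "(nat \<Rightarrow>\<^sub>0 nat) \<Rightarrow>\<^sub>0 'k"

definition Var :: "nat \<Rightarrow> 'k::field mpoly" where
  "Var v = Poly_Mapping.single (Poly_Mapping.single v 1) 1"

definition Const :: "'k::field \<Rightarrow> 'k mpoly" where
  "Const c = Poly_Mapping.single 0 c"

definition mpoly_ring :: "nat set \<Rightarrow> 'k::field mpoly ring" where
  "mpoly_ring V = \<lparr>carrier = {f. \<forall>m\<in>Poly_Mapping.keys f. Poly_Mapping.keys m \<subseteq> V}, monoid.mult = (*), one = 1, zero = 0, add = (+)\<rparr>"

definition mdeg :: "(nat \<Rightarrow>\<^sub>0 nat) \<Rightarrow> nat" where
  "mdeg m = (\<Sum>v\<in>Poly_Mapping.keys m. Poly_Mapping.lookup m v)"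

text \<open>The degree is an integer; zero is homogeneous of every degree, and it is the only
  homogeneous polynomial of a given negative degree.\<close>

definition homog :: "int \<Rightarrow> 'k::field mpoly \<Rightarrow> bool" where
  "homog d f \<longleftrightarrow> (\<forall>m\<in>Poly_Mapping.keys f. int (mdeg m) = d)"

definition hom_comp :: "nat \<Rightarrow> 'k::field mpoly \<Rightarrow> 'k mpoly" where
  "hom_comp e f = (\<Sum>m\<in>{m\<in>Poly_Mapping.keys f. mdeg m = e}. Poly_Mapping.single m (Poly_Mapping.lookup f m))"

definition hom_ideal :: "nat set \<Rightarrow> 'k::field mpoly set \<Rightarrow> bool" where
  "hom_ideal V I \<longleftrightarrow> ideal I (mpoly_ring V) \<and> (\<forall>f\<in>I. \<forall>e. hom_comp e f \<in> I)"

text \<open>Saturation with respect to the irrelevant ideal \<open>\<mm>\<close>: if \<open>\<mm>\<^sup>N f \<subseteq> I\<close> for some \<open>N\<close> then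
  \<open>f \<in> I\<close> (\<open>\<mm>\<^sup>N\<close> is generated by the forms of degree \<open>N\<close>).\<close>

definition saturated :: "nat set \<Rightarrow> 'k::field mpoly set \<Rightarrow> bool" where
  "saturated V I \<longleftrightarrow> (\<forall>f\<in>carrier (mpoly_ring V).
     (\<exists>N::nat. \<forall>g\<in>carrier (mpoly_ring V). homog (int N) g \<longrightarrow> g * f \<in> I) \<longrightarrow> f \<in> I)"


section \<open>Projective schemes and the sheaves \<open>\<O>(d)\<close>\<close>

text \<open>Throughout, \<open>X = Proj (mpoly_ring V / I)\<close>; its points are the homogeneous primes of
  \<open>mpoly_ring V\<close> that contain \<open>I\<close> and do not contain the irrelevant ideal.\<close>

definition Proj :: "nat set \<Rightarrow> 'k::field mpoly set \<Rightarrow> 'k mpoly set set" where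
  "Proj V I = {P. hom_ideal V P \<and> primeideal P (mpoly_ring V) \<and> I \<subseteq> P \<and> \<not> Var ` V \<subseteq> P}"

definition zariski_open :: "nat set \<Rightarrow> 'k::field mpoly set \<Rightarrow> 'k mpoly set set \<Rightarrow> bool" where
  "zariski_open V I U \<longleftrightarrow> (\<exists>E. hom_ideal V E \<and> U = {P \<in> Proj V I. \<not> E \<subseteq> P})"

definition denoms :: "nat set \<Rightarrow> 'k::field mpoly set \<Rightarrow> 'k mpoly set" where
  "denoms V P = {f \<in> carrier (mpoly_ring V). f \<notin> P \<and> (\<exists>e. homog e f)}"

text \<open>\<open>germ V I P a f\<close> is the fraction \<open>a/f\<close>, as an equivalence class, in the localization \<open>loc V I P\<close> of
  \<open>mpoly_ring V / I\<close> at the homogeneous elements outside \<open>P\<close>.\<close>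

definition germ :: "nat set \<Rightarrow> 'k::field mpoly set \<Rightarrow> 'k mpoly set \<Rightarrow>
    'k mpoly \<Rightarrow> 'k mpoly \<Rightarrow> ('k mpoly \<times> 'k mpoly) set" where
  "germ V I P a f = {(b, g). b \<in> carrier (mpoly_ring V) \<and> g \<in> denoms V P \<and>
     (\<exists>h\<in>denoms V P. h * (a * g - b * f) \<in> I)}"

definition loc :: "nat set \<Rightarrow> 'k::field mpoly set \<Rightarrow> 'k mpoly set \<Rightarrow> ('k mpoly \<times> 'k mpoly) set ring" where
  "loc V I P = \<lparr>
     carrier = {germ V I P a f | a f. a \<in> carrier (mpoly_ring V) \<and> f \<in> denoms V P},
     monoid.mult = (\<lambda>x y. \<Union>(a, f)\<in>x. \<Union>(b, g)\<in>y. germ V I P (a * b) (f * g)),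
     one = germ V I P 1 1,
     zero = germ V I P 0 1,
     add = (\<lambda>x y. \<Union>(a, f)\<in>x. \<Union>(b, g)\<in>y. germ V I P (a * g + b * f) (f * g))\<rparr>"

text \<open>The stalk of \<open>\<O>\<^sub>X(d)\<close> at \<open>P\<close> is the degree \<open>d\<close> part of the localization.\<close>

definition stalk :: "nat set \<Rightarrow> 'k::field mpoly set \<Rightarrow> int \<Rightarrow> 'k mpoly set \<Rightarrow> ('k mpoly \<times> 'k mpoly) set set" where
  "stalk V I d P = {germ V I P a f | a f e. a \<in> carrier (mpoly_ring V) \<and> f \<in> denoms V P \<and>
     homog (d + e) a \<and> homog e f}"

definition local_ring :: "nat set \<Rightarrow> 'k::field mpoly set \<Rightarrow> 'k mpoly set \<Rightarrow> ('k mpoly \<times> 'k mpoly) set ring" where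
  "local_ring V I P = (loc V I P)\<lparr>carrier := stalk V I 0 P\<rparr>"

definition sections :: "nat set \<Rightarrow> 'k::field mpoly set \<Rightarrow> int \<Rightarrow> 'k mpoly set set \<Rightarrow>
    ('k mpoly set \<Rightarrow> ('k mpoly \<times> 'k mpoly) set) set" where
  "sections V I d U = {s \<in> (\<Pi>\<^sub>E P\<in>U. stalk V I d P).
     \<forall>P\<in>U. \<exists>W a f e. zariski_open V I W \<and> P \<in> W \<and> W \<subseteq> U \<and>
       a \<in> carrier (mpoly_ring V) \<and> homog (d + e) a \<and> homog e f \<and>
       (\<forall>Q\<in>W. f \<in> denoms V Q \<and> s Q = germ V I Q a f)}"

definition H0 :: "nat set \<Rightarrow> 'k::field mpoly set \<Rightarrow> int \<Rightarrow> ('k mpoly set \<Rightarrow> ('k mpoly \<times> 'k mpoly) set) set" where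
  "H0 V I d = sections V I d (Proj V I)"

text \<open>All sections are computed with pointwise, in the product of the localizations.\<close>

definition sec_ring :: "nat set \<Rightarrow> 'k::field mpoly set \<Rightarrow> ('k mpoly set \<Rightarrow> ('k mpoly \<times> 'k mpoly) set) ring" where
  "sec_ring V I = \<lparr>
     carrier = (\<Pi>\<^sub>E P\<in>Proj V I. carrier (loc V I P)),
     monoid.mult = (\<lambda>s s'. \<lambda>P\<in>Proj V I. s P \<otimes>\<^bsub>loc V I P\<^esub> s' P),
     one = (\<lambda>P\<in>Proj V I. \<one>\<^bsub>loc V I P\<^esub>),
     zero = (\<lambda>P\<in>Proj V I. \<zero>\<^bsub>loc V I P\<^esub>),
     add = (\<lambda>s s'. \<lambda>P\<in>Proj V I. s P \<oplus>\<^bsub>loc V I P\<^esub> s' P)\<rparr>"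

definition poly_sec :: "nat set \<Rightarrow> 'k::field mpoly set \<Rightarrow> 'k mpoly \<Rightarrow> 'k mpoly set \<Rightarrow> ('k mpoly \<times> 'k mpoly) set" where
  "poly_sec V I f = (\<lambda>P\<in>Proj V I. germ V I P f 1)"

text \<open>\<open>\<Oplus>\<^sub>d H\<^sup>0(X, \<O>\<^sub>X(d))\<close>: finitely supported families \<open>s\<close> with \<open>s d \<in> H\<^sup>0(X, \<O>\<^sub>X(d))\<close>, acted on by
  polynomials through their homogeneous components.  The fields \<open>mult\<close> and \<open>one\<close> of the record
  play no role in a module.\<close>

definition H0star :: "nat set \<Rightarrow> 'k::field mpoly set \<Rightarrow>
    ('k mpoly, int \<Rightarrow> 'k mpoly set \<Rightarrow> ('k mpoly \<times> 'k mpoly) set) module" where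
  "H0star V I = \<lparr>
     carrier = {s. (\<forall>d. s d \<in> H0 V I d) \<and> finite {d. s d \<noteq> \<zero>\<^bsub>sec_ring V I\<^esub>}},
     monoid.mult = undefined,
     one = undefined,
     zero = (\<lambda>d. \<zero>\<^bsub>sec_ring V I\<^esub>),
     add = (\<lambda>s s' d. s d \<oplus>\<^bsub>sec_ring V I\<^esub> s' d),
     module.smult = (\<lambda>f s d. \<Oplus>\<^bsub>sec_ring V I\<^esub>e\<in>{e. hom_comp e f \<noteq> 0}.
               poly_sec V I (hom_comp e f) \<otimes>\<^bsub>sec_ring V I\<^esub> s (d - int e))\<rparr>"

definition in_degree :: "nat set \<Rightarrow> 'k::field mpoly set \<Rightarrow> int \<Rightarrow> ('k mpoly set \<Rightarrow> ('k mpoly \<times> 'k mpoly) set) \<Rightarrow>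
    int \<Rightarrow> 'k mpoly set \<Rightarrow> ('k mpoly \<times> 'k mpoly) set" where
  "in_degree V I d s = (\<lambda>e. if e = d then s else \<zero>\<^bsub>sec_ring V I\<^esub>)"

definition free_basis :: "('a, 'c) ring_scheme \<Rightarrow> ('a, 'b, 'd) module_scheme \<Rightarrow> 'i set \<Rightarrow> ('i \<Rightarrow> 'b) \<Rightarrow> bool" where
  "free_basis R M N b \<longleftrightarrow> finite N \<and> b \<in> N \<rightarrow> carrier M \<and>
     (\<forall>x\<in>carrier M. \<exists>!c. c \<in> N \<rightarrow>\<^sub>E carrier R \<and> x = (\<Oplus>\<^bsub>M\<^esub>i\<in>N. c i \<odot>\<^bsub>M\<^esub> b i))"


section \<open>Curves\<close>

definition chain_dim :: "'a set set \<Rightarrow> enat" where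
  "chain_dim \<X> = Sup {enat l | l. \<exists>c. (\<forall>i\<le>l. c i \<in> \<X>) \<and> (\<forall>i<l. c i \<subset> c (Suc i))}"

definition krull_dim :: "('a, 'b) ring_scheme \<Rightarrow> enat" where
  "krull_dim R = chain_dim {P. primeideal P R}"

text \<open>Depth and the Cohen--Macaulay property are meant for (Noetherian) local rings, where the
  maximal ideal is the set of nonunits.\<close>

definition regular_seq :: "('a, 'b) ring_scheme \<Rightarrow> 'a list \<Rightarrow> bool" where
  "regular_seq R xs \<longleftrightarrow> set xs \<subseteq> carrier R - Units R \<and>
     (\<forall>i<length xs. \<forall>a\<in>carrier R. xs ! i \<otimes>\<^bsub>R\<^esub> a \<in> genideal R (set (take i xs)) \<longrightarrow>
        a \<in> genideal R (set (take i xs)))"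

definition depth :: "('a, 'b) ring_scheme \<Rightarrow> enat" where
  "depth R = Sup {enat (length xs) | xs. regular_seq R xs}"

definition locally_cohen_macaulay :: "nat set \<Rightarrow> 'k::field mpoly set \<Rightarrow> bool" where
  "locally_cohen_macaulay V I \<longleftrightarrow>
     (\<forall>P\<in>Proj V I. depth (local_ring V I P) = krull_dim (local_ring V I P))"

text \<open>Irreducible closed subsets of \<open>X\<close> correspond to its points, the irreducible components to the
  minimal ones.\<close>

definition pure_dim_one :: "nat set \<Rightarrow> 'k::field mpoly set \<Rightarrow> bool" where
  "pure_dim_one V I \<longleftrightarrow> (\<forall>P\<in>Proj V I. (\<forall>Q\<in>Proj V I. Q \<subseteq> P \<longrightarrow> Q = P) \<longrightarrow>
     chain_dim {Q \<in> Proj V I. P \<subseteq> Q} = 1)"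

text \<open>A closed subscheme of projective space is given by its saturated homogeneous ideal.\<close>

definition curve :: "nat set \<Rightarrow> 'k::field mpoly set \<Rightarrow> bool" where
  "curve V I \<longleftrightarrow> hom_ideal V I \<and> saturated V I \<and> pure_dim_one V I \<and> locally_cohen_macaulay V I"

definition vdim :: "'k::field mpoly set \<Rightarrow> nat" where
  "vdim W = vector_space.dim (\<lambda>c f. Const c * f) W"

definition hilbert_fun :: "nat set \<Rightarrow> 'k::field mpoly set \<Rightarrow> nat \<Rightarrow> nat" where
  "hilbert_fun V I d = vdim {f :: 'k mpoly. f \<in> carrier (mpoly_ring V) \<and> homog (int d) f} - vdim {f \<in> I. homog (int d) f}"

text \<open>The degree of a curve is the leading coefficient of its (linear) Hilbert polynomial.\<close>

definition has_degree :: "nat set \<Rightarrow> 'k::field mpoly set \<Rightarrow> nat \<Rightarrow> bool" where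
  "has_degree V I e \<longleftrightarrow>
     (\<exists>c::int. eventually (\<lambda>d. int (hilbert_fun V I d) = int e * int d + c) sequentially)"


section \<open>Ropes on a line\<close>

definition line_ideal :: "nat \<Rightarrow> 'k::field mpoly set" where
  "line_ideal n = genideal (mpoly_ring {..n}) (Var ` {..n-2})"

definition rope :: "nat \<Rightarrow> nat \<Rightarrow> 'k::field mpoly set \<Rightarrow> bool" where
  "rope n e I \<longleftrightarrow> curve {..n} I \<and> Proj {..n} I = Proj {..n} (line_ideal n) \<and>
     ideal_prod (mpoly_ring {..n}) (line_ideal n) (line_ideal n) \<subseteq> I \<and> has_degree {..n} I e"

text \<open>The coordinate ring of the line, as a subring of that of \<open>\<P>\<^sup>n\<close>, is \<open>mpoly_ring (line_vars n)\<close>.\<close>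

definition line_vars :: "nat \<Rightarrow> nat set" where
  "line_vars n = {n-1, n}"

text \<open>The map on stalks at the point \<open>Q\<close> of the line that is induced by a matrix \<open>M\<close> over \<open>S\<close>.\<close>

definition stalk_map :: "nat \<Rightarrow> 'k::field mpoly set \<Rightarrow> 'k mpoly mat \<Rightarrow>
    (nat \<Rightarrow> ('k mpoly \<times> 'k mpoly) set) \<Rightarrow> nat \<Rightarrow> ('k mpoly \<times> 'k mpoly) set" where
  "stalk_map n Q M w = (let \<L> = loc (line_vars n) {0} Q in
     (\<lambda>i\<in>{..<dim_row M}. \<Oplus>\<^bsub>\<L>\<^esub>j\<in>{..<dim_col M}. germ (line_vars n) {0} Q (M $$ (i, j)) 1 \<otimes>\<^bsub>\<L>\<^esub> w j))"

text \<open>\<open>A\<close> and \<open>B\<close> are matrices associated with the rope with ideal \<open>I\<close>: the columns of \<open>B\<close> give the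
  generators of \<open>I\<close> modulo the square of the ideal of the line, and
  \<open>0 \<rightarrow> \<Oplus>\<^sub>j \<O>(-\<beta>\<^sub>j - 1) \<rightarrow> \<O>(-1)\<^sup>r\<^sup>+\<^sup>1 \<rightarrow> \<Oplus>\<^sub>i \<O>(\<alpha>\<^sub>i - 1) \<rightarrow> 0\<close> is an exact sequence of sheaves on the line, that is,
  exact on all stalks.\<close>

definition rope_matrices :: "nat \<Rightarrow> nat \<Rightarrow> 'k::field mpoly set \<Rightarrow> 'k mpoly mat \<Rightarrow> 'k mpoly mat \<Rightarrow>
    (nat \<Rightarrow> nat) \<Rightarrow> (nat \<Rightarrow> nat) \<Rightarrow> bool" where
  "rope_matrices n k I A B \<alpha> \<beta> \<longleftrightarrow> (let r = n - 2; V = line_vars n in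
     A \<in> carrier_mat (r + 1 - k) (r + 1) \<and>
     B \<in> carrier_mat (r + 1) k \<and>
     (\<forall>i<r + 1 - k. \<forall>j<r + 1. A $$ (i, j) \<in> carrier (mpoly_ring V) \<and> homog (int (\<alpha> i)) (A $$ (i, j))) \<and>
     (\<forall>i<r + 1. \<forall>j<k. B $$ (i, j) \<in> carrier (mpoly_ring V) \<and> homog (int (\<beta> j)) (B $$ (i, j))) \<and>
     I = genideal (mpoly_ring {..n})
       (ideal_prod (mpoly_ring {..n}) (line_ideal n) (line_ideal n) \<union>
        {\<Sum>i\<le>r. Var i * B $$ (i, j) | j. j < k}) \<and>
     (\<forall>Q\<in>Proj V {0}.
        let \<E> = (\<Pi>\<^sub>E j\<in>{..<k}. stalk V {0} (- int (\<beta> j) - 1) Q);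
            \<F> = (\<Pi>\<^sub>E j\<in>{..<r + 1}. stalk V {0} (- 1) Q);
            \<G> = (\<Pi>\<^sub>E i\<in>{..<r + 1 - k}. stalk V {0} (int (\<alpha> i) - 1) Q)
        in inj_on (stalk_map n Q B) \<E> \<and>
           stalk_map n Q B ` \<E> = {w \<in> \<F>. stalk_map n Q A w = (\<lambda>i\<in>{..<r + 1 - k}. \<zero>\<^bsub>loc V {0} Q\<^esub>)} \<and>
           stalk_map n Q A ` \<F> = \<G>))"

text \<open>The submatrix \<open>A\<^sub>J\<close>, and the section \<open>z\<^sub>i\<close>.  Its germ at \<open>P\<close> is the common value, for all \<open>J\<close> with
  \<open>P \<in> U\<^sub>J\<close>, of the \<open>i\<close>-th entry of the row vector \<open>(x\<^sub>j : j \<in> J) A\<^sub>J\<^sup>-\<^sup>1\<close>, where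
  \<open>A\<^sub>J\<^sup>-\<^sup>1 = adj(A\<^sub>J) / det A\<^sub>J\<close>; \<open>pick J l\<close> is the \<open>l\<close>-th smallest element of \<open>J\<close>, counted from 0.\<close>

definition col_submat :: "'k::field mpoly mat \<Rightarrow> nat set \<Rightarrow> 'k mpoly mat" where
  "col_submat A J = submatrix A UNIV J"

definition z_sec :: "nat \<Rightarrow> nat \<Rightarrow> 'k::field mpoly set \<Rightarrow> 'k mpoly mat \<Rightarrow> nat \<Rightarrow>
    'k mpoly set \<Rightarrow> ('k mpoly \<times> 'k mpoly) set" where
  "z_sec n k I A i = (let r = n - 2 in (\<lambda>P\<in>Proj {..n} I. THE g.
     \<forall>J. J \<subseteq> {..r} \<and> card J = r + 1 - k \<and> det (col_submat A J) \<notin> P \<longrightarrow>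
       g = germ {..n} I P (\<Sum>l\<le>r - k. Var (pick J l) * adj_mat (col_submat A J) $$ (l, i))
                          (det (col_submat A J))))"

end

theory Submission
  imports Defs
begin

text \<open>
  Write \<open>S\<close> for the coordinate ring of the line, \<open>x\<^sub>j\<close> for the equations of the line and \<open>I\<close> for the ideal
  of the rope.  Since \<open>I\<close> contains the square of the ideal of the line, only the expansion
  \<open>a = a\<^sub>0 + \<Sum>\<^sub>j a\<^sub>j x\<^sub>j + \<dots>\<close> of a polynomial to first order along the line matters, with \<open>a\<^sub>0\<close> and
  \<open>a\<^sub>j\<close> in \<open>S\<close>; these are \<open>const_part\<close> and \<open>lin_part\<close> below.  Let \<open>\<nu>\<^sub>i(a) = \<Sum>\<^sub>j A\<^sub>i\<^sub>j a\<^sub>j\<close>.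
  By the Leibniz rule, \<open>\<Phi>(a) = a\<^sub>0 + \<Sum>\<^sub>i \<nu>\<^sub>i(a) \<epsilon>\<^sub>i\<close> is a ring homomorphism into \<open>S[\<epsilon>\<^sub>i]\<close> with
  \<open>\<epsilon>\<^sub>i \<epsilon>\<^sub>j = 0\<close>.  It kills \<open>I\<close> because \<open>A B = 0\<close>, and exactness in the middle of the given sequence says
  that, locally on the line, nothing else is killed (\<open>local_kernel\<close>, \<open>local_kernel_converse\<close>).  So a
  germ \<open>a/f\<close> of the structure sheaf of the rope is determined by the coefficients of
  \<open>\<Phi>(a)/\<Phi>(f)\<close>, its coordinates in the fraction field of \<open>S\<close> (\<open>coord_germ\<close>, \<open>germ_coord\<close>).  Their
  denominator is \<open>f\<^sub>0\<^sup>2\<close>, which does not vanish where \<open>f\<close> does not.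

  The sheaf map \<open>A\<close> is surjective, so at each point some maximal minor of \<open>A\<close> is invertible
  (\<open>minor_cover\<close>), and Cramer's rule shows that \<open>\<Phi>\<close> maps the local fraction that defines \<open>z\<^sub>i\<close> to
  \<open>\<epsilon>\<^sub>i\<close>, whatever minor is used.  Hence \<open>P + \<Sum>\<^sub>i Q\<^sub>i z\<^sub>i\<close> has the coordinates \<open>P, Q\<^sub>0, Q\<^sub>1, \<dots>\<close>, and
  these are determined by the section (\<open>lin_comb_inject\<close>).

  Conversely let \<open>s\<close> be a section of degree \<open>d\<close>.  Each nonempty open set contains the generic point of
  the line, so the local fractions that represent \<open>s\<close> all have the same coordinates.  These coordinates
  have a representation without pole at each point of the line, and a rational function on the
  projective line without poles is a polynomial (\<open>regular_fraction_polynomial\<close>).  Therefore \<open>s\<close> is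
  \<open>P + \<Sum>\<^sub>i Q\<^sub>i z\<^sub>i\<close> with polynomial coefficients (\<open>section_lin_comb\<close>).  Summing over all degrees, the
  coefficient tuples identify the module of all sections with a free module over \<open>S\<close>.
\<close>

section \<open>Polynomials and their homogeneous components\<close>

abbreviation polys :: "nat set \<Rightarrow> 'k::field mpoly set" where
  "polys V \<equiv> carrier (mpoly_ring V)"

abbreviation "supp \<equiv> Poly_Mapping.keys"
abbreviation "coef \<equiv> Poly_Mapping.lookup"
abbreviation "monomial \<equiv> Poly_Mapping.single"

lemma mpoly_ring_simps [simp]:
  "\<one>\<^bsub>mpoly_ring V\<^esub> = 1" "\<zero>\<^bsub>mpoly_ring V\<^esub> = 0"
  "f \<otimes>\<^bsub>mpoly_ring V\<^esub> g = f * g" "f \<oplus>\<^bsub>mpoly_ring V\<^esub> g = f + g"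
  by (simp_all add: mpoly_ring_def)

lemma polys_iff: "f \<in> polys V \<longleftrightarrow> (\<forall>m\<in>supp f. supp m \<subseteq> V)"
  by (simp add: mpoly_ring_def)

lemma polys_UNIV [simp]: "f \<in> polys UNIV"
  by (simp add: polys_iff)

lemma polys_mono: "V \<subseteq> W \<Longrightarrow> f \<in> polys V \<Longrightarrow> f \<in> polys W"
  by (auto simp: polys_iff)

lemma supp_add_nat: "supp (m + m') = supp m \<union> supp (m' :: 'a \<Rightarrow>\<^sub>0 nat)"
  by (auto simp: in_keys_iff lookup_add)

lemma polys_zero [simp, intro]: "0 \<in> polys V"
  by (simp add: polys_iff)

lemma polys_monomial: "supp m \<subseteq> V \<Longrightarrow> monomial m c \<in> polys V"
  by (simp add: polys_iff)

lemma polys_one [simp, intro]: "1 \<in> polys V"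
  by (simp add: polys_iff)

lemma polys_Var [simp]: "Var v \<in> polys V \<longleftrightarrow> v \<in> V"
  by (simp add: polys_iff Var_def)

lemma polys_uminus [simp, intro]: "f \<in> polys V \<Longrightarrow> - f \<in> polys V"
  by (simp add: polys_iff in_keys_iff)

lemma polys_add [simp, intro]: "f \<in> polys V \<Longrightarrow> g \<in> polys V \<Longrightarrow> f + g \<in> polys V"
  unfolding polys_iff using Poly_Mapping.keys_add[of f g] by blast

lemma polys_diff [simp, intro]: "f \<in> polys V \<Longrightarrow> g \<in> polys V \<Longrightarrow> f - g \<in> polys V"
  using polys_add[of f V "- g"] by simp

lemma polys_mult [simp, intro]: "f \<in> polys V \<Longrightarrow> g \<in> polys V \<Longrightarrow> f * g \<in> polys V"
  unfolding polys_iff using Poly_Mapping.keys_mult[of f g] by (fastforce simp: supp_add_nat)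

lemma polys_sum [intro]: "(\<And>i. i \<in> X \<Longrightarrow> f i \<in> polys V) \<Longrightarrow> sum f X \<in> polys V"
  by (induction X rule: infinite_finite_induct) auto

lemma polys_prod [intro]: "(\<And>i. i \<in> X \<Longrightarrow> f i \<in> polys V) \<Longrightarrow> prod f X \<in> polys V"
  by (induction X rule: infinite_finite_induct) auto

lemma polys_power [simp, intro]: "f \<in> polys V \<Longrightarrow> f ^ N \<in> polys V"
  by (induction N) auto

lemma cring_mpoly_ring: "cring (mpoly_ring V)"
proof (rule cringI)
  show "abelian_group (mpoly_ring V)"
  proof (rule abelian_groupI)
    fix x assume "x \<in> polys V"
    then show "\<exists>y\<in>polys V. y \<oplus>\<^bsub>mpoly_ring V\<^esub> x = \<zero>\<^bsub>mpoly_ring V\<^esub>"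
      by (intro bexI[of _ "- x"]) auto
  qed (auto simp: add_ac)
  show "Group.comm_monoid (mpoly_ring V)"
    by (rule comm_monoidI) (auto simp: mult_ac)
qed (auto simp: algebra_simps)

lemma sum_monomials: "f = (\<Sum>m\<in>supp f. monomial m (coef f m))"
proof (rule poly_mapping_eqI)
  fix k
  have "coef (\<Sum>m\<in>supp f. monomial m (coef f m)) k = (\<Sum>m\<in>supp f. if m = k then coef f k else 0)"
    unfolding lookup_sum by (intro sum.cong) (auto simp: lookup_single when_def)
  also have "\<dots> = coef f k"
    by (simp add: in_keys_iff)
  finally show "coef f k = coef (\<Sum>m\<in>supp f. monomial m (coef f m)) k" by simp
qed

lemma mpoly_induct [consumes 1, case_names zero monomial add]:
  assumes f: "f \<in> polys V" and zero: "P 0"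
    and monomial: "\<And>m c. supp m \<subseteq> V \<Longrightarrow> P (monomial m c)"
    and add: "\<And>f g. f \<in> polys V \<Longrightarrow> g \<in> polys V \<Longrightarrow> P f \<Longrightarrow> P g \<Longrightarrow> P (f + g)"
  shows "P f"
proof -
  have "(\<Sum>m\<in>X. monomial m (coef f m)) \<in> polys V \<and> P (\<Sum>m\<in>X. monomial m (coef f m))"
    if "finite X" "X \<subseteq> supp f" for X
    using that
  proof (induction X)
    case (insert m X)
    then have "supp m \<subseteq> V" using f by (auto simp: polys_iff)
    with insert show ?case by (auto intro!: add monomial polys_monomial)
  qed (use zero in auto)
  from this[of "supp f"] show ?thesis
    using sum_monomials[of f] by simp
qed

text \<open>Taking homogeneous components and setting variables to zero are both of this form.\<close>

definition part :: "((nat \<Rightarrow>\<^sub>0 nat) \<Rightarrow> bool) \<Rightarrow> 'k::field mpoly \<Rightarrow> 'k mpoly" where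
  "part X f = (\<Sum>m\<in>{m\<in>supp f. X m}. monomial m (coef f m))"

lemma coef_part [simp]: "coef (part X f) k = (if X k then coef f k else 0)"
proof -
  have "coef (part X f) k = (\<Sum>m\<in>{m\<in>supp f. X m}. if m = k then coef f k else 0)"
    unfolding lookup_sum part_def by (intro sum.cong) (auto simp: lookup_single when_def)
  also have "\<dots> = (if X k then coef f k else 0)"
    by (simp add: in_keys_iff)
  finally show ?thesis .
qed

lemma part_add [simp]: "part X (f + g) = part X f + part X g"
  by (rule poly_mapping_eqI) (simp add: lookup_add)

lemma part_zero [simp]: "part X 0 = 0"
  by (rule poly_mapping_eqI) simp

lemma part_monomial: "part X (monomial m c) = (if X m then monomial m c else 0)"
  by (rule poly_mapping_eqI) (auto simp: lookup_single when_def)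

lemma supp_part: "supp (part X f) = {m \<in> supp f. X m}"
  unfolding Poly_Mapping.keys.rep_eq coef_part by auto

lemma polys_part [simp, intro]: "f \<in> polys V \<Longrightarrow> part X f \<in> polys V"
  by (simp add: polys_iff supp_part)

text \<open>With integer degrees, so that degrees can be shifted freely; the components of negative degree
  are zero.\<close>

definition hcomp :: "int \<Rightarrow> 'k::field mpoly \<Rightarrow> 'k mpoly" where
  "hcomp d = part (\<lambda>m. int (mdeg m) = d)"

lemma hom_comp_eq: "hom_comp e f = hcomp (int e) f"
  unfolding hom_comp_def hcomp_def part_def by simp

lemma coef_hcomp [simp]: "coef (hcomp d f) m = (if int (mdeg m) = d then coef f m else 0)"
  by (simp add: hcomp_def)

lemma hcomp_simps [simp]:
  "hcomp d (f + g) = hcomp d f + hcomp d g" "hcomp d 0 = 0"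
  "hcomp d (- f) = - hcomp d f" "hcomp d (f - g) = hcomp d f - hcomp d g"
  by (rule poly_mapping_eqI, simp add: lookup_add lookup_minus)+

lemma hcomp_sum: "hcomp d (sum f X) = (\<Sum>i\<in>X. hcomp d (f i))"
  by (induction X rule: infinite_finite_induct) auto

lemma polys_hcomp [simp, intro]: "f \<in> polys V \<Longrightarrow> hcomp d f \<in> polys V"
  by (simp add: hcomp_def)

lemma homog_hcomp [simp, intro]: "homog d (hcomp d f)"
  by (simp add: homog_def hcomp_def supp_part)

lemma homog_iff: "homog d f \<longleftrightarrow> hcomp d f = f"
proof
  assume "homog d f"
  then show "hcomp d f = f"
    by (intro poly_mapping_eqI) (auto simp: homog_def in_keys_iff)
next
  assume "hcomp d f = f"
  then show "homog d f" by (metis homog_hcomp)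
qed

lemma hcomp_homog: "homog d f \<Longrightarrow> hcomp e f = (if e = d then f else 0)"
  by (rule poly_mapping_eqI) (auto simp: homog_def in_keys_iff)

lemma hcomp_neg: "d < 0 \<Longrightarrow> hcomp d f = 0"
  by (rule poly_mapping_eqI) auto

lemma homog_zero [simp, intro]: "homog d 0"
  by (simp add: homog_def)

lemma mdeg_eq: "finite X \<Longrightarrow> supp m \<subseteq> X \<Longrightarrow> mdeg m = (\<Sum>v\<in>X. coef m v)"
  unfolding mdeg_def by (rule sum.mono_neutral_left) (auto simp: in_keys_iff)

lemma mdeg_add [simp]: "mdeg (m + m') = mdeg m + mdeg m'"
proof -
  have "mdeg (m + m') = (\<Sum>v\<in>supp m \<union> supp m'. coef m v + coef m' v)"
    by (subst mdeg_eq[of "supp m \<union> supp m'"]) (auto simp: supp_add_nat lookup_add)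
  then show ?thesis
    by (simp add: sum.distrib mdeg_eq[of "supp m \<union> supp m'"])
qed

lemma mdeg_single [simp]: "mdeg (monomial v e) = e"
  by (simp add: mdeg_def)

lemma homog_one [simp, intro]: "homog 0 1"
  by (simp add: homog_def mdeg_def)

lemma homog_Var [simp, intro]: "homog 1 (Var v)"
  by (simp add: homog_def Var_def)

lemma homog_uminus [simp, intro]: "homog d f \<Longrightarrow> homog d (- f)"
  by (simp add: homog_iff)

lemma homog_add [intro]: "homog d f \<Longrightarrow> homog d g \<Longrightarrow> homog d (f + g)"
  by (simp add: homog_iff)

lemma homog_diff [intro]: "homog d f \<Longrightarrow> homog d g \<Longrightarrow> homog d (f - g)"
  by (simp add: homog_iff)

lemma homog_sum [intro]: "(\<And>i. i \<in> X \<Longrightarrow> homog d (f i)) \<Longrightarrow> homog d (sum f X)"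
  by (induction X rule: infinite_finite_induct) auto

lemma homog_mult: "homog d f \<Longrightarrow> homog e g \<Longrightarrow> homog (d + e) (f * g)"
  unfolding homog_def using Poly_Mapping.keys_mult[of f g] by fastforce

lemma homog_mult': "homog d f \<Longrightarrow> homog e g \<Longrightarrow> c = d + e \<Longrightarrow> homog c (f * g)"
  by (simp add: homog_mult)

lemma homog_prod: "(\<And>i. i \<in> X \<Longrightarrow> homog (d i) (f i)) \<Longrightarrow> homog (sum d X) (prod f X)"
  by (induction X rule: infinite_finite_induct) (auto intro: homog_mult)

lemma homog_power: "homog d f \<Longrightarrow> homog (int N * d) (f ^ N)"
  by (induction N) (auto simp: algebra_simps intro: homog_mult')

text \<open>Without its component of degree \<open>d - e\<close>, the polynomial \<open>f\<close> contributes nothing to the degree \<open>d\<close> of the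
  product.\<close>

lemma hcomp_mult_homog:
  assumes g: "homog e g"
  shows "hcomp d (g * f) = g * hcomp (d - e) f"
proof -
  define h where "h = hcomp (d - e) f"
  have rest: "hcomp d (g * (f - h)) = 0"
  proof (rule poly_mapping_eqI)
    fix m
    show "coef (hcomp d (g * (f - h))) m = coef 0 m"
    proof (cases "m \<in> supp (g * (f - h)) \<and> int (mdeg m) = d")
      case True
      then obtain a b where ab: "m = a + b" "a \<in> supp g" "b \<in> supp (f - h)"
        using Poly_Mapping.keys_mult[of g "f - h"] by blast
      then have "int (mdeg a) = e" using g by (auto simp: homog_def)
      then have "int (mdeg b) = d - e" using True ab by simp
      then have "coef (f - h) b = 0" by (simp add: h_def lookup_minus)
      with ab show ?thesis by (simp add: in_keys_iff)
    qed (auto simp: in_keys_iff)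
  qed
  have "homog d (g * h)"
    by (rule homog_mult'[OF g, of "d - e"]) (auto simp: h_def)
  then have "hcomp d (g * h) = g * h" by (simp add: homog_iff)
  with rest show ?thesis
    using hcomp_simps(4)[of d "g * f" "g * h"] by (simp add: h_def algebra_simps)
qed

lemma hom_comp_support: "{e. hom_comp e f \<noteq> 0} = mdeg ` supp f"
proof (intro Set.set_eqI iffI)
  fix e assume "e \<in> {e. hom_comp e f \<noteq> 0}"
  then have "hom_comp e f \<noteq> 0" by simp
  then obtain m where "coef (hom_comp e f) m \<noteq> 0"
    by (metis lookup_zero poly_mapping_eqI)
  then have "mdeg m = e" "m \<in> supp f"
    by (simp_all add: hom_comp_eq in_keys_iff split: if_splits)
  then show "e \<in> mdeg ` supp f" by blast
next
  fix e assume "e \<in> mdeg ` supp f"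
  then obtain m where m: "m \<in> supp f" "e = mdeg m" by blast
  then have "coef (hom_comp e f) m \<noteq> 0" by (simp add: hom_comp_eq in_keys_iff)
  then show "e \<in> {e. hom_comp e f \<noteq> 0}" by auto
qed

lemma finite_hom_comp_support [simp]: "finite {e. hom_comp e f \<noteq> 0}"
  by (simp add: hom_comp_support)

lemma sum_hom_comp_superset:
  assumes "finite E" "{e. hom_comp e f \<noteq> 0} \<subseteq> E"
  shows "(\<Sum>e\<in>E. hom_comp e f) = f"
proof (rule poly_mapping_eqI)
  fix m
  have "coef (\<Sum>e\<in>E. hom_comp e f) m = (\<Sum>e\<in>E. if e = mdeg m then coef f m else 0)"
    unfolding lookup_sum by (intro sum.cong) (auto simp: hom_comp_eq)
  also have "\<dots> = (if mdeg m \<in> E then coef f m else 0)"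
    using assms(1) by simp
  also have "\<dots> = coef f m"
    using assms(2) unfolding hom_comp_support by (metis image_subset_iff in_keys_iff)
  finally show "coef (\<Sum>e\<in>E. hom_comp e f) m = coef f m" .
qed

lemma sum_hom_comp: "(\<Sum>e\<in>{e. hom_comp e f \<noteq> 0}. hom_comp e f) = f"
  by (rule sum_hom_comp_superset) auto

lemma homog_hom_comp [simp, intro]: "homog (int e) (hom_comp e f)"
  by (simp add: hom_comp_eq)

lemma polys_hom_comp [simp, intro]: "f \<in> polys V \<Longrightarrow> hom_comp e f \<in> polys V"
  by (simp add: hom_comp_eq)

lemma hcomp_mult:
  "hcomp d (f * g) = (\<Sum>e\<in>{e. hom_comp e f \<noteq> 0}. hom_comp e f * hcomp (d - int e) g)"
proof -
  have "hcomp d (f * g) = hcomp d ((\<Sum>e\<in>{e. hom_comp e f \<noteq> 0}. hom_comp e f) * g)"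
    by (simp add: sum_hom_comp)
  also have "\<dots> = (\<Sum>e\<in>{e. hom_comp e f \<noteq> 0}. hom_comp e f * hcomp (d - int e) g)"
    unfolding sum_distrib_right hcomp_sum
    by (intro sum.cong refl hcomp_mult_homog homog_hom_comp)
  finally show ?thesis .
qed


section \<open>Homogeneous prime ideals\<close>

lemma ideal_mpoly_iff:
  fixes J :: "'k::field mpoly set"
  shows
  "ideal J (mpoly_ring V) \<longleftrightarrow> J \<subseteq> polys V \<and> 0 \<in> J \<and> (\<forall>a\<in>J. \<forall>b\<in>J. a + b \<in> J) \<and>
     (\<forall>f\<in>polys V. \<forall>a\<in>J. f * a \<in> J)" (is "?L \<longleftrightarrow> ?R")
proof
  assume ?L
  then interpret ideal J "mpoly_ring V" .
  show ?R
    using a_subset additive_subgroup.zero_closed[OF is_additive_subgroup]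
      additive_subgroup.a_closed[OF is_additive_subgroup] I_l_closed by auto
next
  assume R: ?R
  interpret cring "mpoly_ring V" by (rule cring_mpoly_ring)
  have minus: "- a \<in> J" if "a \<in> J" for a
  proof -
    have "(- 1) * a \<in> J" using R that by blast
    then show ?thesis by simp
  qed
  have inv: "\<ominus>\<^bsub>mpoly_ring V\<^esub> a = - a" if "a \<in> polys V" for a
    using that by (intro minus_equality) auto
  show ?L
  proof (rule idealI)
    show "subgroup J (add_monoid (mpoly_ring V))"
    proof (rule group.subgroupI)
      show "Group.group (add_monoid (mpoly_ring V))" by (rule add.is_group)
      fix a assume "a \<in> J"
      then show "inv\<^bsub>add_monoid (mpoly_ring V)\<^esub> a \<in> J"
        using inv[of a] minus[of a] R by (auto simp: a_inv_def)
    qed (use R in auto)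
    show "ring (mpoly_ring V)" by (rule ring_axioms)
    fix a x :: "'k mpoly" assume ax: "a \<in> J" "x \<in> polys V"
    then have "x * a \<in> J" using R by blast
    then show "x \<otimes>\<^bsub>mpoly_ring V\<^esub> a \<in> J" "a \<otimes>\<^bsub>mpoly_ring V\<^esub> x \<in> J"
      by (simp_all add: mult.commute)
  qed
qed

lemma ideal_mpolyD:
  assumes "ideal J (mpoly_ring V)"
  shows "J \<subseteq> polys V" "0 \<in> J" "a \<in> J \<Longrightarrow> b \<in> J \<Longrightarrow> a + b \<in> J"
    "f \<in> polys V \<Longrightarrow> a \<in> J \<Longrightarrow> f * a \<in> J" "f \<in> polys V \<Longrightarrow> a \<in> J \<Longrightarrow> a * f \<in> J"
    "a \<in> J \<Longrightarrow> - a \<in> J" "a \<in> J \<Longrightarrow> b \<in> J \<Longrightarrow> a - b \<in> J"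
proof -
  note * = assms[unfolded ideal_mpoly_iff]
  show "J \<subseteq> polys V" "0 \<in> J" "a \<in> J \<Longrightarrow> b \<in> J \<Longrightarrow> a + b \<in> J"
    "f \<in> polys V \<Longrightarrow> a \<in> J \<Longrightarrow> f * a \<in> J" "f \<in> polys V \<Longrightarrow> a \<in> J \<Longrightarrow> a * f \<in> J"
    using * by (auto simp: mult.commute[of _ f])
  have minus: "- a \<in> J" if "a \<in> J" for a
  proof -
    have "(- 1) * a \<in> J" using * that by blast
    then show ?thesis by simp
  qed
  then show "a \<in> J \<Longrightarrow> - a \<in> J" .
  show "a \<in> J \<Longrightarrow> b \<in> J \<Longrightarrow> a - b \<in> J"
    using * minus[of b] by (metis uminus_add_conv_diff add.commute)
qed

lemma ideal_mpoly_sum: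
  assumes "ideal J (mpoly_ring V)" "\<And>i. i \<in> X \<Longrightarrow> f i \<in> J"
  shows "sum f X \<in> J"
  using assms(2) by (induction X rule: infinite_finite_induct) (auto intro: ideal_mpolyD[OF assms(1)])

lemma primeideal_mpoly_iff:
  "primeideal P (mpoly_ring V) \<longleftrightarrow> ideal P (mpoly_ring V) \<and> 1 \<notin> P \<and>
     (\<forall>a\<in>polys V. \<forall>b\<in>polys V. a * b \<in> P \<longrightarrow> a \<in> P \<or> b \<in> P)" (is "?L \<longleftrightarrow> ?R")
proof
  assume ?L
  then interpret primeideal P "mpoly_ring V" .
  have "ideal P (mpoly_ring V)" by (rule is_ideal)
  moreover have "1 \<notin> P" using I_notcarr one_imp_carrier by auto
  ultimately show ?R using I_prime by auto
next
  assume R: ?R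
  then show ?L
    by (intro primeidealI cring_mpoly_ring) auto
qed

lemma hom_ideal_mpolyD:
  assumes "hom_ideal V J"
  shows "ideal J (mpoly_ring V)" "f \<in> J \<Longrightarrow> hom_comp e f \<in> J" "f \<in> J \<Longrightarrow> hcomp d f \<in> J"
proof -
  show 1: "ideal J (mpoly_ring V)" and 2: "f \<in> J \<Longrightarrow> hom_comp e f \<in> J" for e
    using assms by (auto simp: hom_ideal_def)
  show "hcomp d f \<in> J" if "f \<in> J"
  proof (cases "d < 0")
    case True
    then show ?thesis by (simp add: hcomp_neg ideal_mpolyD(2)[OF 1])
  next
    case False
    with 2[OF that, of "nat d"] show ?thesis by (simp add: hom_comp_eq)
  qed
qed

lemma hom_ideal_principal:
  fixes g :: "'k::field mpoly"
  assumes g: "g \<in> polys V" "homog d g"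
  shows "hom_ideal V {g * f | f. f \<in> polys V}" (is "hom_ideal V ?E")
proof -
  have "ideal ?E (mpoly_ring V)"
    unfolding ideal_mpoly_iff
  proof (intro conjI ballI)
    show "?E \<subseteq> polys V" using g by auto
    show "0 \<in> ?E" by (intro CollectI exI[of _ 0]) auto
  next
    fix a b assume "a \<in> ?E" "b \<in> ?E"
    then obtain x y where "a = g * x" "b = g * y" "x \<in> polys V" "y \<in> polys V" by blast
    then have "a + b = g * (x + y)" "x + y \<in> polys V" by (simp_all add: distrib_left)
    then show "a + b \<in> ?E" by blast
  next
    fix f a :: "'k mpoly" assume "f \<in> polys V" "a \<in> ?E"
    then obtain x where "a = g * x" "x \<in> polys V" by blast
    then have "f * a = g * (f * x)" "f * x \<in> polys V" using \<open>f \<in> polys V\<close> by (simp_all add: mult_ac)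
    then show "f * a \<in> ?E" by blast
  qed
  moreover have "hom_comp e a \<in> ?E" if a: "a \<in> ?E" for e a
  proof -
    obtain x where x: "a = g * x" "x \<in> polys V" using a by blast
    then have "hom_comp e a = g * hcomp (int e - d) x" "hcomp (int e - d) x \<in> polys V"
      using hcomp_mult_homog[OF g(2)] by (simp_all add: hom_comp_eq)
    then show ?thesis by blast
  qed
  ultimately show ?thesis by (simp add: hom_ideal_def)
qed

text \<open>If \<open>a\<close>, \<open>b\<close> lie outside a homogeneous ideal, take the components of \<open>a\<close> and \<open>b\<close> of lowest degree
  outside it: modulo the ideal, their product is a component of \<open>a * b\<close>.\<close>

lemma primeideal_if_prime_on_homogeneous:
  fixes P :: "'k::field mpoly set"
  assumes hom: "hom_ideal V P" and one: "1 \<notin> P"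
    and prime: "\<And>a b d e. a \<in> polys V \<Longrightarrow> b \<in> polys V \<Longrightarrow> homog d a \<Longrightarrow> homog e b \<Longrightarrow>
      a * b \<in> P \<Longrightarrow> a \<in> P \<or> b \<in> P"
  shows "primeideal P (mpoly_ring V)"
  unfolding primeideal_mpoly_iff
proof (intro conjI ballI impI)
  note P = hom_ideal_mpolyD[OF hom]
  note idl = ideal_mpolyD[OF P(1)]
  show "ideal P (mpoly_ring V)" "1 \<notin> P" by (fact P one)+
  fix a b assume a: "a \<in> polys V" and b: "b \<in> polys V" and ab: "a * b \<in> P"
  show "a \<in> P \<or> b \<in> P"
  proof (rule ccontr)
    have ex: "\<exists>e. hom_comp e f \<notin> P" if "f \<notin> P" for f
      using that ideal_mpoly_sum[OF P(1), of _ "\<lambda>e. hom_comp e f"] by (metis sum_hom_comp)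
    assume "\<not> (a \<in> P \<or> b \<in> P)"
    then have "\<exists>e. hom_comp e a \<notin> P" "\<exists>e. hom_comp e b \<notin> P" using ex by auto
    define i where "i = (LEAST e. hom_comp e a \<notin> P)"
    define j where "j = (LEAST e. hom_comp e b \<notin> P)"
    have i: "hom_comp i a \<notin> P" "\<And>e. e < i \<Longrightarrow> hom_comp e a \<in> P"
      unfolding i_def using LeastI_ex[OF \<open>\<exists>e. hom_comp e a \<notin> P\<close>] not_less_Least by blast+
    have j: "hom_comp j b \<notin> P" "\<And>e. e < j \<Longrightarrow> hom_comp e b \<in> P"
      unfolding j_def using LeastI_ex[OF \<open>\<exists>e. hom_comp e b \<notin> P\<close>] not_less_Least by blast+
    let ?E = "{e. hom_comp e a \<noteq> 0}"
    let ?t = "\<lambda>e. hom_comp e a * hcomp (int (i + j) - int e) b"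
    have "i \<in> ?E" using i(1) idl(2) by auto
    have "hcomp (int (i + j)) (a * b) = ?t i + (\<Sum>e\<in>?E - {i}. ?t e)"
      unfolding hcomp_mult by (subst sum.remove[OF _ \<open>i \<in> ?E\<close>]) auto
    moreover have "(\<Sum>e\<in>?E - {i}. ?t e) \<in> P"
    proof (rule ideal_mpoly_sum[OF P(1)])
      fix e assume "e \<in> ?E - {i}"
      then consider "e < i" | "e > i" by force
      then show "?t e \<in> P"
      proof cases
        case 1
        then show ?thesis using b by (intro idl(5) i(2)) auto
      next
        case 2
        have "hcomp (int (i + j) - int e) b \<in> P"
        proof (cases "int (i + j) - int e < 0")
          case True
          then show ?thesis by (simp add: hcomp_neg idl)
        next
          case False
          with 2 have "hom_comp (i + j - e) b \<in> P" by (intro j(2)) auto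
          moreover have "int (i + j - e) = int (i + j) - int e" using False by simp
          ultimately show ?thesis by (simp add: hom_comp_eq)
        qed
        then show ?thesis using a by (intro idl(4)) auto
      qed
    qed
    ultimately have "?t i + (\<Sum>e\<in>?E - {i}. ?t e) - (\<Sum>e\<in>?E - {i}. ?t e) \<in> P"
      using P(3)[OF ab, of "int (i + j)"] by (intro idl(7)) simp_all
    then have "?t i \<in> P" by simp
    then have "hom_comp i a * hom_comp j b \<in> P" by (simp add: hom_comp_eq)
    then have "hom_comp i a \<in> P \<or> hom_comp j b \<in> P"
      by (rule prime[rotated 4]) (use a b in auto)
    with i(1) j(1) show False by blast
  qed
qed

text \<open>A homogeneous ideal that is maximal among those avoiding all powers of \<open>g\<close> is prime.\<close>

lemma hom_prime_avoiding:
  fixes J :: "'k::field mpoly set"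
  assumes J: "hom_ideal V J" and g: "g \<in> polys V" and avoid: "\<And>N. g ^ N \<notin> J"
  obtains P where "hom_ideal V P" "primeideal P (mpoly_ring V)" "J \<subseteq> P" "g \<notin> P"
proof -
  define \<A> where "\<A> = {M. hom_ideal V M \<and> J \<subseteq> M \<and> (\<forall>N. g ^ N \<notin> M)}"
  have "J \<in> \<A>" using assms by (auto simp: \<A>_def)
  have "\<exists>M\<in>\<A>. \<forall>X\<in>\<A>. M \<subseteq> X \<longrightarrow> X = M"
  proof (rule subset_Zorn_nonempty)
    fix C assume C: "C \<noteq> {}" "subset.chain \<A> C"
    then have mem: "\<And>M. M \<in> C \<Longrightarrow> hom_ideal V M \<and> J \<subseteq> M \<and> (\<forall>N. g ^ N \<notin> M)"
      and lin: "\<And>M M'. M \<in> C \<Longrightarrow> M' \<in> C \<Longrightarrow> M \<subseteq> M' \<or> M' \<subseteq> M"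
      by (auto simp: subset.chain_def \<A>_def)
    have "ideal (\<Union>C) (mpoly_ring V)"
      unfolding ideal_mpoly_iff
    proof (intro conjI ballI)
      show "\<Union>C \<subseteq> polys V" using mem hom_ideal_mpolyD(1) ideal_mpolyD(1) by blast
      show "0 \<in> \<Union>C" using C(1) mem hom_ideal_mpolyD(1) ideal_mpolyD(2) by blast
    next
      fix a b assume "a \<in> \<Union>C" "b \<in> \<Union>C"
      then obtain M where "M \<in> C" "a \<in> M" "b \<in> M" using lin by blast
      then show "a + b \<in> \<Union>C" using mem hom_ideal_mpolyD(1) ideal_mpolyD(3) by blast
    next
      fix f a :: "'k mpoly" assume "f \<in> polys V" "a \<in> \<Union>C"
      then show "f * a \<in> \<Union>C" using mem hom_ideal_mpolyD(1) ideal_mpolyD(4) by blast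
    qed
    moreover have "hom_comp e f \<in> \<Union>C" if "f \<in> \<Union>C" for f e
      using that mem hom_ideal_mpolyD(2) by blast
    ultimately have "hom_ideal V (\<Union>C)" by (simp add: hom_ideal_def)
    moreover have "J \<subseteq> \<Union>C" using mem C(1) by blast
    ultimately show "\<Union>C \<in> \<A>" using mem by (simp add: \<A>_def)
  qed (use \<open>J \<in> \<A>\<close> in auto)
  then obtain P where "P \<in> \<A>" and max: "\<And>X. X \<in> \<A> \<Longrightarrow> P \<subseteq> X \<Longrightarrow> X = P"
    by blast
  then have P: "hom_ideal V P" "J \<subseteq> P" "\<And>N. g ^ N \<notin> P"
    by (simp_all add: \<A>_def)
  note idl = ideal_mpolyD[OF hom_ideal_mpolyD(1)[OF P(1)]]
  \<comment> \<open>Adding a homogeneous element outside \<open>P\<close> gives a larger homogeneous ideal, which must contain a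
     power of \<open>g\<close>; multiplying two such powers shows that \<open>P\<close> is prime.\<close>
  have power_in: "\<exists>N m s. m \<in> P \<and> s \<in> polys V \<and> g ^ N = m + s * a"
    if a: "a \<in> polys V" "homog d a" "a \<notin> P" for a d
  proof (rule ccontr)
    assume no: "\<not> ?thesis"
    define X where "X = {m + s * a | m s. m \<in> P \<and> s \<in> polys V}"
    have "ideal X (mpoly_ring V)"
      unfolding ideal_mpoly_iff
    proof (intro conjI ballI)
      show "X \<subseteq> polys V" using a idl(1) by (auto simp: X_def intro!: polys_add polys_mult)
      have "0 = 0 + 0 * a" "(0 :: 'k mpoly) \<in> polys V" by simp_all
      with idl(2) show "0 \<in> X" unfolding X_def by blast
    next
      fix x y assume "x \<in> X" "y \<in> X"
      then obtain m s m' s' where "x = m + s * a" "y = m' + s' * a" "m \<in> P" "m' \<in> P"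
        "s \<in> polys V" "s' \<in> polys V" by (auto simp: X_def)
      then have "x + y = (m + m') + (s + s') * a" "m + m' \<in> P" "s + s' \<in> polys V"
        by (simp_all add: algebra_simps idl(3))
      then show "x + y \<in> X" unfolding X_def by blast
    next
      fix f x :: "'k mpoly" assume f: "f \<in> polys V" and "x \<in> X"
      then obtain m s where "x = m + s * a" "m \<in> P" "s \<in> polys V" by (auto simp: X_def)
      then have "f * x = f * m + (f * s) * a" "f * m \<in> P" "f * s \<in> polys V"
        using f by (simp_all add: algebra_simps idl(4))
      then show "f * x \<in> X" unfolding X_def by blast
    qed
    moreover have "hom_comp e x \<in> X" if x: "x \<in> X" for e x
    proof -
      obtain m s where "x = m + s * a" "m \<in> P" "s \<in> polys V" using x by (auto simp: X_def)
      moreover have "hom_comp e (s * a) = hcomp (int e - d) s * a"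
        using hcomp_mult_homog[OF a(2), of "int e" s] by (simp add: hom_comp_eq mult.commute)
      ultimately have "hom_comp e x = hom_comp e m + hcomp (int e - d) s * a"
        "hom_comp e m \<in> P" "hcomp (int e - d) s \<in> polys V"
        using hom_ideal_mpolyD(2)[OF P(1)] by (simp_all add: hom_comp_eq)
      then show ?thesis unfolding X_def by blast
    qed
    ultimately have "hom_ideal V X" by (simp add: hom_ideal_def)
    moreover have PX: "P \<subseteq> X"
    proof
      fix m assume "m \<in> P"
      then have "m = m + 0 * a" "(0 :: 'k mpoly) \<in> polys V" by simp_all
      with \<open>m \<in> P\<close> show "m \<in> X" unfolding X_def by blast
    qed
    moreover have "g ^ N \<notin> X" for N using no by (auto simp: X_def)
    ultimately have "X \<in> \<A>" using P(2) by (auto simp: \<A>_def)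
    then have "X = P" using max PX by blast
    moreover have "a = 0 + 1 * a" "(1 :: 'k mpoly) \<in> polys V" by simp_all
    then have "a \<in> X" unfolding X_def using idl(2) by blast
    ultimately show False using a(3) by simp
  qed
  have "primeideal P (mpoly_ring V)"
  proof (rule primeideal_if_prime_on_homogeneous[OF P(1)])
    show "1 \<notin> P" using P(3)[of 0] by simp
    fix a b d e assume ab: "a \<in> polys V" "b \<in> polys V" "homog d a" "homog e b" "a * b \<in> P"
    show "a \<in> P \<or> b \<in> P"
    proof (rule ccontr)
      assume "\<not> (a \<in> P \<or> b \<in> P)"
      then obtain N m s N' m' s' where 1: "m \<in> P" "s \<in> polys V" "g ^ N = m + s * a"
        and 2: "m' \<in> P" "s' \<in> polys V" "g ^ N' = m' + s' * b"
        using power_in ab by meson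
      have "g ^ (N + N') = m * (m' + s' * b) + (s * a) * m' + s * s' * (a * b)"
        by (simp add: power_add 1 2 algebra_simps)
      also have "\<dots> \<in> P"
      proof (intro idl(3))
        have "g ^ N' \<in> polys V" using g by simp
        then show "m * (m' + s' * b) \<in> P" using idl(5) 1 2 by simp
        show "(s * a) * m' \<in> P" by (rule idl(4)) (use 1 2 ab in simp_all)
        show "s * s' * (a * b) \<in> P" by (rule idl(4)) (use 1 2 ab in simp_all)
      qed
      finally show False using P(3) by simp
    qed
  qed
  moreover have "g \<notin> P" using P(3)[of 1] by simp
  ultimately show ?thesis using that P by blast
qed


section \<open>Localizations and the ring of sections\<close>

locale localization =
  fixes V :: "nat set" and I P :: "'k::field mpoly set"
  assumes ideal_I: "ideal I (mpoly_ring V)" and prime_P: "primeideal P (mpoly_ring V)"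
begin

abbreviation "\<L> \<equiv> loc V I P"

lemma denoms_polys: "f \<in> denoms V P \<Longrightarrow> f \<in> polys V"
  by (simp add: denoms_def)

lemma one_denoms [simp, intro]: "1 \<in> denoms V P"
  using prime_P by (auto simp: denoms_def primeideal_mpoly_iff)

lemma mult_denoms [simp, intro]: "f \<in> denoms V P \<Longrightarrow> g \<in> denoms V P \<Longrightarrow> f * g \<in> denoms V P"
  using prime_P by (auto simp: denoms_def primeideal_mpoly_iff intro: homog_mult)

lemma prod_denoms: "(\<And>i. i \<in> X \<Longrightarrow> f i \<in> denoms V P) \<Longrightarrow> prod f X \<in> denoms V P"
  by (induction X rule: infinite_finite_induct) auto

text \<open>The symmetric and transitive laws for the relation that defines fractions; for the latter the
  witness is multiplied by the middle denominator.\<close>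

lemma germ_eq_iff:
  assumes a: "a \<in> polys V" "f \<in> denoms V P" and b: "b \<in> polys V" "g \<in> denoms V P"
  shows "germ V I P a f = germ V I P b g \<longleftrightarrow> (\<exists>h\<in>denoms V P. h * (a * g - b * f) \<in> I)"
proof
  assume eq: "germ V I P a f = germ V I P b g"
  have "(b, g) \<in> germ V I P b g"
    using b ideal_mpolyD(2)[OF ideal_I] by (auto simp: germ_def mult.commute intro!: bexI[of _ 1])
  then have "(b, g) \<in> germ V I P a f" by (simp only: eq)
  then show "\<exists>h\<in>denoms V P. h * (a * g - b * f) \<in> I"
    by (simp add: germ_def)
next
  have sub: "germ V I P b g \<subseteq> germ V I P a f"
    if *: "a \<in> polys V" "f \<in> denoms V P" "b \<in> polys V" "g \<in> denoms V P"
      "h \<in> denoms V P" "h * (a * g - b * f) \<in> I" for a f b g h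
  proof
    fix x assume "x \<in> germ V I P b g"
    then obtain c k h' where x: "x = (c, k)" "c \<in> polys V" "k \<in> denoms V P" "h' \<in> denoms V P"
      "h' * (b * k - c * g) \<in> I" by (auto simp: germ_def)
    have "(h * h' * g) * (a * k - c * f) =
        (h' * k) * (h * (a * g - b * f)) + (h * f) * (h' * (b * k - c * g))"
      by (simp add: algebra_simps)
    also have "\<dots> \<in> I"
      using * x by (intro ideal_mpolyD(3)[OF ideal_I ideal_mpolyD(4)[OF ideal_I] ideal_mpolyD(4)[OF ideal_I]]) (auto dest: denoms_polys)
    finally show "x \<in> germ V I P a f"
      using * x by (auto simp: germ_def intro!: bexI[of _ "h * h' * g"])
  qed
  assume "\<exists>h\<in>denoms V P. h * (a * g - b * f) \<in> I"
  then obtain h where h: "h \<in> denoms V P" "h * (a * g - b * f) \<in> I" by blast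
  then have "h * (b * f - a * g) \<in> I"
    using ideal_mpolyD(6)[OF ideal_I h(2)] by (simp add: algebra_simps)
  with h show "germ V I P a f = germ V I P b g"
    using sub a b by blast
qed

lemma germ_eqI:
  assumes "a \<in> polys V" "f \<in> denoms V P" "b \<in> polys V" "g \<in> denoms V P" "a * g = b * f"
  shows "germ V I P a f = germ V I P b g"
  using assms ideal_mpolyD(2)[OF ideal_I] by (subst germ_eq_iff) (auto intro!: bexI[of _ 1])

lemma mem_germ_iff:
  assumes "a \<in> polys V" "f \<in> denoms V P"
  shows "x \<in> germ V I P a f \<longleftrightarrow> (\<exists>b g. x = (b, g) \<and> b \<in> polys V \<and> g \<in> denoms V P \<and>
    germ V I P a f = germ V I P b g)"
proof -
  have "(b, g) \<in> germ V I P a f \<longleftrightarrow> b \<in> polys V \<and> g \<in> denoms V P \<and> germ V I P a f = germ V I P b g"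
    for b g using germ_eq_iff[OF assms, of b g] by (auto simp: germ_def)
  then show ?thesis by (cases x) auto
qed

lemma loc_carrierI: "a \<in> polys V \<Longrightarrow> f \<in> denoms V P \<Longrightarrow> germ V I P a f \<in> carrier \<L>"
  by (auto simp: loc_def)

lemma loc_carrierE:
  assumes "x \<in> carrier \<L>"
  obtains a f where "a \<in> polys V" "f \<in> denoms V P" "x = germ V I P a f"
  using assms by (auto simp: loc_def)

lemma loc_one: "\<one>\<^bsub>\<L>\<^esub> = germ V I P 1 1" and loc_zero: "\<zero>\<^bsub>\<L>\<^esub> = germ V I P 0 1"
  by (simp_all add: loc_def)

text \<open>The operations of the localization are unions over all representatives.  They are single germs
  because the result does not depend on the representatives.\<close>

lemma add_germ:
  assumes a: "a \<in> polys V" "f \<in> denoms V P" and b: "b \<in> polys V" "g \<in> denoms V P"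
  shows "germ V I P a f \<oplus>\<^bsub>\<L>\<^esub> germ V I P b g = germ V I P (a * g + b * f) (f * g)"
proof -
  have eq: "germ V I P (a' * g' + b' * f') (f' * g') = germ V I P (a * g + b * f) (f * g)"
    if *: "(a', f') \<in> germ V I P a f" "(b', g') \<in> germ V I P b g" for a' f' b' g'
  proof -
    obtain h k where h: "h \<in> denoms V P" "h * (a * f' - a' * f) \<in> I"
      and k: "k \<in> denoms V P" "k * (b * g' - b' * g) \<in> I"
      and 1: "a' \<in> polys V" "b' \<in> polys V" "f' \<in> denoms V P" "g' \<in> denoms V P"
      using * by (auto simp: germ_def)
    have "(h * k) * ((a * g + b * f) * (f' * g') - (a' * g' + b' * f') * (f * g)) =
      (k * g * g') * (h * (a * f' - a' * f)) + (h * f * f') * (k * (b * g' - b' * g))"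
      by (simp add: algebra_simps)
    also have "\<dots> \<in> I"
      using h k 1 a b by (intro ideal_mpolyD(3)[OF ideal_I ideal_mpolyD(4)[OF ideal_I] ideal_mpolyD(4)[OF ideal_I]]) (auto dest: denoms_polys)
    finally have "\<exists>h\<in>denoms V P. h * ((a * g + b * f) * (f' * g') - (a' * g' + b' * f') * (f * g)) \<in> I"
      using h k by blast
    then show ?thesis
      using 1 a b by (intro germ_eq_iff[THEN iffD2, symmetric]) (auto dest: denoms_polys)
  qed
  have ne: "(a, f) \<in> germ V I P a f" "(b, g) \<in> germ V I P b g"
    using a b by (auto simp: mem_germ_iff)
  show ?thesis
    unfolding loc_def ring.simps
  proof (intro equalityI)
    show "(\<Union>(a, f)\<in>germ V I P a f. \<Union>(b, g)\<in>germ V I P b g. germ V I P (a * g + b * f) (f * g))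
        \<subseteq> germ V I P (a * g + b * f) (f * g)"
      using eq by auto
    show "germ V I P (a * g + b * f) (f * g)
        \<subseteq> (\<Union>(a, f)\<in>germ V I P a f. \<Union>(b, g)\<in>germ V I P b g. germ V I P (a * g + b * f) (f * g))"
      using ne by blast
  qed
qed

lemma mult_germ:
  assumes a: "a \<in> polys V" "f \<in> denoms V P" and b: "b \<in> polys V" "g \<in> denoms V P"
  shows "germ V I P a f \<otimes>\<^bsub>\<L>\<^esub> germ V I P b g = germ V I P (a * b) (f * g)"
proof -
  have eq: "germ V I P (a' * b') (f' * g') = germ V I P (a * b) (f * g)"
    if *: "(a', f') \<in> germ V I P a f" "(b', g') \<in> germ V I P b g" for a' f' b' g'
  proof -
    obtain h k where h: "h \<in> denoms V P" "h * (a * f' - a' * f) \<in> I"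
      and k: "k \<in> denoms V P" "k * (b * g' - b' * g) \<in> I"
      and 1: "a' \<in> polys V" "b' \<in> polys V" "f' \<in> denoms V P" "g' \<in> denoms V P"
      using * by (auto simp: germ_def)
    have "(h * k) * ((a * b) * (f' * g') - (a' * b') * (f * g)) =
      (k * b * g') * (h * (a * f' - a' * f)) + (h * a' * f) * (k * (b * g' - b' * g))"
      by (simp add: algebra_simps)
    also have "\<dots> \<in> I"
      using h k 1 a b by (intro ideal_mpolyD(3)[OF ideal_I ideal_mpolyD(4)[OF ideal_I] ideal_mpolyD(4)[OF ideal_I]]) (auto dest: denoms_polys)
    finally have "\<exists>h\<in>denoms V P. h * ((a * b) * (f' * g') - (a' * b') * (f * g)) \<in> I"
      using h k by blast
    then show ?thesis
      using 1 a b by (intro germ_eq_iff[THEN iffD2, symmetric]) (auto dest: denoms_polys)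
  qed
  have ne: "(a, f) \<in> germ V I P a f" "(b, g) \<in> germ V I P b g"
    using a b by (auto simp: mem_germ_iff)
  show ?thesis
    unfolding loc_def monoid.simps
  proof (intro equalityI)
    show "(\<Union>(a, f)\<in>germ V I P a f. \<Union>(b, g)\<in>germ V I P b g. germ V I P (a * b) (f * g))
        \<subseteq> germ V I P (a * b) (f * g)"
      using eq by auto
    show "germ V I P (a * b) (f * g)
        \<subseteq> (\<Union>(a, f)\<in>germ V I P a f. \<Union>(b, g)\<in>germ V I P b g. germ V I P (a * b) (f * g))"
      using ne by blast
  qed
qed

lemma add_germ_same:
  assumes "a \<in> polys V" "b \<in> polys V" "f \<in> denoms V P"
  shows "germ V I P a f \<oplus>\<^bsub>\<L>\<^esub> germ V I P b f = germ V I P (a + b) f"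
proof -
  have "germ V I P (a * f + b * f) (f * f) = germ V I P (a + b) f"
    by (rule germ_eqI) (use assms in \<open>auto dest: denoms_polys simp: algebra_simps\<close>)
  with assms show ?thesis by (simp add: add_germ)
qed

lemma cring_loc: "cring \<L>"
proof (rule cringI)
  show "abelian_group \<L>"
  proof (rule abelian_groupI)
    fix x y assume "x \<in> carrier \<L>" "y \<in> carrier \<L>"
    then show "x \<oplus>\<^bsub>\<L>\<^esub> y \<in> carrier \<L>" "x \<oplus>\<^bsub>\<L>\<^esub> y = y \<oplus>\<^bsub>\<L>\<^esub> x"
      by (auto elim!: loc_carrierE simp: add_germ denoms_polys add.commute mult.commute intro!: loc_carrierI)
  next
    fix x y z assume "x \<in> carrier \<L>" "y \<in> carrier \<L>" "z \<in> carrier \<L>"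
    then show "(x \<oplus>\<^bsub>\<L>\<^esub> y) \<oplus>\<^bsub>\<L>\<^esub> z = x \<oplus>\<^bsub>\<L>\<^esub> (y \<oplus>\<^bsub>\<L>\<^esub> z)"
      by (auto elim!: loc_carrierE simp: add_germ denoms_polys algebra_simps)
  next
    show "\<zero>\<^bsub>\<L>\<^esub> \<in> carrier \<L>" by (simp add: loc_zero loc_carrierI)
  next
    fix x assume "x \<in> carrier \<L>"
    then show "\<zero>\<^bsub>\<L>\<^esub> \<oplus>\<^bsub>\<L>\<^esub> x = x"
      by (auto elim!: loc_carrierE simp: add_germ denoms_polys loc_zero)
  next
    fix x assume "x \<in> carrier \<L>"
    then obtain a f where x: "a \<in> polys V" "f \<in> denoms V P" "x = germ V I P a f"
      by (rule loc_carrierE)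
    have "germ V I P 0 f = germ V I P 0 1"
      by (rule germ_eqI) (use x in auto)
    then have "germ V I P (- a) f \<oplus>\<^bsub>\<L>\<^esub> x = \<zero>\<^bsub>\<L>\<^esub>"
      using x by (simp add: add_germ_same loc_zero)
    with x show "\<exists>y\<in>carrier \<L>. y \<oplus>\<^bsub>\<L>\<^esub> x = \<zero>\<^bsub>\<L>\<^esub>" by (auto intro!: loc_carrierI)
  qed
  show "Group.comm_monoid \<L>"
  proof (rule comm_monoidI)
    fix x y assume "x \<in> carrier \<L>" "y \<in> carrier \<L>"
    then show "x \<otimes>\<^bsub>\<L>\<^esub> y \<in> carrier \<L>" "x \<otimes>\<^bsub>\<L>\<^esub> y = y \<otimes>\<^bsub>\<L>\<^esub> x"
      by (auto elim!: loc_carrierE simp: mult_germ denoms_polys mult.commute intro!: loc_carrierI)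
  next
    fix x y z assume "x \<in> carrier \<L>" "y \<in> carrier \<L>" "z \<in> carrier \<L>"
    then show "(x \<otimes>\<^bsub>\<L>\<^esub> y) \<otimes>\<^bsub>\<L>\<^esub> z = x \<otimes>\<^bsub>\<L>\<^esub> (y \<otimes>\<^bsub>\<L>\<^esub> z)"
      by (auto elim!: loc_carrierE simp: mult_germ denoms_polys algebra_simps)
  next
    show "\<one>\<^bsub>\<L>\<^esub> \<in> carrier \<L>" by (simp add: loc_one loc_carrierI)
  next
    fix x assume "x \<in> carrier \<L>"
    then show "\<one>\<^bsub>\<L>\<^esub> \<otimes>\<^bsub>\<L>\<^esub> x = x"
      by (auto elim!: loc_carrierE simp: mult_germ denoms_polys loc_one)
  qed
  fix x y z assume "x \<in> carrier \<L>" "y \<in> carrier \<L>" "z \<in> carrier \<L>"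
  then obtain a f b g c h where xyz: "a \<in> polys V" "f \<in> denoms V P" "x = germ V I P a f"
    "b \<in> polys V" "g \<in> denoms V P" "y = germ V I P b g"
    "c \<in> polys V" "h \<in> denoms V P" "z = germ V I P c h"
    by (metis loc_carrierE)
  have "germ V I P ((a * g + b * f) * c) (f * g * h) =
      germ V I P (a * c * (g * h) + b * c * (f * h)) (f * h * (g * h))"
    by (rule germ_eqI) (use xyz in \<open>auto simp: denoms_polys algebra_simps\<close>)
  then show "(x \<oplus>\<^bsub>\<L>\<^esub> y) \<otimes>\<^bsub>\<L>\<^esub> z = x \<otimes>\<^bsub>\<L>\<^esub> z \<oplus>\<^bsub>\<L>\<^esub> y \<otimes>\<^bsub>\<L>\<^esub> z"
    using xyz by (simp add: add_germ mult_germ denoms_polys)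
qed

sublocale loc: cring \<L> by (rule cring_loc)

lemma finsum_germ_same:
  assumes "finite X" "\<And>j. j \<in> X \<Longrightarrow> c j \<in> polys V" "f \<in> denoms V P"
  shows "(\<Oplus>\<^bsub>\<L>\<^esub>j\<in>X. germ V I P (c j) f) = germ V I P (\<Sum>j\<in>X. c j) f"
  using assms(1,2)
proof (induction X)
  case empty
  have "germ V I P 0 1 = germ V I P 0 f"
    by (rule germ_eqI) (use assms(3) in auto)
  then show ?case by (simp add: loc_zero)
next
  case (insert x X)
  then have "(\<Oplus>\<^bsub>\<L>\<^esub>j\<in>insert x X. germ V I P (c j) f) =
      germ V I P (c x) f \<oplus>\<^bsub>\<L>\<^esub> germ V I P (\<Sum>j\<in>X. c j) f"
    using assms(3) by (subst loc.finsum_insert) (auto intro!: loc_carrierI)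
  also have "\<dots> = germ V I P (\<Sum>j\<in>insert x X. c j) f"
    using insert assms(3) by (subst add_germ_same) (auto intro!: polys_sum)
  finally show ?case .
qed

text \<open>This brings a vector of germs into the form in which a matrix can be applied to it.\<close>

lemma stalk_common_denominator:
  fixes N :: nat
  assumes "\<And>j. j < N \<Longrightarrow> w j \<in> stalk V I (d j) P"
  obtains b g where "g \<in> denoms V P" "\<And>j. j < N \<Longrightarrow> b j \<in> polys V"
    "\<And>j. j < N \<Longrightarrow> w j = germ V I P (b j) g"
proof -
  have "\<forall>j\<in>{..<N}. \<exists>x. fst x \<in> polys V \<and> snd x \<in> denoms V P \<and> w j = germ V I P (fst x) (snd x)"
    using assms by (fastforce simp: stalk_def)
  then obtain x where x: "\<And>j. j < N \<Longrightarrow> fst (x j) \<in> polys V \<and> snd (x j) \<in> denoms V P \<and>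
      w j = germ V I P (fst (x j)) (snd (x j))"
    by (metis lessThan_iff)
  show ?thesis
  proof (rule that[of "\<Prod>j<N. snd (x j)" "\<lambda>j. fst (x j) * (\<Prod>i\<in>{..<N} - {j}. snd (x i))"])
    show *: "(\<Prod>j<N. snd (x j)) \<in> denoms V P" using x by (intro prod_denoms) auto
    fix j assume j: "j < N"
    have d: "(\<Prod>i\<in>{..<N} - {j}. snd (x i)) \<in> denoms V P" using x by (intro prod_denoms) auto
    then show **: "fst (x j) * (\<Prod>i\<in>{..<N} - {j}. snd (x i)) \<in> polys V"
      using x[OF j] denoms_polys by auto
    have "(\<Prod>i<N. snd (x i)) = snd (x j) * (\<Prod>i\<in>{..<N} - {j}. snd (x i))"
      using j by (intro prod.remove) auto
    then have "germ V I P (fst (x j)) (snd (x j)) =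
        germ V I P (fst (x j) * (\<Prod>i\<in>{..<N} - {j}. snd (x i))) (\<Prod>j<N. snd (x j))"
      using x[OF j] * ** by (intro germ_eqI) (simp_all add: mult_ac)
    then show "w j = germ V I P (fst (x j) * (\<Prod>i\<in>{..<N} - {j}. snd (x i))) (\<Prod>j<N. snd (x j))"
      using x[OF j] by simp
  qed
qed

end

lemma Proj_D:
  assumes "P \<in> Proj V I"
  shows "hom_ideal V P" "primeideal P (mpoly_ring V)" "I \<subseteq> P" "\<not> Var ` V \<subseteq> P"
  using assms by (auto simp: Proj_def)

lemma localization_Proj: "ideal I (mpoly_ring V) \<Longrightarrow> P \<in> Proj V I \<Longrightarrow> localization V I P"
  by (simp add: localization_def Proj_D)

locale proj_scheme =
  fixes V :: "nat set" and I :: "'k::field mpoly set"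
  assumes ideal_I: "ideal I (mpoly_ring V)"
begin

abbreviation "\<S> \<equiv> sec_ring V I"

lemma localization: "P \<in> Proj V I \<Longrightarrow> localization V I P"
  by (rule localization_Proj[OF ideal_I])

lemma cring_loc: "P \<in> Proj V I \<Longrightarrow> cring (loc V I P)"
  using localization.cring_loc[OF localization] .

lemma sec_carrier: "carrier \<S> = (\<Pi>\<^sub>E P\<in>Proj V I. carrier (loc V I P))"
  and sec_mult: "s \<otimes>\<^bsub>\<S>\<^esub> s' = (\<lambda>P\<in>Proj V I. s P \<otimes>\<^bsub>loc V I P\<^esub> s' P)"
  and sec_add: "s \<oplus>\<^bsub>\<S>\<^esub> s' = (\<lambda>P\<in>Proj V I. s P \<oplus>\<^bsub>loc V I P\<^esub> s' P)"
  and sec_one: "\<one>\<^bsub>\<S>\<^esub> = (\<lambda>P\<in>Proj V I. \<one>\<^bsub>loc V I P\<^esub>)"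
  and sec_zero: "\<zero>\<^bsub>\<S>\<^esub> = (\<lambda>P\<in>Proj V I. \<zero>\<^bsub>loc V I P\<^esub>)"
  by (simp_all add: sec_ring_def)

lemmas sec_simps = sec_mult sec_add sec_one sec_zero

lemma sec_eqI:
  assumes "s \<in> carrier \<S>" "s' \<in> carrier \<S>" "\<And>P. P \<in> Proj V I \<Longrightarrow> s P = s' P"
  shows "s = s'"
  using assms unfolding sec_carrier by (rule PiE_ext)

lemma sec_carrierD: "s \<in> carrier \<S> \<Longrightarrow> P \<in> Proj V I \<Longrightarrow> s P \<in> carrier (loc V I P)"
  by (auto simp: sec_carrier)

lemma sec_carrier_restrict:
  "(\<And>P. P \<in> Proj V I \<Longrightarrow> f P \<in> carrier (loc V I P)) \<Longrightarrow> (\<lambda>P\<in>Proj V I. f P) \<in> carrier \<S>"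
  by (auto simp: sec_carrier)

lemma sec_closed:
  "s \<in> carrier \<S> \<Longrightarrow> s' \<in> carrier \<S> \<Longrightarrow> s \<oplus>\<^bsub>\<S>\<^esub> s' \<in> carrier \<S>"
  "s \<in> carrier \<S> \<Longrightarrow> s' \<in> carrier \<S> \<Longrightarrow> s \<otimes>\<^bsub>\<S>\<^esub> s' \<in> carrier \<S>"
  "\<zero>\<^bsub>\<S>\<^esub> \<in> carrier \<S>" "\<one>\<^bsub>\<S>\<^esub> \<in> carrier \<S>"
  unfolding sec_simps
  by (auto intro!: sec_carrier_restrict cring.cring_simprules(1,2,5,6) cring_loc dest: sec_carrierD)

lemma cring_sec: "cring \<S>"
proof (rule cringI)
  note c = cring_loc sec_carrierD sec_closed
  show "abelian_group \<S>"
  proof (rule abelian_groupI)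
    fix x y z assume xyz: "x \<in> carrier \<S>" "y \<in> carrier \<S>" "z \<in> carrier \<S>"
    show "(x \<oplus>\<^bsub>\<S>\<^esub> y) \<oplus>\<^bsub>\<S>\<^esub> z = x \<oplus>\<^bsub>\<S>\<^esub> (y \<oplus>\<^bsub>\<S>\<^esub> z)"
      by (rule sec_eqI) (use xyz in \<open>simp_all add: c\<close>, simp add: sec_simps cring.cring_simprules(7) c)
  next
    fix x y assume xy: "x \<in> carrier \<S>" "y \<in> carrier \<S>"
    show "x \<oplus>\<^bsub>\<S>\<^esub> y = y \<oplus>\<^bsub>\<S>\<^esub> x"
      by (rule sec_eqI) (use xy in \<open>simp_all add: c\<close>, simp add: sec_simps cring.cring_simprules(10) c)
  next
    fix x assume x: "x \<in> carrier \<S>"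
    show "\<zero>\<^bsub>\<S>\<^esub> \<oplus>\<^bsub>\<S>\<^esub> x = x"
      by (rule sec_eqI) (use x in \<open>simp_all add: c\<close>, simp add: sec_simps cring.cring_simprules(8) c)
    define y where "y = (\<lambda>P\<in>Proj V I. \<ominus>\<^bsub>loc V I P\<^esub> x P)"
    have y: "y \<in> carrier \<S>"
      unfolding y_def by (rule sec_carrier_restrict) (use x in \<open>simp add: c cring.cring_simprules(3)\<close>)
    have "y \<oplus>\<^bsub>\<S>\<^esub> x = \<zero>\<^bsub>\<S>\<^esub>"
      by (rule sec_eqI) (use x y in \<open>simp_all add: c\<close>, simp add: y_def sec_simps cring.cring_simprules(9) c)
    with y show "\<exists>y\<in>carrier \<S>. y \<oplus>\<^bsub>\<S>\<^esub> x = \<zero>\<^bsub>\<S>\<^esub>" by blast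
  qed (rule sec_closed; assumption)+
  show "Group.comm_monoid \<S>"
  proof (rule comm_monoidI)
    fix x y z assume xyz: "x \<in> carrier \<S>" "y \<in> carrier \<S>" "z \<in> carrier \<S>"
    show "(x \<otimes>\<^bsub>\<S>\<^esub> y) \<otimes>\<^bsub>\<S>\<^esub> z = x \<otimes>\<^bsub>\<S>\<^esub> (y \<otimes>\<^bsub>\<S>\<^esub> z)"
      by (rule sec_eqI) (use xyz in \<open>simp_all add: c\<close>, simp add: sec_simps cring.cring_simprules(11) c)
  next
    fix x y assume xy: "x \<in> carrier \<S>" "y \<in> carrier \<S>"
    show "x \<otimes>\<^bsub>\<S>\<^esub> y = y \<otimes>\<^bsub>\<S>\<^esub> x"
      by (rule sec_eqI) (use xy in \<open>simp_all add: c\<close>, simp add: sec_simps cring.cring_simprules(14) c)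
  next
    fix x assume x: "x \<in> carrier \<S>"
    show "\<one>\<^bsub>\<S>\<^esub> \<otimes>\<^bsub>\<S>\<^esub> x = x"
      by (rule sec_eqI) (use x in \<open>simp_all add: c\<close>, simp add: sec_simps cring.cring_simprules(12) c)
  qed (rule sec_closed; assumption)+
  fix x y z assume xyz: "x \<in> carrier \<S>" "y \<in> carrier \<S>" "z \<in> carrier \<S>"
  show "(x \<oplus>\<^bsub>\<S>\<^esub> y) \<otimes>\<^bsub>\<S>\<^esub> z = x \<otimes>\<^bsub>\<S>\<^esub> z \<oplus>\<^bsub>\<S>\<^esub> y \<otimes>\<^bsub>\<S>\<^esub> z"
    by (rule sec_eqI) (use xyz in \<open>simp_all add: c\<close>, simp add: sec_simps cring.cring_simprules(13) c)
qed

sublocale sec: cring \<S> by (rule cring_sec)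

lemma finsum_sec_apply:
  assumes "finite X" "\<And>i. i \<in> X \<Longrightarrow> F i \<in> carrier \<S>" "P \<in> Proj V I"
  shows "(\<Oplus>\<^bsub>\<S>\<^esub>i\<in>X. F i) P = (\<Oplus>\<^bsub>loc V I P\<^esub>i\<in>X. F i P)"
proof -
  interpret L: cring "loc V I P" by (rule cring_loc) fact
  show ?thesis using assms(1,2)
  proof (induction X)
    case empty
    show ?case using assms(3) by (simp add: sec_zero)
  next
    case (insert x X)
    then have "(\<Oplus>\<^bsub>\<S>\<^esub>i\<in>insert x X. F i) = F x \<oplus>\<^bsub>\<S>\<^esub> (\<Oplus>\<^bsub>\<S>\<^esub>i\<in>X. F i)"
      by (intro sec.finsum_insert) auto
    moreover have "(\<Oplus>\<^bsub>loc V I P\<^esub>i\<in>insert x X. F i P) =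
        F x P \<oplus>\<^bsub>loc V I P\<^esub> (\<Oplus>\<^bsub>loc V I P\<^esub>i\<in>X. F i P)"
      using insert assms(3) by (intro L.finsum_insert) (auto intro!: sec_carrierD)
    ultimately show ?case using insert assms(3) by (simp add: sec_add)
  qed
qed

lemma poly_sec_apply: "P \<in> Proj V I \<Longrightarrow> poly_sec V I f P = germ V I P f 1"
  by (simp add: poly_sec_def)

lemma poly_sec_carrier [simp, intro]: "f \<in> polys V \<Longrightarrow> poly_sec V I f \<in> carrier \<S>"
  unfolding poly_sec_def
  by (rule sec_carrier_restrict) (auto intro!: localization.loc_carrierI localization localization.one_denoms)

end


section \<open>Expansion along a line\<close>

abbreviation "\<epsilon> j \<equiv> monomial j (Suc 0)"

text \<open>If \<open>L\<close> is the set of variables of the line, these are the coefficients of the expansion of \<open>f\<close> along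
  the line to first order: the restriction to the line, and the coefficient of the variable \<open>j\<close>, which is
  found by shifting the exponents by \<open>\<epsilon> j\<close>.\<close>

definition const_part :: "nat set \<Rightarrow> 'k::field mpoly \<Rightarrow> 'k mpoly" where
  "const_part L = part (\<lambda>m. supp m \<subseteq> L)"

definition lin_part :: "nat set \<Rightarrow> nat \<Rightarrow> 'k::field mpoly \<Rightarrow> 'k mpoly" where
  "lin_part L j f = part (\<lambda>m. supp m \<subseteq> L) (Poly_Mapping.map_key (\<lambda>m. m + \<epsilon> j) f)"

lemma inj_shift: "inj (\<lambda>m :: nat \<Rightarrow>\<^sub>0 nat. m + \<epsilon> j)"
  by (simp add: inj_def)

lemma coef_const_part: "coef (const_part L f) m = (if supp m \<subseteq> L then coef f m else 0)"
  by (simp add: const_part_def)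

lemma coef_lin_part: "coef (lin_part L j f) m = (if supp m \<subseteq> L then coef f (m + \<epsilon> j) else 0)"
  by (simp add: lin_part_def Poly_Mapping.map_key.rep_eq[OF inj_shift])

lemma const_part_add [simp]: "const_part L (f + g) = const_part L f + const_part L g"
  and const_part_zero [simp]: "const_part L 0 = 0"
  and const_part_diff [simp]: "const_part L (f - g) = const_part L f - const_part L g"
  by (rule poly_mapping_eqI, simp add: coef_const_part lookup_add lookup_minus)+

lemma lin_part_add [simp]: "lin_part L j (f + g) = lin_part L j f + lin_part L j g"
  and lin_part_zero [simp]: "lin_part L j 0 = 0"
  and lin_part_diff [simp]: "lin_part L j (f - g) = lin_part L j f - lin_part L j g"
  by (rule poly_mapping_eqI, simp add: coef_lin_part lookup_add lookup_minus)+

lemma const_part_sum: "const_part L (sum f X) = (\<Sum>i\<in>X. const_part L (f i))"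
  by (induction X rule: infinite_finite_induct) auto

lemma polys_const_part [simp, intro]: "const_part L f \<in> polys L"
  and polys_lin_part [simp, intro]: "lin_part L j f \<in> polys L"
  by (auto simp: polys_iff const_part_def lin_part_def supp_part)

lemma const_part_polys: "f \<in> polys L \<Longrightarrow> const_part L f = f"
  by (rule poly_mapping_eqI) (auto simp: coef_const_part polys_iff in_keys_iff)

lemma lin_part_polys:
  assumes f: "f \<in> polys L" "j \<notin> L"
  shows "lin_part L j f = 0"
proof (rule poly_mapping_eqI)
  fix m
  from f have "m + \<epsilon> j \<notin> supp f" by (auto simp: polys_iff supp_add_nat)
  then show "coef (lin_part L j f) m = coef 0 m" by (simp add: coef_lin_part in_keys_iff)
qed

lemma const_part_hcomp: "const_part L (hcomp d f) = hcomp d (const_part L f)"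
  by (rule poly_mapping_eqI) (simp add: coef_const_part)

lemma homog_const_part: "homog d f \<Longrightarrow> homog d (const_part L f)"
  by (auto simp: homog_def const_part_def supp_part)

lemma homog_lin_part:
  assumes "homog d f"
  shows "homog (d - 1) (lin_part L j f)"
  unfolding homog_def
proof
  fix m assume "m \<in> supp (lin_part L j f)"
  then have "m + \<epsilon> j \<in> supp f" by (auto simp: in_keys_iff coef_lin_part split: if_splits)
  then have "int (mdeg (m + \<epsilon> j)) = d" using assms by (auto simp: homog_def)
  then show "int (mdeg m) = d - 1" by simp
qed

lemma const_part_monomial: "const_part L (monomial m c) = (if supp m \<subseteq> L then monomial m c else 0)"
  by (simp add: const_part_def part_monomial)

lemma supp_shift: "v \<in> supp (m + \<epsilon> v)"
  by (simp add: in_keys_iff lookup_add)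

lemma lin_part_monomial0: "supp m \<subseteq> L \<Longrightarrow> j \<notin> L \<Longrightarrow> lin_part L j (monomial m c) = 0"
  by (intro lin_part_polys polys_monomial)

lemma lin_part_monomial1:
  assumes "supp m \<subseteq> L" "v \<notin> L" "j \<notin> L"
  shows "lin_part L j (monomial (m + \<epsilon> v) c) = (if v = j then monomial m c else 0)"
proof (rule poly_mapping_eqI)
  fix k
  have "v = j" if "m + \<epsilon> v = k + \<epsilon> j" "supp k \<subseteq> L"
    using that assms supp_shift[of v m] by (auto simp: supp_add_nat)
  then show "coef (lin_part L j (monomial (m + \<epsilon> v) c)) k = coef (if v = j then monomial m c else 0) k"
    using assms by (auto simp: coef_lin_part lookup_single when_def)
qed

lemma lin_part_monomial2:
  assumes "v \<notin> L" "w \<notin> L" "j \<notin> L"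
  shows "lin_part L j (monomial (m + \<epsilon> v + \<epsilon> w) c) = 0"
proof (rule poly_mapping_eqI)
  fix k
  have False if k: "m + \<epsilon> v + \<epsilon> w = k + \<epsilon> j" "supp k \<subseteq> L"
  proof -
    have "v \<in> supp (k + \<epsilon> j)" "w \<in> supp (k + \<epsilon> j)"
      unfolding k(1)[symmetric] by (auto simp: in_keys_iff lookup_add)
    then have "v = j" "w = j" using k(2) assms by (auto simp: supp_add_nat)
    moreover have "j \<notin> supp k" using k(2) assms by auto
    ultimately show False
      using arg_cong[OF k(1), of "\<lambda>m. coef m j"] by (simp add: lookup_add in_keys_iff)
  qed
  then show "coef (lin_part L j (monomial (m + \<epsilon> v + \<epsilon> w) c)) k = coef 0 k"
    by (auto simp: coef_lin_part lookup_single when_def)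
qed

lemma monomial_split:
  assumes "v \<in> supp (m :: nat \<Rightarrow>\<^sub>0 nat)"
  obtains m' where "m = m' + \<epsilon> v"
proof -
  have "m = (m - \<epsilon> v) + \<epsilon> v"
    using assms by (intro poly_mapping_eqI) (auto simp: lookup_add lookup_minus lookup_single when_def in_keys_iff)
  then show ?thesis by (rule that)
qed

text \<open>Monomials of degree 0, 1 and at least 2 in the variables outside \<open>L\<close>.\<close>

lemma monomial_cases:
  fixes m :: "nat \<Rightarrow>\<^sub>0 nat"
  obtains (const) "supp m \<subseteq> L"
  | (lin) m' v where "m = m' + \<epsilon> v" "supp m' \<subseteq> L" "v \<notin> L"
  | (high) m' v w where "m = m' + \<epsilon> v + \<epsilon> w" "v \<notin> L" "w \<notin> L"
proof (cases "supp m \<subseteq> L")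
  case False
  then obtain v where v: "v \<in> supp m" "v \<notin> L" by blast
  obtain m' where m': "m = m' + \<epsilon> v" using v(1) by (rule monomial_split)
  show ?thesis
  proof (cases "supp m' \<subseteq> L")
    case True
    then show ?thesis using lin m' v by blast
  next
    case False
    then obtain w where w: "w \<in> supp m'" "w \<notin> L" by blast
    obtain m'' where "m' = m'' + \<epsilon> w" using w(1) by (rule monomial_split)
    then show ?thesis using high m' v w by blast
  qed
qed (use const in blast)

lemma product_rule_monomials:
  assumes "j \<notin> L"
  shows "lin_part L j (monomial m c * monomial m' c') =
    const_part L (monomial m c) * lin_part L j (monomial m' c') +
    lin_part L j (monomial m c) * const_part L (monomial m' c')" (is "?D m c m' c'")
proof -
  have sym: "?D m' c' m c" if "?D m c m' c'" for m c m' c'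
    using that by (metis add.commute mult.commute)
  have highD: "?D m c m' c'" if m: "m = k + \<epsilon> v + \<epsilon> w" "v \<notin> L" "w \<notin> L" for k v w m c m' c'
  proof -
    have "const_part L (monomial m c) = 0" "lin_part L j (monomial m c) = 0"
      using m assms supp_shift[of w "k + \<epsilon> v"] by (auto simp: const_part_monomial lin_part_monomial2)
    moreover have eq: "m + m' = (k + m') + \<epsilon> v + \<epsilon> w" by (simp add: m(1) algebra_simps)
    have "lin_part L j (monomial m c * monomial m' c') = 0"
      unfolding mult_single eq by (rule lin_part_monomial2) (fact m assms)+
    ultimately show ?thesis by simp
  qed
  have linD: "?D m c m' c'"
    if m: "m = k + \<epsilon> v" "supp k \<subseteq> L" "v \<notin> L" and m': "supp m' \<subseteq> L" for k v m c m' c'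
  proof -
    have "const_part L (monomial m c) = 0" "lin_part L j (monomial m c) = (if v = j then monomial k c else 0)"
      using m assms supp_shift[of v k] by (auto simp: const_part_monomial lin_part_monomial1)
    moreover have "const_part L (monomial m' c') = monomial m' c'"
      using m' by (simp add: const_part_monomial)
    moreover have eq: "m + m' = (k + m') + \<epsilon> v" and "supp (k + m') \<subseteq> L"
      using m m' by (simp_all add: add_ac supp_add_nat)
    then have "lin_part L j (monomial m c * monomial m' c') =
        (if v = j then monomial (k + m') (c * c') else 0)"
      unfolding mult_single eq using m assms by (intro lin_part_monomial1)
    ultimately show ?thesis by (simp add: mult_single)
  qed
  show ?thesis
  proof (cases m L rule: monomial_cases)
    case m: const
    show ?thesis
    proof (cases m' L rule: monomial_cases)
      case const
      with m assms show ?thesis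
        by (simp add: const_part_monomial lin_part_monomial0 mult_single supp_add_nat)
    next
      case (lin k v)
      show ?thesis by (rule sym, rule linD[OF lin m])
    next
      case (high k v w)
      show ?thesis by (rule sym, rule highD[OF high])
    qed
  next
    case m: (lin k v)
    show ?thesis
    proof (cases m' L rule: monomial_cases)
      case const
      show ?thesis by (rule linD[OF m const])
    next
      case m': (lin k' v')
      have "\<not> supp m \<subseteq> L" "\<not> supp m' \<subseteq> L"
        using m m' supp_shift[of v k] supp_shift[of v' k'] by auto
      moreover have eq: "m + m' = (k + k') + \<epsilon> v + \<epsilon> v'" by (simp add: m m' algebra_simps)
      have "lin_part L j (monomial m c * monomial m' c') = 0"
        unfolding mult_single eq by (rule lin_part_monomial2) (fact m m' assms)+
      ultimately show ?thesis by (simp add: const_part_monomial)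
    next
      case (high k' v' w')
      show ?thesis by (rule sym, rule highD[OF high])
    qed
  next
    case (high k v w)
    show ?thesis by (rule highD[OF high])
  qed
qed

text \<open>The Leibniz rule: \<open>lin_part L j\<close> is the derivative along the variable \<open>j\<close>, evaluated on the line.\<close>

lemma lin_part_mult:
  assumes "j \<notin> L"
  shows "lin_part L j (f * g) = const_part L f * lin_part L j g + lin_part L j f * const_part L g"
proof -
  have f: "f \<in> polys UNIV" and g: "g \<in> polys UNIV" by simp_all
  show ?thesis
    using f
  proof (induction f rule: mpoly_induct)
    case (monomial m c)
    show ?case using g
    proof (induction g rule: mpoly_induct)
      case (monomial m' c')
      show ?case by (rule product_rule_monomials[OF assms])
    qed (simp_all add: algebra_simps)
  qed (simp_all add: algebra_simps)
qed

lemma const_part_mult: "const_part L (f * g) = const_part L f * const_part L g"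
proof -
  have f: "f \<in> polys UNIV" and g: "g \<in> polys UNIV" by simp_all
  show ?thesis
    using f
  proof (induction f rule: mpoly_induct)
    case (monomial m c)
    show ?case using g
    proof (induction g rule: mpoly_induct)
      case (monomial m' c')
      show ?case by (simp add: mult_single const_part_monomial supp_add_nat)
    qed (simp_all add: algebra_simps)
  qed (simp_all add: algebra_simps)
qed

lemma Var_eq: "Var v = monomial (\<epsilon> v) 1"
  by (simp add: Var_def)

lemma monomial_Var: "monomial (m + \<epsilon> v) c = monomial m c * Var v"
  by (simp add: Var_eq mult_single)

lemma const_part_Var: "v \<notin> L \<Longrightarrow> const_part L (Var v) = 0"
  by (simp add: Var_eq const_part_monomial)

lemma lin_part_Var: "v \<notin> L \<Longrightarrow> j \<notin> L \<Longrightarrow> lin_part L j (Var v) = (if v = j then 1 else 0)"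
  using lin_part_monomial1[of 0 L v j "1 :: 'a"] by (simp add: Var_eq)

lemma Var_nonzero [simp]: "Var v \<noteq> 0"
  by (metis Var_eq lookup_single_eq lookup_zero zero_neq_one)

lemma Var_power: "Var v ^ N = monomial (monomial v N) 1"
  by (induction N) (simp_all add: Var_eq mult_single flip: single_add)


section \<open>The line\<close>

locale line =
  fixes n :: nat
  assumes n_ge: "n \<ge> 2"
begin

abbreviation "L \<equiv> line_vars n"
abbreviation "R \<equiv> mpoly_ring {..n}"

lemma vars_split: "{..n} = {..n-2} \<union> L" and x_notin_L: "j \<le> n - 2 \<Longrightarrow> j \<notin> L"
  using n_ge by (auto simp: line_vars_def)

lemma polys_L_R: "f \<in> polys L \<Longrightarrow> f \<in> polys {..n}"
  by (rule polys_mono[rotated]) (auto simp: vars_split)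

lemma x_if_notin_L: "v \<in> {..n} \<Longrightarrow> v \<notin> L \<Longrightarrow> v \<le> n - 2"
  by (auto simp: vars_split)

abbreviation IL :: "'k::field mpoly set" where "IL \<equiv> line_ideal n"

lemma ideal_IL: "ideal IL R"
  unfolding line_ideal_def
  by (rule ring.genideal_ideal[OF cring.axioms(1)[OF cring_mpoly_ring]]) auto

lemma Var_IL: "j \<le> n - 2 \<Longrightarrow> Var j \<in> IL"
proof -
  have "Var ` {..n-2} \<subseteq> polys {..n}" by auto
  from ring.genideal_self[OF cring.axioms(1)[OF cring_mpoly_ring] this]
  show "j \<le> n - 2 \<Longrightarrow> Var j \<in> IL" by (auto simp: line_ideal_def)
qed

lemma const_part_kernel_ideal: "ideal {f \<in> polys {..n}. const_part L f = 0} R"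
  unfolding ideal_mpoly_iff by (auto simp: const_part_mult)

lemma diff_const_part_IL:
  assumes "f \<in> polys {..n}"
  shows "f - const_part L f \<in> IL"
  using assms
proof (induction f rule: mpoly_induct)
  case (monomial m c)
  show ?case
  proof (cases "supp m \<subseteq> L")
    case False
    then obtain v where v: "v \<in> supp m" "v \<notin> L" by blast
    then have "v \<le> n - 2" using monomial x_if_notin_L by blast
    obtain m' where m': "m = m' + \<epsilon> v" using v(1) by (rule monomial_split)
    then have "supp m' \<subseteq> {..n}" using monomial by (auto simp: supp_add_nat)
    then have "monomial m c \<in> IL"
      unfolding m' monomial_Var using Var_IL \<open>v \<le> n - 2\<close>
      by (intro ideal_mpolyD(4)[OF ideal_IL] polys_monomial)
    with False show ?thesis by (simp add: const_part_monomial)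
  qed (simp add: const_part_monomial ideal_mpolyD(2)[OF ideal_IL])
next
  case (add f g)
  then show ?case
    using ideal_mpolyD(3)[OF ideal_IL add(3,4)] by (simp add: algebra_simps)
qed (simp add: ideal_mpolyD(2)[OF ideal_IL])

lemma IL_iff: "f \<in> IL \<longleftrightarrow> f \<in> polys {..n} \<and> const_part L f = 0"
proof
  have "IL \<subseteq> {f \<in> polys {..n}. const_part L f = 0}"
    unfolding line_ideal_def using x_notin_L
    by (intro ring.genideal_minimal[OF cring.axioms(1)[OF cring_mpoly_ring]] const_part_kernel_ideal)
      (auto simp: const_part_Var)
  then show "f \<in> IL \<Longrightarrow> f \<in> polys {..n} \<and> const_part L f = 0" by blast
  show "f \<in> polys {..n} \<and> const_part L f = 0 \<Longrightarrow> f \<in> IL"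
    using diff_const_part_IL[of f] by auto
qed

abbreviation IL2 :: "'k::field mpoly set" where "IL2 \<equiv> ideal_prod R IL IL"

lemma ideal_IL2: "ideal IL2 R"
  by (rule ring.ideal_prod_is_ideal[OF cring.axioms(1)[OF cring_mpoly_ring] ideal_IL ideal_IL])

lemma IL2_mult: "f \<in> IL \<Longrightarrow> g \<in> IL \<Longrightarrow> f * g \<in> IL2"
  using ideal_prod.prod[of f IL g IL R] by simp

text \<open>Monomials that contain two of the equations of the line, counted with multiplicity, lie in the
  square of its ideal.\<close>

lemma taylor_IL2:
  assumes "f \<in> polys {..n}"
  shows "f - const_part L f - (\<Sum>j\<le>n-2. lin_part L j f * Var j) \<in> IL2"
  using assms
proof (induction f rule: mpoly_induct)
  case (monomial m c)
  note zero = ideal_mpolyD(2)[OF ideal_IL2]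
  show ?case
  proof (cases m L rule: monomial_cases)
    case const
    then show ?thesis using x_notin_L
      by (simp add: const_part_monomial lin_part_monomial0 zero)
  next
    case (lin m' v)
    then have "v \<le> n - 2" using monomial x_if_notin_L by (auto simp: supp_add_nat)
    have const: "const_part L (monomial m c) = 0"
      using lin supp_shift[of v m'] by (auto simp: const_part_monomial)
    have "(\<Sum>j\<le>n-2. lin_part L j (monomial m c) * Var j) =
        (\<Sum>j\<le>n-2. if j = v then monomial m' c * Var v else 0)"
      using lin x_notin_L by (intro sum.cong) (auto simp: lin_part_monomial1)
    also have "\<dots> = monomial m c"
      using \<open>v \<le> n - 2\<close> by (simp add: lin(1) monomial_Var)
    finally show ?thesis by (simp add: const zero)
  next
    case (high m' v w)
    then have vw: "v \<le> n - 2" "w \<le> n - 2" using monomial x_if_notin_L by (auto simp: supp_add_nat)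
    have const: "const_part L (monomial m c) = 0"
      using high supp_shift[of w "m' + \<epsilon> v"] by (auto simp: const_part_monomial)
    moreover have "monomial m c \<in> IL2"
    proof -
      have "supp m' \<subseteq> {..n}" using monomial high by (auto simp: supp_add_nat)
      then have "monomial m' c * Var v \<in> IL" using vw Var_IL
        by (intro ideal_mpolyD(4)[OF ideal_IL] polys_monomial)
      then show ?thesis unfolding high(1) monomial_Var using vw Var_IL by (intro IL2_mult)
    qed
    moreover have "lin_part L j (monomial m c) = 0" if "j \<le> n - 2" for j
      unfolding high(1) using high x_notin_L[OF that] by (intro lin_part_monomial2)
    ultimately show ?thesis by simp
  qed
next
  case (add f g)
  have "f + g - const_part L (f + g) - (\<Sum>j\<le>n-2. lin_part L j (f + g) * Var j) =
    (f - const_part L f - (\<Sum>j\<le>n-2. lin_part L j f * Var j)) +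
    (g - const_part L g - (\<Sum>j\<le>n-2. lin_part L j g * Var j))"
    by (simp add: algebra_simps sum.distrib)
  also have "\<dots> \<in> IL2" by (rule ideal_mpolyD(3)[OF ideal_IL2 add(3,4)])
  finally show ?case .
qed (simp add: ideal_mpolyD(2)[OF ideal_IL2])

text \<open>The points of the line in the ambient space are those of the line itself.\<close>

lemma Proj_IL_restrict:
  assumes "P \<in> Proj {..n} IL"
  shows "P \<inter> polys L \<in> Proj L {0}"
proof -
  note P = Proj_D[OF assms]
  note idl = ideal_mpolyD[OF hom_ideal_mpolyD(1)[OF P(1)]]
  have id: "ideal (P \<inter> polys L) (mpoly_ring L)"
    unfolding ideal_mpoly_iff using idl by (auto dest: polys_L_R)
  have "hom_ideal L (P \<inter> polys L)"
    unfolding hom_ideal_def using id hom_ideal_mpolyD(2)[OF P(1)] by auto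
  moreover have "primeideal (P \<inter> polys L) (mpoly_ring L)"
    using P(2) id unfolding primeideal_mpoly_iff by (auto dest: polys_L_R)
  moreover have "\<not> Var ` L \<subseteq> P \<inter> polys L"
  proof
    assume "Var ` L \<subseteq> P \<inter> polys L"
    then have "Var ` {..n} \<subseteq> P" using P(3) Var_IL by (auto simp: vars_split)
    with P(4) show False by blast
  qed
  ultimately show ?thesis using idl(2) by (simp add: Proj_def)
qed

lemma Proj_IL_extend:
  assumes "Q \<in> Proj L {0}"
  shows "{f \<in> polys {..n}. const_part L f \<in> Q} \<in> Proj {..n} IL" (is "?P \<in> _")
proof -
  note Q = Proj_D[OF assms]
  note idl = ideal_mpolyD[OF hom_ideal_mpolyD(1)[OF Q(1)]]
  have id: "ideal ?P R"
    unfolding ideal_mpoly_iff using idl by (auto simp: const_part_mult)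
  have "hom_ideal {..n} ?P"
    unfolding hom_ideal_def using id hom_ideal_mpolyD(3)[OF Q(1)] by (auto simp: hom_comp_eq const_part_hcomp)
  moreover have "primeideal ?P R"
    using Q(2) id unfolding primeideal_mpoly_iff by (auto simp: const_part_mult const_part_polys)
  moreover have "IL \<subseteq> ?P" using idl(2) by (auto simp: IL_iff)
  moreover have "\<not> Var ` {..n} \<subseteq> ?P"
    using Q(4) by (auto simp: vars_split const_part_polys)
  ultimately show ?thesis by (simp add: Proj_def)
qed

lemma zero_Proj_L: "{0} \<in> Proj L {0}"
proof -
  have id: "ideal {0 :: 'a mpoly} (mpoly_ring L)" by (simp add: ideal_mpoly_iff)
  then have "hom_ideal L {0 :: 'a mpoly}" by (simp add: hom_ideal_def hom_comp_eq)
  moreover have "primeideal {0 :: 'a mpoly} (mpoly_ring L)"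
    using id by (simp add: primeideal_mpoly_iff)
  moreover have "\<not> Var ` L \<subseteq> {0 :: 'a mpoly}" by (simp add: line_vars_def)
  ultimately show ?thesis by (simp add: Proj_def)
qed

text \<open>This is the generic point of the line, the point of the zero ideal of its coordinate ring.\<close>

lemma IL_Proj: "IL \<in> Proj {..n} IL"
proof -
  have "{f \<in> polys {..n}. const_part L f \<in> {0}} = IL" by (auto simp: IL_iff)
  from subst[OF this, of "\<lambda>P. P \<in> Proj {..n} IL"] show ?thesis
    using Proj_IL_extend[OF zero_Proj_L] .
qed

lemma const_part_mem_iff:
  assumes "P \<in> Proj {..n} IL" "f \<in> polys {..n}"
  shows "const_part L f \<in> P \<longleftrightarrow> f \<in> P"
proof -
  note P = Proj_D[OF assms(1)]
  note idl = ideal_mpolyD[OF hom_ideal_mpolyD(1)[OF P(1)]]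
  have d: "f - const_part L f \<in> P" using diff_const_part_IL[OF assms(2)] P(3) by blast
  show ?thesis using idl(3)[OF _ d] idl(7)[OF _ d] by force
qed

end

text \<open>Powers of two different variables are coprime: the part of \<open>f\<close> that is not divisible by \<open>Var v ^ N\<close>
  stays indivisible after multiplication by \<open>Var w ^ M\<close>, so the equation forces it to vanish.\<close>

lemma Var_power_dvd:
  assumes "v \<noteq> w" and eq: "Var w ^ M * f = Var v ^ N * (g :: 'k::field mpoly)" and f: "f \<in> polys L"
  obtains h where "h \<in> polys L" "f = Var v ^ N * h"
proof -
  have div: "\<exists>h\<in>polys L. part (\<lambda>m. coef m v \<ge> N) f = Var v ^ N * h"
    using f
  proof (induction f rule: mpoly_induct)
    case zero
    show ?case by (intro bexI[of _ 0]) auto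
  next
    case (monomial m c)
    show ?case
    proof (cases "coef m v \<ge> N")
      case True
      then have "m = monomial v N + (m - monomial v N)"
        by (intro poly_mapping_eqI) (auto simp: lookup_add lookup_minus lookup_single when_def)
      then have "monomial m c = Var v ^ N * monomial (m - monomial v N) c"
        by (simp add: Var_power mult_single)
      moreover have "supp (m - monomial v N) \<subseteq> L"
        using monomial by (auto simp: in_keys_iff lookup_minus)
      moreover have "part (\<lambda>m. coef m v \<ge> N) (monomial m c) = monomial m c"
        using True by (simp add: part_monomial)
      ultimately show ?thesis by (metis polys_monomial)
    next
      case False
      then show ?thesis by (intro bexI[of _ 0]) (auto simp: part_monomial)
    qed
  next
    case (add f g)
    then obtain h k where "h \<in> polys L" "part (\<lambda>m. coef m v \<ge> N) f = Var v ^ N * h"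
      "k \<in> polys L" "part (\<lambda>m. coef m v \<ge> N) g = Var v ^ N * k" by blast
    then show ?case by (intro bexI[of _ "h + k"]) (auto simp: algebra_simps)
  qed
  then obtain h where h: "h \<in> polys L" "part (\<lambda>m. coef m v \<ge> N) f = Var v ^ N * h" by blast
  define f' where "f' = part (\<lambda>m. \<not> coef m v \<ge> N) f"
  have split: "f = Var v ^ N * h + f'"
    unfolding h(2)[symmetric] f'_def by (rule poly_mapping_eqI) (simp add: lookup_add)
  have eq': "Var w ^ M * f' = Var v ^ N * (g - Var w ^ M * h)"
    using eq unfolding split by (simp add: algebra_simps)
  have "m \<notin> supp (Var w ^ M * f')" for m
  proof
    assume m: "m \<in> supp (Var w ^ M * f')"
    have low: "coef m v < N"
      using Poly_Mapping.keys_mult[of "Var w ^ M" f'] m \<open>v \<noteq> w\<close>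
      by (auto simp: Var_power f'_def supp_part lookup_add lookup_single when_def)
    have "coef m v \<ge> N"
      using Poly_Mapping.keys_mult[of "Var v ^ N" "g - Var w ^ M * h"] m
      unfolding eq' by (auto simp: Var_power lookup_add)
    with low show False by simp
  qed
  then have "supp (Var w ^ M * f') = {}" by blast
  then have "Var w ^ M * f' = 0"
    by (metis empty_iff in_keys_iff lookup_zero poly_mapping_eqI)
  then have "f' = 0" by simp
  with split h(1) show ?thesis using that by simp
qed

text \<open>A rational function \<open>p/q\<close> without poles on the line is a polynomial.  Its denominators form a
  homogeneous ideal \<open>J\<close> that is contained in no point of the line.  An ideal that avoids the powers of a
  variable lies in a homogeneous prime without that variable; so \<open>J\<close> contains powers of both variables of
  the line, and as these are coprime, \<open>q\<close> divides \<open>p\<close>.\<close>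

lemma (in line) regular_fraction_polynomial:
  fixes p q :: "'k::field mpoly"
  assumes p: "p \<in> polys L" "homog d p" and q: "q \<in> polys L" "homog e q" "q \<noteq> 0"
    and regular: "\<And>P. P \<in> Proj {..n} IL \<Longrightarrow> \<exists>h\<in>polys L. h \<notin> P \<and> (\<exists>x\<in>polys L. h * p = x * q)"
  obtains x where "x \<in> polys L" "p = x * q"
proof -
  define J where "J = {h \<in> polys {..n}. \<exists>x\<in>polys L. const_part L h * p = x * q}"
  have "ideal J R"
    unfolding ideal_mpoly_iff
  proof (intro conjI ballI)
    show "J \<subseteq> polys {..n}" by (auto simp: J_def)
    show "0 \<in> J" by (auto simp: J_def intro!: bexI[of _ 0])
  next
    fix a b assume "a \<in> J" "b \<in> J"
    then obtain x y where "a \<in> polys {..n}" "b \<in> polys {..n}" "x \<in> polys L" "y \<in> polys L"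
      "const_part L a * p = x * q" "const_part L b * p = y * q" by (auto simp: J_def)
    then show "a + b \<in> J" by (auto simp: J_def algebra_simps intro!: bexI[of _ "x + y"])
  next
    fix f a :: "'k mpoly" assume f: "f \<in> polys {..n}" and "a \<in> J"
    then obtain x where "a \<in> polys {..n}" "x \<in> polys L" "const_part L a * p = x * q"
      by (auto simp: J_def)
    with f show "f * a \<in> J"
      by (auto simp: J_def const_part_mult mult.assoc intro!: bexI[of _ "const_part L f * x"])
  qed
  moreover have "hom_comp i a \<in> J" if a: "a \<in> J" for i a
  proof -
    obtain x where x: "a \<in> polys {..n}" "x \<in> polys L" "const_part L a * p = x * q"
      using a by (auto simp: J_def)
    have "p * hcomp (int i) (const_part L a) = hcomp (int i + d) (p * const_part L a)"
      by (simp add: hcomp_mult_homog[OF p(2)])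
    also have "\<dots> = hcomp (int i + d) (q * x)" using x(3) by (simp add: mult.commute)
    also have "\<dots> = q * hcomp (int i + d - e) x" by (rule hcomp_mult_homog[OF q(2)])
    finally show ?thesis using x
      by (auto simp: J_def hom_comp_eq const_part_hcomp mult.commute
          intro!: bexI[of _ "hcomp (int i + d - e) x"] polys_hcomp)
  qed
  ultimately have J: "hom_ideal {..n} J" by (simp add: hom_ideal_def)
  have "IL \<subseteq> J" by (auto simp: IL_iff J_def intro!: bexI[of _ 0])
  have power: "\<exists>N. Var \<tau> ^ N \<in> J" if "\<tau> \<in> L" for \<tau>
  proof (rule ccontr)
    assume "\<nexists>N. Var \<tau> ^ N \<in> J"
    moreover have "\<tau> \<in> {..n}" using that by (simp add: vars_split)
    ultimately obtain P where P: "hom_ideal {..n} P" "primeideal P R" "J \<subseteq> P" "Var \<tau> \<notin> P"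
      using hom_prime_avoiding[OF J, of "Var \<tau>"] by auto
    then have "P \<in> Proj {..n} IL" using \<open>IL \<subseteq> J\<close> \<open>\<tau> \<in> {..n}\<close> by (auto simp: Proj_def)
    then obtain h x where h: "h \<in> polys L" "h \<notin> P" "x \<in> polys L" "h * p = x * q"
      using regular by blast
    then have "h \<in> J" by (auto simp: J_def const_part_polys polys_L_R)
    with h(2) P(3) show False by blast
  qed
  have ex: "\<exists>N. \<exists>x\<in>polys L. Var \<tau> ^ N * p = x * q" if "\<tau> \<in> L" for \<tau>
  proof -
    have "const_part L (Var \<tau> ^ N) = (Var \<tau> ^ N :: 'k mpoly)" for N
      using that by (simp add: const_part_polys)
    then show ?thesis using power[OF that] by (auto simp: J_def)
  qed
  obtain N x where x: "x \<in> polys L" "Var (n - 1) ^ N * p = x * q"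
    using ex[of "n - 1"] by (auto simp: line_vars_def)
  obtain M y where y: "Var n ^ M * p = y * q"
    using ex[of n] by (auto simp: line_vars_def)
  have "(Var n ^ M * x) * q = Var n ^ M * (Var (n - 1) ^ N * p)"
    unfolding x(2) by (simp only: mult.assoc)
  also have "\<dots> = Var (n - 1) ^ N * (Var n ^ M * p)" by (simp only: ac_simps)
  also have "\<dots> = (Var (n - 1) ^ N * y) * q"
    unfolding y by (simp only: mult.assoc)
  finally have "(Var n ^ M * x) * q = (Var (n - 1) ^ N * y) * q" .
  then have "Var n ^ M * x = Var (n - 1) ^ N * y" using q(3) by simp
  then obtain h where "h \<in> polys L" "x = Var (n - 1) ^ N * h"
    using n_ge by (elim Var_power_dvd[rotated, OF _ x(1)]) auto
  then show ?thesis using that[of h] x(2) by (simp add: mult.assoc)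
qed


section \<open>Determinants and maximal minors\<close>

lemma signof_cases: "signof p = (1 :: 'a :: ring_1) \<or> signof p = (- 1 :: 'a)"
  using signof_pm_one[of p] by auto

lemma polys_signof [simp, intro]: "signof p \<in> polys V"
  using signof_cases[of p] by (metis polys_one polys_uminus)

lemma homog_signof [simp, intro]: "homog 0 (signof p :: 'k::field mpoly)"
  using signof_cases[of p] by (metis homog_one homog_uminus)

lemma permutes_less: "p permutes {0..<m} \<Longrightarrow> i < m \<Longrightarrow> p i < (m :: nat)"
  using permutes_in_image[of p "{0..<m}" i] by simp

lemma det_polys:
  assumes "M \<in> carrier_mat m m" "\<And>i j. i < m \<Longrightarrow> j < m \<Longrightarrow> M $$ (i, j) \<in> polys V"
  shows "det M \<in> polys V"
  unfolding det_def'[OF assms(1)]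
  by (intro polys_sum polys_mult polys_signof polys_prod assms(2)) (auto dest: permutes_less)

lemma det_homog:
  assumes "M \<in> carrier_mat m m" "\<And>i j. i < m \<Longrightarrow> j < m \<Longrightarrow> homog (d i) (M $$ (i, j))"
  shows "homog (\<Sum>i<m. d i) (det M)"
proof -
  have "homog (\<Sum>i=0..<m. d i) (\<Prod>i = 0..<m. M $$ (i, p i))" if "p permutes {0..<m}" for p
    using that by (intro homog_prod assms(2)) (auto dest: permutes_less)
  then show ?thesis
    unfolding det_def'[OF assms(1)]
    by (intro homog_sum homog_mult'[OF homog_signof]) (auto simp: atLeast0LessThan)
qed

lemma adj_mat_polys:
  assumes "M \<in> carrier_mat m m" "\<And>i j. i < m \<Longrightarrow> j < m \<Longrightarrow> M $$ (i, j) \<in> polys V" "l < m" "i < m"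
  shows "adj_mat M $$ (l, i) \<in> polys V"
proof -
  have "det (mat_delete M i l) \<in> polys V"
    by (rule det_polys[OF mat_delete_carrier[OF assms(1)]]) (use assms in \<open>auto simp: mat_delete_def\<close>)
  then show ?thesis using assms by (auto simp: adj_mat_def cofactor_def)
qed

text \<open>The degree of a cofactor: deleting the row \<open>i\<close> removes its degree from the sum.\<close>

lemma sum_insert_index:
  assumes "i < m"
  shows "(\<Sum>i'<m - 1. d (if i' < i then i' else Suc i')) = (\<Sum>i'<m. d i') - (d i :: int)"
proof -
  obtain m' where m': "m = Suc m'" using assms by (cases m) auto
  have "(\<Sum>i'<m - 1. d (if i' < i then i' else Suc i')) = (\<Sum>i'\<in>{0..<m'}. d (insert_index i i'))"
    unfolding m' insert_index_def by (simp add: atLeast0LessThan)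
  also have "\<dots> = (\<Sum>i'\<in>{0..<m} - {i}. d i')"
    unfolding m' insert_index_image[OF assms[unfolded m'], symmetric]
    by (subst sum.reindex[OF insert_index_inj_on]) simp
  also have "\<dots> = (\<Sum>i'<m. d i') - d i"
    using assms by (simp add: sum_diff1 atLeast0LessThan)
  finally show ?thesis .
qed

lemma adj_mat_homog:
  assumes "M \<in> carrier_mat m m" "\<And>i j. i < m \<Longrightarrow> j < m \<Longrightarrow> homog (d i) (M $$ (i, j))" "l < m" "i < m"
  shows "homog ((\<Sum>i<m. d i) - d i) (adj_mat M $$ (l, i))"
proof -
  have "homog (\<Sum>i'<m - 1. d (if i' < i then i' else Suc i')) (det (mat_delete M i l))"
    by (rule det_homog[OF mat_delete_carrier[OF assms(1)]]) (use assms in \<open>auto simp: mat_delete_def\<close>)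
  note this[unfolded sum_insert_index[OF assms(4)]]
  moreover have "homog 0 ((- 1 :: 'a mpoly) ^ (i + l))"
    using homog_power[OF homog_uminus[OF homog_one], of "i + l"] by simp
  ultimately show ?thesis
    using assms by (auto simp: adj_mat_def cofactor_def intro!: homog_mult'[of 0])
qed

text \<open>The first step of the Cauchy--Binet formula, by multilinearity in the columns.\<close>

lemma det_mult_expand:
  fixes A M :: "'a::comm_ring_1 mat"
  assumes A: "A \<in> carrier_mat m N" and M: "M \<in> carrier_mat N m"
  shows "det (A * M) = (\<Sum>\<phi>\<in>{..<m} \<rightarrow>\<^sub>E {..<N}. (\<Prod>l<m. M $$ (\<phi> l, l)) * det (mat m m (\<lambda>(i, l). A $$ (i, \<phi> l))))"
proof -
  let ?S = "{p. p permutes {0..<m}}" and ?F = "{..<m} \<rightarrow>\<^sub>E {..<N}"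
  have "det (A * M) = (\<Sum>p\<in>?S. signof p * (\<Prod>l<m. (A * M) $$ (p l, l)))"
    using A M by (intro det_col) auto
  also have "\<dots> = (\<Sum>p\<in>?S. signof p * (\<Prod>l<m. \<Sum>j<N. A $$ (p l, j) * M $$ (j, l)))"
  proof (intro sum.cong refl arg_cong2[where f = "(*)"] prod.cong)
    fix p l assume "p \<in> ?S" "l \<in> {..<m}"
    then have "p l < m" "l < m" by (auto dest: permutes_less)
    then show "(A * M) $$ (p l, l) = (\<Sum>j<N. A $$ (p l, j) * M $$ (j, l))"
      using A M by (auto simp: scalar_prod_def atLeast0LessThan)
  qed
  also have "\<dots> = (\<Sum>p\<in>?S. \<Sum>\<phi>\<in>?F. signof p * (\<Prod>l<m. A $$ (p l, \<phi> l) * M $$ (\<phi> l, l)))"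
    by (subst prod_sum_PiE) (auto simp: sum_distrib_left)
  also have "\<dots> = (\<Sum>\<phi>\<in>?F. \<Sum>p\<in>?S. signof p * (\<Prod>l<m. A $$ (p l, \<phi> l) * M $$ (\<phi> l, l)))"
    by (rule sum.swap)
  also have "\<dots> = (\<Sum>\<phi>\<in>?F. (\<Prod>l<m. M $$ (\<phi> l, l)) * det (mat m m (\<lambda>(i, l). A $$ (i, \<phi> l))))"
  proof (intro sum.cong refl)
    fix \<phi>
    have "det (mat m m (\<lambda>(i, l). A $$ (i, \<phi> l))) = (\<Sum>p\<in>?S. signof p * (\<Prod>l<m. A $$ (p l, \<phi> l)))"
    proof (subst det_col[of _ m], simp, intro sum.cong refl arg_cong2[where f = "(*)"] prod.cong)
      fix p l assume "p \<in> ?S" "l \<in> {..<m}"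
      then have "p l < m" "l < m" by (auto dest: permutes_less)
      then show "mat m m (\<lambda>(i, l). A $$ (i, \<phi> l)) $$ (p l, l) = A $$ (p l, \<phi> l)" by simp
    qed
    then show "(\<Sum>p\<in>?S. signof p * (\<Prod>l<m. A $$ (p l, \<phi> l) * M $$ (\<phi> l, l))) =
        (\<Prod>l<m. M $$ (\<phi> l, l)) * det (mat m m (\<lambda>(i, l). A $$ (i, \<phi> l)))"
      by (simp add: prod.distrib sum_distrib_left algebra_simps)
  qed
  finally show ?thesis .
qed

lemma col_submat_carrier:
  assumes "A \<in> carrier_mat m N" "J \<subseteq> {..<N}" "card J = m"
  shows "col_submat A J \<in> carrier_mat m m"
    and "i < m \<Longrightarrow> l < m \<Longrightarrow> col_submat A J $$ (i, l) = A $$ (i, pick J l)"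
proof -
  have "{j. j < N \<and> j \<in> J} = J" "{i. i < m} = {..<m}" using assms(2) by auto
  then have *: "card {j. j < dim_col A \<and> j \<in> J} = m" "card {i. i < dim_row A \<and> i \<in> UNIV} = m"
    using assms by auto
  then show "col_submat A J \<in> carrier_mat m m"
    unfolding col_submat_def by (intro carrier_matI) (simp_all add: dim_submatrix del: UNIV_I)
  show "i < m \<Longrightarrow> l < m \<Longrightarrow> col_submat A J $$ (i, l) = A $$ (i, pick J l)"
    unfolding col_submat_def using * by (subst submatrix_index) (simp_all add: pick_UNIV)
qed

text \<open>Choosing columns with repetition gives a multiple of a maximal minor: any \<open>J\<close> with \<open>m\<close>
  elements that contains all chosen columns will do, since the choice is then \<open>A\<^sub>J\<close> times a matrix
  of zeros and ones.\<close>

lemma det_choose_columns: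
  fixes A :: "'k::field mpoly mat"
  assumes A: "A \<in> carrier_mat m N" and J: "J \<subseteq> {..<N}" "card J = m"
    and \<phi>: "\<And>l. l < m \<Longrightarrow> \<phi> l \<in> J"
  shows "det (mat m m (\<lambda>(i, l). A $$ (i, \<phi> l))) =
    det (col_submat A J) * det (mat m m (\<lambda>(l', l). if pick J l' = \<phi> l then 1 else 0))"
proof -
  let ?E = "mat m m (\<lambda>(l', l). if pick J l' = \<phi> l then 1 else (0 :: 'k mpoly))"
  note AJ = col_submat_carrier[OF A J]
  have "mat m m (\<lambda>(i, l). A $$ (i, \<phi> l)) = col_submat A J * ?E"
  proof (rule eq_matI)
    fix i l assume "i < dim_row (col_submat A J * ?E)" "l < dim_col (col_submat A J * ?E)"
    then have il: "i < m" "l < m" using AJ(1) by auto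
    define l0 where "l0 = card {a \<in> J. a < \<phi> l}"
    have l0: "pick J l0 = \<phi> l" unfolding l0_def by (rule pick_card_in_set[OF \<phi>[OF il(2)]])
    have "finite J" using J finite_subset by blast
    then have "l0 < m"
      unfolding l0_def J(2)[symmetric] using \<phi>[OF il(2)] by (intro psubset_card_mono) auto
    have eq_iff: "pick J l' = \<phi> l \<longleftrightarrow> l' = l0" if "l' < m" for l'
      using that l0 card_pick_le[of l' J] J(2) by (auto simp: l0_def)
    have "(col_submat A J * ?E) $$ (i, l) = (\<Sum>l'<m. A $$ (i, pick J l') * (if pick J l' = \<phi> l then 1 else 0))"
      using il AJ by (auto simp: scalar_prod_def atLeast0LessThan intro!: sum.cong)
    also have "\<dots> = (\<Sum>l'<m. if l' = l0 then A $$ (i, \<phi> l) else 0)"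
      using l0 by (intro sum.cong) (auto simp: eq_iff)
    also have "\<dots> = A $$ (i, \<phi> l)" using \<open>l0 < m\<close> by simp
    finally show "mat m m (\<lambda>(i, l). A $$ (i, \<phi> l)) $$ (i, l) = (col_submat A J * ?E) $$ (i, l)"
      using il by simp
  qed (use AJ in auto)
  then show ?thesis using det_mult[OF AJ(1), of ?E] by simp
qed

text \<open>By the last two lemmas, \<open>det (A * M)\<close> is a combination of maximal minors of \<open>A\<close>.\<close>

lemma exists_minor_not_in_ideal:
  assumes A: "A \<in> carrier_mat m N" and M: "M \<in> carrier_mat N m" and mN: "m \<le> N"
    and polys: "\<And>i j. i < m \<Longrightarrow> j < N \<Longrightarrow> A $$ (i, j) \<in> polys V" "\<And>i j. i < N \<Longrightarrow> j < m \<Longrightarrow> M $$ (i, j) \<in> polys V"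
    and P: "ideal P (mpoly_ring V)" and det: "det (A * M) \<notin> P"
  obtains J where "J \<subseteq> {..<N}" "card J = m" "det (col_submat A J) \<notin> P"
proof -
  have "\<exists>\<phi>\<in>{..<m} \<rightarrow>\<^sub>E {..<N}. det (mat m m (\<lambda>(i, l). A $$ (i, \<phi> l))) \<notin> P"
  proof (rule ccontr)
    assume "\<not> ?thesis"
    then have "det (A * M) \<in> P"
      unfolding det_mult_expand[OF A M] using polys(2)
      by (intro ideal_mpoly_sum[OF P] ideal_mpolyD(4)[OF P] polys_prod) auto
    with det show False by blast
  qed
  then obtain \<phi> where \<phi>: "\<phi> \<in> {..<m} \<rightarrow>\<^sub>E {..<N}" "det (mat m m (\<lambda>(i, l). A $$ (i, \<phi> l))) \<notin> P"
    by blast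
  have "card (\<phi> ` {..<m}) \<le> m" using card_image_le[of "{..<m}" \<phi>] by simp
  moreover have "\<phi> ` {..<m} \<subseteq> {..<N}" using \<phi>(1) by auto
  ultimately obtain J where J: "\<phi> ` {..<m} \<subseteq> J" "J \<subseteq> {..<N}" "card J = m"
    using exists_subset_between[of "\<phi> ` {..<m}" m "{..<N}"] mN by auto
  let ?E = "mat m m (\<lambda>(l', l). if pick J l' = \<phi> l then 1 else 0)"
  have "det ?E \<in> polys V" by (rule det_polys[of _ m]) auto
  moreover have "det (mat m m (\<lambda>(i, l). A $$ (i, \<phi> l))) = det (col_submat A J) * det ?E"
    by (rule det_choose_columns[OF A J(2,3)]) (use J(1) in auto)
  ultimately have "det (col_submat A J) \<notin> P" using \<phi>(2) ideal_mpolyD(5)[OF P] by metis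
  with that J show ?thesis by blast
qed


section \<open>The conormal coordinates of a rope\<close>

\<comment> \<open>The number of \<open>z\<^sub>i\<close> has the form \<open>Suc (r - k)\<close>; sums and products over \<open>{..<Suc (r - k)}\<close> are kept whole.\<close>
declare sum.lessThan_Suc [simp del] sum.op_ivl_Suc [simp del] prod.op_ivl_Suc [simp del]

locale rope_with_matrices = line n for n :: nat +
  fixes k r :: nat and I :: "'k::field mpoly set" and A B :: "'k mpoly mat" and \<alpha> \<beta> :: "nat \<Rightarrow> nat"
  assumes r_eq: "r = n - 2" and k_le: "k \<le> n - 2"
    and rope: "rope n (n - k) I" and matrices: "rope_matrices n k I A B \<alpha> \<beta>"
begin

abbreviation "m \<equiv> Suc (r - k)"

lemma m_eq: "m = r + 1 - k"
  using k_le r_eq by linarith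

lemma A_carrier: "A \<in> carrier_mat m (Suc r)" and B_carrier: "B \<in> carrier_mat (Suc r) k"
  and A_polys: "i < m \<Longrightarrow> j \<le> r \<Longrightarrow> A $$ (i, j) \<in> polys L"
  and A_homog: "i < m \<Longrightarrow> j \<le> r \<Longrightarrow> homog (int (\<alpha> i)) (A $$ (i, j))"
  and B_polys: "j \<le> r \<Longrightarrow> l < k \<Longrightarrow> B $$ (j, l) \<in> polys L"
  and I_gen: "I = genideal R (IL2 \<union> {\<Sum>i\<le>r. Var i * B $$ (i, l) | l. l < k})"
  using matrices unfolding rope_matrices_def Let_def r_eq[symmetric] m_eq by (auto simp: less_Suc_eq_le)

context
  fixes Q :: "'k mpoly set"
  assumes Q: "Q \<in> Proj L {0}"
begin

lemma exact:
  "stalk_map n Q B ` (\<Pi>\<^sub>E j\<in>{..<k}. stalk L {0} (- int (\<beta> j) - 1) Q) =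
     {w \<in> \<Pi>\<^sub>E j\<in>{..<r + 1}. stalk L {0} (- 1) Q. stalk_map n Q A w = (\<lambda>i\<in>{..<m}. \<zero>\<^bsub>loc L {0} Q\<^esub>)}"
  "stalk_map n Q A ` (\<Pi>\<^sub>E j\<in>{..<r + 1}. stalk L {0} (- 1) Q) =
     (\<Pi>\<^sub>E i\<in>{..<m}. stalk L {0} (int (\<alpha> i) - 1) Q)"
proof -
  note E = matrices[unfolded rope_matrices_def Let_def r_eq[symmetric], THEN conjunct2, THEN conjunct2,
    THEN conjunct2, THEN conjunct2, THEN conjunct2, THEN bspec, OF Q, THEN conjunct2]
  show "stalk_map n Q B ` (\<Pi>\<^sub>E j\<in>{..<k}. stalk L {0} (- int (\<beta> j) - 1) Q) =
     {w \<in> \<Pi>\<^sub>E j\<in>{..<r + 1}. stalk L {0} (- 1) Q. stalk_map n Q A w = (\<lambda>i\<in>{..<m}. \<zero>\<^bsub>loc L {0} Q\<^esub>)}"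
    unfolding m_eq by (rule E[THEN conjunct1])
  show "stalk_map n Q A ` (\<Pi>\<^sub>E j\<in>{..<r + 1}. stalk L {0} (- 1) Q) =
     (\<Pi>\<^sub>E i\<in>{..<m}. stalk L {0} (int (\<alpha> i) - 1) Q)"
    unfolding m_eq by (rule E[THEN conjunct2])
qed

lemma exact_middle:
  assumes "w \<in> (\<Pi>\<^sub>E j\<in>{..<Suc r}. stalk L {0} (- 1) Q)"
    and "stalk_map n Q A w = (\<lambda>i\<in>{..<m}. \<zero>\<^bsub>loc L {0} Q\<^esub>)"
  shows "\<exists>e\<in>(\<Pi>\<^sub>E j\<in>{..<k}. stalk L {0} (- int (\<beta> j) - 1) Q). stalk_map n Q B e = w"
proof -
  have "w \<in> stalk_map n Q B ` (\<Pi>\<^sub>E j\<in>{..<k}. stalk L {0} (- int (\<beta> j) - 1) Q)"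
    unfolding exact(1) using assms by simp
  then show ?thesis by blast
qed

lemma exact_left:
  assumes "e \<in> (\<Pi>\<^sub>E j\<in>{..<k}. stalk L {0} (- int (\<beta> j) - 1) Q)"
  shows "stalk_map n Q A (stalk_map n Q B e) = (\<lambda>i\<in>{..<m}. \<zero>\<^bsub>loc L {0} Q\<^esub>)"
  using imageI[OF assms, of "stalk_map n Q B"] unfolding exact(1) by blast

lemma exact_right:
  assumes "v \<in> (\<Pi>\<^sub>E i\<in>{..<m}. stalk L {0} (int (\<alpha> i) - 1) Q)"
  shows "\<exists>w\<in>(\<Pi>\<^sub>E j\<in>{..<Suc r}. stalk L {0} (- 1) Q). stalk_map n Q A w = v"
  using assms unfolding exact(2)[symmetric] by auto

lemma localization_Q: "localization L {0} Q"
  using Q by (intro localization_Proj) (auto simp: ideal_mpoly_iff)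

interpretation localization L "{0}" Q by (rule localization_Q)

text \<open>The coordinate ring of the line is a domain.\<close>

lemma germ_line_eq_iff:
  assumes "a \<in> polys L" "f \<in> denoms L Q" "b \<in> polys L" "g \<in> denoms L Q"
  shows "germ L {0} Q a f = germ L {0} Q b g \<longleftrightarrow> a * g = b * f"
proof -
  have "h \<noteq> 0" if "h \<in> denoms L Q" for h
    using that hom_ideal_mpolyD(1)[OF Proj_D(1)[OF Q]] ideal_mpolyD(2) by (auto simp: denoms_def)
  then show ?thesis using assms one_denoms by (subst germ_eq_iff) auto
qed

lemma stalk_map_germ:
  assumes M: "M \<in> carrier_mat N N'" and polys: "\<And>i j. i < N \<Longrightarrow> j < N' \<Longrightarrow> M $$ (i, j) \<in> polys L"
    and w: "\<And>j. j < N' \<Longrightarrow> b j \<in> polys L" "g \<in> denoms L Q" "\<And>j. j < N' \<Longrightarrow> w j = germ L {0} Q (b j) g"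
  shows "stalk_map n Q M w = (\<lambda>i\<in>{..<N}. germ L {0} Q (\<Sum>j<N'. M $$ (i, j) * b j) g)"
proof -
  have "(\<Oplus>\<^bsub>\<L>\<^esub>j\<in>{..<N'}. germ L {0} Q (M $$ (i, j)) 1 \<otimes>\<^bsub>\<L>\<^esub> w j) =
      germ L {0} Q (\<Sum>j<N'. M $$ (i, j) * b j) g" if i: "i < N" for i
  proof -
    have "(\<Oplus>\<^bsub>\<L>\<^esub>j\<in>{..<N'}. germ L {0} Q (M $$ (i, j)) 1 \<otimes>\<^bsub>\<L>\<^esub> w j) =
        (\<Oplus>\<^bsub>\<L>\<^esub>j\<in>{..<N'}. germ L {0} Q (M $$ (i, j) * b j) g)"
    proof (rule loc.finsum_cong')
      show "(\<lambda>j. germ L {0} Q (M $$ (i, j) * b j) g) \<in> {..<N'} \<rightarrow> carrier \<L>"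
        using polys i w by (auto intro!: loc_carrierI)
    qed (use polys i w in \<open>auto simp: mult_germ\<close>)
    also have "\<dots> = germ L {0} Q (\<Sum>j<N'. M $$ (i, j) * b j) g"
      using polys i w by (intro finsum_germ_same) auto
    finally show ?thesis .
  qed
  then show ?thesis using M by (auto simp: stalk_map_def Let_def intro!: restrict_ext)
qed

lemma Var_denoms: "\<tau> \<in> L \<Longrightarrow> Var \<tau> \<notin> Q \<Longrightarrow> Var \<tau> ^ N \<in> denoms L Q"
proof (induction N)
  case (Suc N)
  have "Var \<tau> \<in> denoms L Q" using Suc(2,3) by (auto simp: denoms_def)
  with Suc show ?case by auto
qed auto

lemma obtain_Var: obtains \<tau> where "\<tau> \<in> L" "Var \<tau> \<notin> Q"
  using Proj_D(4)[OF Q] by auto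

lemma homog_Var_power: "homog (int N) (Var \<tau> ^ N)"
  using homog_power[OF homog_Var, of N] by simp

lemma A_polys': "i < m \<Longrightarrow> j < Suc r \<Longrightarrow> A $$ (i, j) \<in> polys L"
  and B_polys': "j < Suc r \<Longrightarrow> l < k \<Longrightarrow> B $$ (j, l) \<in> polys L"
  using A_polys B_polys by auto

text \<open>The \<open>l\<close>-th column of \<open>B\<close>, divided by a power of a variable that is invertible at \<open>Q\<close>, is the image of a
  local section.  Fractions over the line are zero only if their numerator is, so a single point suffices.\<close>

lemma AB_zero_at_point:
  assumes i: "i < m" and l: "l < k"
  shows "(\<Sum>j\<le>r. A $$ (i, j) * B $$ (j, l)) = 0"
proof -
  obtain \<tau> where \<tau>: "\<tau> \<in> L" "Var \<tau> \<notin> Q" by (rule obtain_Var)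
  define g where "g = (Var \<tau> ^ Suc (\<beta> l) :: 'k mpoly)"
  have g: "g \<in> denoms L Q" "homog (int (\<beta> l) + 1) g"
    unfolding g_def using Var_denoms[OF \<tau>] homog_Var_power[of "Suc (\<beta> l)" \<tau>]
    by (simp_all add: add.commute del: power_Suc)
  let ?b = "\<lambda>j. if j = l then 1 else (0 :: 'k mpoly)"
  define e where "e = (\<lambda>j\<in>{..<k}. germ L {0} Q (?b j) g)"
  have "e \<in> (\<Pi>\<^sub>E j\<in>{..<k}. stalk L {0} (- int (\<beta> j) - 1) Q)"
  proof
    fix j assume "j \<in> {..<k}"
    moreover have "homog (- int (\<beta> j) - 1 + (int (\<beta> l) + 1)) (?b j)" by auto
    ultimately show "e j \<in> stalk L {0} (- int (\<beta> j) - 1) Q"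
      unfolding stalk_def e_def using g by fastforce
  qed (simp add: e_def)
  from exact_left[OF this]
  have 0: "stalk_map n Q A (stalk_map n Q B e) = (\<lambda>i\<in>{..<m}. \<zero>\<^bsub>\<L>\<^esub>)" .
  have "stalk_map n Q B e = (\<lambda>j\<in>{..<Suc r}. germ L {0} Q (\<Sum>l<k. B $$ (j, l) * ?b l) g)"
    by (rule stalk_map_germ[OF B_carrier B_polys']) (use g in \<open>auto simp: e_def\<close>)
  also have "\<dots> = (\<lambda>j\<in>{..<Suc r}. germ L {0} Q (B $$ (j, l)) g)"
    using l by (intro restrict_ext) (simp add: if_distrib cong: if_cong)
  finally have "stalk_map n Q A (stalk_map n Q B e) =
      (\<lambda>i\<in>{..<m}. germ L {0} Q (\<Sum>j<Suc r. A $$ (i, j) * B $$ (j, l)) g)"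
    by (intro stalk_map_germ[OF A_carrier A_polys']) (use g l B_polys' in auto)
  with 0 i have "germ L {0} Q (\<Sum>j<Suc r. A $$ (i, j) * B $$ (j, l)) g = germ L {0} Q 0 1"
    by (metis (no_types, lifting) lessThan_iff restrict_apply' loc_zero)
  then have "(\<Sum>j<Suc r. A $$ (i, j) * B $$ (j, l)) = 0"
    using g i l A_polys' B_polys' by (subst (asm) germ_line_eq_iff) auto
  then show ?thesis by (simp only: lessThan_Suc_atMost)
qed

text \<open>Exactness in the middle, with denominators cleared.  Dividing by a power of a variable that is
  invertible at \<open>Q\<close> turns polynomials of degree \<open>d\<close> into germs of degree \<open>-1\<close>.\<close>

lemma local_syzygy:
  assumes y: "\<And>j. j \<le> r \<Longrightarrow> y j \<in> polys L" "\<And>j. j \<le> r \<Longrightarrow> homog d (y j)"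
    and Ay: "\<And>i. i < m \<Longrightarrow> (\<Sum>j\<le>r. A $$ (i, j) * y j) = 0"
  obtains g b where "g \<in> denoms L Q" "\<And>l. l < k \<Longrightarrow> b l \<in> polys L"
    "\<And>j. j \<le> r \<Longrightarrow> g * y j = (\<Sum>l<k. B $$ (j, l) * b l)"
proof (cases "d < 0")
  \<comment> \<open>A form of negative degree is zero, and there is nothing to divide by.\<close>
  case True
  have "y j = 0" if "j \<le> r" for j
    using y(2)[OF that] hcomp_neg[OF True, of "y j"] by (simp add: homog_iff)
  then show ?thesis by (intro that[of 1 "\<lambda>_. 0"]) auto
next
  case False
  obtain \<tau> where \<tau>: "\<tau> \<in> L" "Var \<tau> \<notin> Q" by (rule obtain_Var)
  define f where "f = (Var \<tau> ^ nat (d + 1) :: 'k mpoly)"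
  have f: "f \<in> denoms L Q" "homog (d + 1) f"
    unfolding f_def using Var_denoms[OF \<tau>] homog_Var_power[of "nat (d + 1)" \<tau>] False by simp_all
  define w where "w = (\<lambda>j\<in>{..<Suc r}. germ L {0} Q (y j) f)"
  have w: "w \<in> (\<Pi>\<^sub>E j\<in>{..<Suc r}. stalk L {0} (- 1) Q)"
  proof
    fix j assume j: "j \<in> {..<Suc r}"
    then have "homog (- 1 + (d + 1)) (y j)" using y(2) by simp
    then show "w j \<in> stalk L {0} (- 1) Q"
      unfolding stalk_def w_def using j f y(1) by fastforce
  qed (simp add: w_def)
  have "stalk_map n Q A w = (\<lambda>i\<in>{..<m}. germ L {0} Q (\<Sum>j<Suc r. A $$ (i, j) * y j) f)"
    by (rule stalk_map_germ[OF A_carrier A_polys']) (use f y in \<open>auto simp: w_def\<close>)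
  also have "\<dots> = (\<lambda>i\<in>{..<m}. germ L {0} Q 0 f)"
  proof (rule restrict_ext)
    fix i assume "i \<in> {..<m}"
    then have "(\<Sum>j<Suc r. A $$ (i, j) * y j) = 0"
      using Ay[of i] unfolding lessThan_Suc_atMost by simp
    then show "germ L {0} Q (\<Sum>j<Suc r. A $$ (i, j) * y j) f = germ L {0} Q 0 f" by simp
  qed
  also have "\<dots> = (\<lambda>i\<in>{..<m}. \<zero>\<^bsub>\<L>\<^esub>)"
  proof (rule restrict_ext)
    show "germ L {0} Q 0 f = \<zero>\<^bsub>\<L>\<^esub>"
      unfolding loc_zero by (rule germ_eqI) (use f in auto)
  qed
  finally obtain e where e: "e \<in> (\<Pi>\<^sub>E j\<in>{..<k}. stalk L {0} (- int (\<beta> j) - 1) Q)" "stalk_map n Q B e = w"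
    using exact_middle[OF w] by metis
  have st: "e j \<in> stalk L {0} (- int (\<beta> j) - 1) Q" if "j < k" for j using e(1) that by blast
  obtain b g where bg: "g \<in> denoms L Q" "\<And>l. l < k \<Longrightarrow> b l \<in> polys L"
    "\<And>l. l < k \<Longrightarrow> e l = germ L {0} Q (b l) g"
    by (rule stalk_common_denominator[OF st]) blast+
  have Be: "stalk_map n Q B e = (\<lambda>j\<in>{..<Suc r}. germ L {0} Q (\<Sum>l<k. B $$ (j, l) * b l) g)"
    by (rule stalk_map_germ[OF B_carrier B_polys']) (use bg in auto)
  show ?thesis
  proof (rule that[of g "\<lambda>l. b l * f"])
    fix j assume j: "j \<le> r"
    then have "w j = (\<lambda>j\<in>{..<Suc r}. germ L {0} Q (\<Sum>l<k. B $$ (j, l) * b l) g) j"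
      using e(2) Be by simp
    then have "germ L {0} Q (y j) f = germ L {0} Q (\<Sum>l<k. B $$ (j, l) * b l) g"
      using j by (simp add: w_def)
    then have "y j * g = (\<Sum>l<k. B $$ (j, l) * b l) * f"
      using j f bg y B_polys by (subst (asm) germ_line_eq_iff) auto
    then show "g * y j = (\<Sum>l<k. B $$ (j, l) * (b l * f))"
      by (simp add: sum_distrib_left mult_ac)
  qed (use bg f denoms_polys in auto)
qed

text \<open>Surjectivity of \<open>A\<close>, with denominators cleared.\<close>

lemma local_right_inverse:
  assumes i: "i < m"
  obtains g c where "g \<in> denoms L Q" "\<And>j. j \<le> r \<Longrightarrow> c j \<in> polys L"
    "\<And>i'. i' < m \<Longrightarrow> (\<Sum>j\<le>r. A $$ (i', j) * c j) = (if i' = i then g else 0)"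
proof -
  obtain \<tau> where \<tau>: "\<tau> \<in> L" "Var \<tau> \<notin> Q" by (rule obtain_Var)
  define t where "t = (Var \<tau> ^ \<alpha> i :: 'k mpoly)"
  have t: "t \<in> denoms L Q" "homog (int (\<alpha> i)) t" and \<tau>1: "Var \<tau> \<in> denoms L Q"
    unfolding t_def using Var_denoms[OF \<tau>] Var_denoms[OF \<tau>, of 1] homog_Var_power by simp_all
  let ?t = "\<lambda>i'. if i' = i then t else 0"
  define v where "v = (\<lambda>i'\<in>{..<m}. germ L {0} Q (?t i') (Var \<tau>))"
  have "v \<in> (\<Pi>\<^sub>E i\<in>{..<m}. stalk L {0} (int (\<alpha> i) - 1) Q)"
  proof
    fix i' assume i': "i' \<in> {..<m}"
    then have "homog (int (\<alpha> i') - 1 + 1) (?t i')" using t(2) by simp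
    then show "v i' \<in> stalk L {0} (int (\<alpha> i') - 1) Q"
      unfolding stalk_def v_def using i' t(1) \<tau>1 homog_Var denoms_polys by fastforce
  qed (simp add: v_def)
  then obtain w where w: "w \<in> (\<Pi>\<^sub>E j\<in>{..<Suc r}. stalk L {0} (- 1) Q)" "stalk_map n Q A w = v"
    using exact_right by blast
  have st: "w j \<in> stalk L {0} (- 1) Q" if "j < Suc r" for j using w(1) that by blast
  obtain c g where cg: "g \<in> denoms L Q" "\<And>j. j < Suc r \<Longrightarrow> c j \<in> polys L"
    "\<And>j. j < Suc r \<Longrightarrow> w j = germ L {0} Q (c j) g"
    by (rule stalk_common_denominator[OF st]) blast+
  have Aw: "stalk_map n Q A w = (\<lambda>i\<in>{..<m}. germ L {0} Q (\<Sum>j<Suc r. A $$ (i, j) * c j) g)"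
    by (rule stalk_map_germ[OF A_carrier A_polys']) (use cg in auto)
  show ?thesis
  proof (rule that[of "t * g" "\<lambda>j. c j * Var \<tau>"])
    fix i' assume i': "i' < m"
    then have "v i' = (\<lambda>i\<in>{..<m}. germ L {0} Q (\<Sum>j<Suc r. A $$ (i, j) * c j) g) i'"
      using w(2) Aw by simp
    then have "germ L {0} Q (?t i') (Var \<tau>) = germ L {0} Q (\<Sum>j<Suc r. A $$ (i', j) * c j) g"
      using i' by (simp add: v_def)
    then have "?t i' * g = (\<Sum>j<Suc r. A $$ (i', j) * c j) * Var \<tau>"
      using i' t \<tau>1 cg A_polys' denoms_polys by (subst (asm) germ_line_eq_iff) auto
    then show "(\<Sum>j\<le>r. A $$ (i', j) * (c j * Var \<tau>)) = (if i' = i then t * g else 0)"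
      by (auto simp: sum_distrib_left mult_ac lessThan_Suc_atMost split: if_splits)
  qed (use cg t \<tau> \<tau>1 denoms_polys in \<open>auto simp: less_Suc_eq_le\<close>)
qed

end

end


context rope_with_matrices
begin

lemma hom_ideal_I: "hom_ideal {..n} I" and Proj_I: "Proj {..n} I = Proj {..n} IL" and IL2_I: "IL2 \<subseteq> I"
  using rope by (auto simp: rope_def curve_def)

lemma ideal_I: "ideal I R"
  by (rule hom_ideal_mpolyD(1)[OF hom_ideal_I])

sublocale proj_scheme "{..n}" I
  by (rule proj_scheme.intro) (rule ideal_I)

lemma AB_zero: "i < m \<Longrightarrow> l < k \<Longrightarrow> (\<Sum>j\<le>r. A $$ (i, j) * B $$ (j, l)) = 0"
  by (rule AB_zero_at_point[OF zero_Proj_L])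

lemma x_notin_L': "j \<le> r \<Longrightarrow> j \<notin> L"
  using x_notin_L r_eq by simp

lemma Var_mult_polys: "j \<le> r \<Longrightarrow> f \<in> polys L \<Longrightarrow> Var j * f \<in> polys {..n}"
  using r_eq by (simp add: polys_L_R)

text \<open>The image under \<open>A\<close> of the linear part of \<open>a\<close>.  For \<open>a\<close> in the ideal of the line, these are
  the components of the class of \<open>a\<close> modulo \<open>I\<close>, seen in the right-hand term of the exact sequence.  Together with \<^const>\<open>const_part\<close> it is a ring
  homomorphism to the dual numbers over the coordinate ring of the line.\<close>

definition conormal :: "nat \<Rightarrow> 'k mpoly \<Rightarrow> 'k mpoly" where
  "conormal i a = (\<Sum>j\<le>r. A $$ (i, j) * lin_part L j a)"

lemma conormal_simps [simp]:
  "conormal i (a + b) = conormal i a + conormal i b" "conormal i (a - b) = conormal i a - conormal i b" "conormal i 0 = 0"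
  by (simp_all add: conormal_def algebra_simps sum.distrib sum_subtractf)

lemma conormal_sum: "conormal i (sum f X) = (\<Sum>x\<in>X. conormal i (f x))"
  by (induction X rule: infinite_finite_induct) auto

lemma conormal_mult: "conormal i (a * b) = const_part L a * conormal i b + conormal i a * const_part L b"
proof -
  have "conormal i (a * b) = (\<Sum>j\<le>r. const_part L a * (A $$ (i, j) * lin_part L j b) +
      A $$ (i, j) * lin_part L j a * const_part L b)"
    unfolding conormal_def by (intro sum.cong refl) (simp add: lin_part_mult x_notin_L' algebra_simps)
  then show ?thesis by (simp add: conormal_def sum.distrib sum_distrib_left sum_distrib_right)
qed

lemma polys_conormal: "i < m \<Longrightarrow> conormal i a \<in> polys L"
  unfolding conormal_def using A_polys by (intro polys_sum polys_mult) auto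

lemma conormal_polys: "f \<in> polys L \<Longrightarrow> conormal i f = 0"
  unfolding conormal_def by (intro sum.neutral) (simp add: lin_part_polys x_notin_L')

lemma homog_conormal: "i < m \<Longrightarrow> homog d a \<Longrightarrow> homog (int (\<alpha> i) + d - 1) (conormal i a)"
  unfolding conormal_def using A_homog
  by (intro homog_sum homog_mult'[where d = "int (\<alpha> i)" and e = "d - 1"]) (auto intro: homog_lin_part)

lemma kernel_ideal: "ideal {a \<in> polys {..n}. const_part L a = 0 \<and> (\<forall>i<m. conormal i a = 0)} R" (is "ideal ?K R")
  unfolding ideal_mpoly_iff by (auto simp: const_part_mult conormal_mult)

lemma I_kernel:
  assumes "a \<in> I"
  shows "const_part L a = 0" "i < m \<Longrightarrow> conormal i a = 0"
proof -
  let ?K = "{a \<in> polys {..n}. const_part L a = 0 \<and> (\<forall>i<m. conormal i a = 0)}"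
  have "IL2 \<subseteq> ?K"
  proof
    fix a :: "'k mpoly" assume "a \<in> IL2"
    then show "a \<in> ?K"
      by (induction rule: ideal_prod.induct) (auto simp: IL_iff const_part_mult conormal_mult)
  qed
  moreover have "(\<Sum>j\<le>r. Var j * B $$ (j, l)) \<in> ?K" if l: "l < k" for l
  proof -
    have B: "B $$ (j, l) \<in> polys L" if "j \<le> r" for j using B_polys that l by blast
    have "Var j * B $$ (j, l) \<in> polys {..n}" if "j \<le> r" for j
      using that B[OF that] by (rule Var_mult_polys)
    moreover have "const_part L (\<Sum>j\<le>r. Var j * B $$ (j, l)) = 0"
      unfolding const_part_sum using x_notin_L'
      by (intro sum.neutral) (simp add: const_part_mult const_part_Var)
    moreover have "conormal i (\<Sum>j\<le>r. Var j * B $$ (j, l)) = 0" if i: "i < m" for i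
    proof -
      have "conormal i (Var j * B $$ (j, l)) = A $$ (i, j) * B $$ (j, l)" if j: "j \<le> r" for j
      proof -
        have "conormal i (Var j) = (\<Sum>j'\<le>r. if j' = j then A $$ (i, j) else 0)"
          unfolding conormal_def using j x_notin_L' by (intro sum.cong) (auto simp: lin_part_Var)
        also have "\<dots> = A $$ (i, j)" using j by simp
        finally show ?thesis
          using j x_notin_L' by (simp add: conormal_mult conormal_polys B const_part_polys)
      qed
      then have "conormal i (\<Sum>j\<le>r. Var j * B $$ (j, l)) = (\<Sum>j\<le>r. A $$ (i, j) * B $$ (j, l))"
        unfolding conormal_sum by (intro sum.cong) auto
      then show ?thesis using AB_zero[OF i l] by simp
    qed
    ultimately show ?thesis by auto
  qed
  ultimately have "I \<subseteq> ?K"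
    unfolding I_gen
    by (intro ring.genideal_minimal[OF cring.axioms(1)[OF cring_mpoly_ring] kernel_ideal]) auto
  with assms show "const_part L a = 0" "i < m \<Longrightarrow> conormal i a = 0" by auto
qed

lemma denoms_const_part:
  assumes P: "P \<in> Proj {..n} I" and h: "h \<in> denoms {..n} P"
  shows "const_part L h \<notin> P" "const_part L h \<noteq> 0"
proof -
  show *: "const_part L h \<notin> P"
    using const_part_mem_iff[of P h] P h by (auto simp: Proj_I denoms_def)
  have "0 \<in> P" using ideal_mpolyD(2)[OF hom_ideal_mpolyD(1)[OF Proj_D(1)[OF P]]] .
  with * show "const_part L h \<noteq> 0" by metis
qed

lemma local_kernel:
  assumes P: "P \<in> Proj {..n} I" and h: "h \<in> denoms {..n} P" and ha: "h * a \<in> I"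
  shows "const_part L a = 0" "i < m \<Longrightarrow> conormal i a = 0"
proof -
  note h0 = denoms_const_part(2)[OF P h]
  show c: "const_part L a = 0" using I_kernel(1)[OF ha] h0 by (simp add: const_part_mult)
  show "i < m \<Longrightarrow> conormal i a = 0" using I_kernel(2)[OF ha] h0 c by (simp add: conormal_mult)
qed

text \<open>The linear part of \<open>a\<close> is a syzygy of \<open>A\<close>, hence locally a combination of the columns of \<open>B\<close>, and these
  give elements of \<open>I\<close>.\<close>

lemma local_kernel_converse:
  assumes P: "P \<in> Proj {..n} I" and a: "a \<in> polys {..n}" "homog d a"
    and zero: "const_part L a = 0" "\<And>i. i < m \<Longrightarrow> conormal i a = 0"
  shows "\<exists>h\<in>denoms {..n} P. h * a \<in> I"
proof -
  define Q where "Q = P \<inter> polys L"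
  have Q: "Q \<in> Proj L {0}" unfolding Q_def using P Proj_I by (intro Proj_IL_restrict) simp
  obtain g b where g: "g \<in> denoms L Q" and b: "\<And>l. l < k \<Longrightarrow> b l \<in> polys L"
    and gb: "\<And>j. j \<le> r \<Longrightarrow> g * lin_part L j a = (\<Sum>l<k. B $$ (j, l) * b l)"
  proof (rule local_syzygy[OF Q, of "\<lambda>j. lin_part L j a" "d - 1"])
    show "homog (d - 1) (lin_part L j a)" for j by (rule homog_lin_part[OF a(2)])
    show "(\<Sum>j\<le>r. A $$ (i, j) * lin_part L j a) = 0" if "i < m" for i
      using zero(2)[OF that] by (simp add: conormal_def)
  qed auto
  have gP: "g \<in> denoms {..n} P"
    using g by (auto simp: denoms_def Q_def polys_L_R)
  have g_pol: "g \<in> polys {..n}" using gP by (simp add: denoms_def)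
  define x where "x = a - const_part L a - (\<Sum>j\<le>n-2. lin_part L j a * Var j)"
  have x: "x \<in> I" unfolding x_def using taylor_IL2[OF a(1)] IL2_I by blast
  have "a = x + (\<Sum>j\<le>r. lin_part L j a * Var j)"
    by (simp add: x_def zero r_eq)
  then have "g * a = g * (x + (\<Sum>j\<le>r. lin_part L j a * Var j))"
    by (rule arg_cong)
  also have "\<dots> = g * x + (\<Sum>j\<le>r. (g * lin_part L j a) * Var j)"
    by (simp only: distrib_left sum_distrib_left mult.assoc)
  also have "(\<Sum>j\<le>r. (g * lin_part L j a) * Var j) = (\<Sum>j\<le>r. \<Sum>l<k. b l * (Var j * B $$ (j, l)))"
    by (intro sum.cong refl) (simp add: gb sum_distrib_left mult_ac)
  also have "\<dots> = (\<Sum>l<k. b l * (\<Sum>j\<le>r. Var j * B $$ (j, l)))"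
    by (subst sum.swap) (simp add: sum_distrib_left)
  finally have eq: "g * a = g * x + (\<Sum>l<k. b l * (\<Sum>j\<le>r. Var j * B $$ (j, l)))" .
  have "(\<Sum>j\<le>r. Var j * B $$ (j, l)) \<in> I" if l: "l < k" for l
  proof -
    have "Var j * B $$ (j, l) \<in> polys {..n}" if "j \<le> r" "l < k" for j l
      using that B_polys by (intro Var_mult_polys) auto
    then have "IL2 \<union> {\<Sum>i\<le>r. Var i * B $$ (i, l) | l. l < k} \<subseteq> polys {..n}"
      using ideal_mpolyD(1)[OF ideal_IL2] by (auto intro!: polys_sum)
    from ring.genideal_self[OF cring.axioms(1)[OF cring_mpoly_ring] this]
    show ?thesis unfolding I_gen using l by blast
  qed
  note gens = this
  have "(\<Sum>l<k. b l * (\<Sum>j\<le>r. Var j * B $$ (j, l))) \<in> I"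
  proof (rule ideal_mpoly_sum[OF ideal_I])
    fix l assume "l \<in> {..<k}"
    then have "b l \<in> polys {..n}" "l < k" using b polys_L_R by auto
    then show "b l * (\<Sum>j\<le>r. Var j * B $$ (j, l)) \<in> I"
      using gens by (intro ideal_mpolyD(4)[OF ideal_I])
  qed
  then have "g * a \<in> I"
    unfolding eq using x g_pol by (simp add: ideal_mpolyD(3,4)[OF ideal_I])
  with gP show ?thesis by blast
qed

text \<open>The quotient of the dual numbers \<open>const_part L a + \<Sum>\<^sub>i conormal i a \<epsilon>\<^sub>i\<close> and \<open>const_part L f + \<Sum>\<^sub>i conormal i f \<epsilon>\<^sub>i\<close>
  over the fraction field: number 0 is its constant term, number \<open>i + 1\<close> its coefficient at \<open>\<epsilon>\<^sub>i\<close>.\<close>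

definition coord :: "nat \<Rightarrow> 'k mpoly \<Rightarrow> 'k mpoly \<Rightarrow> 'k mpoly fract" where
  "coord i a f = (case i of
     0 \<Rightarrow> to_fract (const_part L a) / to_fract (const_part L f)
   | Suc i \<Rightarrow> (to_fract (conormal i a) * to_fract (const_part L f) - to_fract (const_part L a) * to_fract (conormal i f)) /
       (to_fract (const_part L f))\<^sup>2)"

lemma coord_simps:
  "coord 0 a f = to_fract (const_part L a) / to_fract (const_part L f)"
  "coord (Suc i) a f =
    (to_fract (conormal i a) * to_fract (const_part L f) - to_fract (const_part L a) * to_fract (conormal i f)) /
       (to_fract (const_part L f))\<^sup>2"
  by (simp_all add: coord_def)

lemma coord_eq_iff:
  assumes nz: "const_part L f \<noteq> 0" "const_part L g \<noteq> 0"
  shows "(\<forall>i\<le>m. coord i a f = coord i b g) \<longleftrightarrow>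
    const_part L (a * g - b * f) = 0 \<and> (\<forall>i<m. conormal i (a * g - b * f) = 0)"
proof -
  have split: "(\<forall>i\<le>m. Q i) \<longleftrightarrow> Q 0 \<and> (\<forall>i<m. Q (Suc i))" for Q
    by (metis Suc_le_eq le0 not0_implies_Suc)
  have 0: "coord 0 a f = coord 0 b g \<longleftrightarrow> const_part L (a * g - b * f) = 0"
    unfolding coord_simps const_part_diff const_part_mult using nz
    by (simp add: field_simps flip: to_fract_mult)
  have "coord (Suc i) a f = coord (Suc i) b g \<longleftrightarrow> conormal i (a * g - b * f) = 0"
    if c: "const_part L (a * g - b * f) = 0" for i
  proof -
    define a0 b0 f0 g0 a1 b1 f1 g1 where defs:
      "a0 = to_fract (const_part L a)" "b0 = to_fract (const_part L b)"
      "f0 = to_fract (const_part L f)" "g0 = to_fract (const_part L g)"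
      "a1 = to_fract (conormal i a)" "b1 = to_fract (conormal i b)"
      "f1 = to_fract (conormal i f)" "g1 = to_fract (conormal i g)"
    have nz': "f0 \<noteq> 0" "g0 \<noteq> 0" using nz by (simp_all add: defs)
    have "a0 * g0 = b0 * f0"
      using c by (simp add: defs const_part_mult flip: to_fract_mult)
    then have a0: "a0 = b0 * f0 / g0" using nz' by (simp add: field_simps)
    have "coord (Suc i) a f - coord (Suc i) b g = (a1 * f0 - a0 * f1) / f0\<^sup>2 - (b1 * g0 - b0 * g1) / g0\<^sup>2"
      by (simp add: coord_simps defs)
    also have "\<dots> = (a0 * g1 + a1 * g0 - (b0 * f1 + b1 * f0)) / (f0 * g0)"
      using nz' by (simp add: a0 field_simps power2_eq_square)
    also have "a0 * g1 + a1 * g0 - (b0 * f1 + b1 * f0) = to_fract (conormal i (a * g - b * f))"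
      by (simp add: defs conormal_mult)
    finally show ?thesis using nz' by (metis divide_eq_0_iff no_zero_divisors right_minus_eq to_fract_eq_0_iff)
  qed
  with 0 show ?thesis unfolding split by metis
qed

text \<open>Coordinates do not depend on the point: a germ at any point determines them as elements of one and
  the same field.\<close>

lemma coord_germ:
  assumes P: "P \<in> Proj {..n} I" and "a \<in> polys {..n}" "f \<in> denoms {..n} P" "b \<in> polys {..n}" "g \<in> denoms {..n} P"
    and eq: "germ {..n} I P a f = germ {..n} I P b g" and i: "i \<le> m"
  shows "coord i a f = coord i b g"
proof -
  interpret localization "{..n}" I P by (rule localization) fact
  obtain h where h: "h \<in> denoms {..n} P" "h * (a * g - b * f) \<in> I"
    using germ_eq_iff[of a f b g] assms by blast
  then have "\<forall>i\<le>m. coord i a f = coord i b g"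
    using denoms_const_part(2)[OF P] assms local_kernel[OF P h] by (subst coord_eq_iff) auto
  with i show ?thesis by blast
qed

lemma germ_coord:
  assumes P: "P \<in> Proj {..n} I" and ab: "a \<in> polys {..n}" "f \<in> denoms {..n} P" "b \<in> polys {..n}" "g \<in> denoms {..n} P"
    and hom: "homog (d + e) a" "homog e f" "homog (d + e') b" "homog e' g"
    and eq: "\<And>i. i \<le> m \<Longrightarrow> coord i a f = coord i b g"
  shows "germ {..n} I P a f = germ {..n} I P b g"
proof -
  interpret localization "{..n}" I P by (rule localization) fact
  have "const_part L (a * g - b * f) = 0 \<and> (\<forall>i<m. conormal i (a * g - b * f) = 0)"
    using eq denoms_const_part(2)[OF P] ab by (subst coord_eq_iff[symmetric]) auto
  moreover have "homog (d + e + e') (a * g - b * f)"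
    by (intro homog_diff homog_mult'[OF hom(1) hom(4)] homog_mult'[OF hom(3) hom(2)]) auto
  ultimately have "\<exists>h\<in>denoms {..n} P. h * (a * g - b * f) \<in> I"
    using ab denoms_polys by (intro local_kernel_converse[OF P]) auto
  then show ?thesis using germ_eq_iff ab by blast
qed

definition column_sets :: "nat set set" where
  "column_sets = {J. J \<subseteq> {..r} \<and> card J = m}"

text \<open>The denominator, and below the numerator, of \<open>z\<^sub>i\<close> on the open set that belongs to \<open>J\<close>.\<close>

definition max_minor :: "nat set \<Rightarrow> 'k mpoly" where
  "max_minor J = det (col_submat A J)"

definition z_num :: "nat set \<Rightarrow> nat \<Rightarrow> 'k mpoly" where
  "z_num J i = (\<Sum>l<m. Var (pick J l) * adj_mat (col_submat A J) $$ (l, i))"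

text \<open>As \<open>A\<close> is surjective at \<open>P\<close>, some matrix \<open>M\<close> makes \<open>A * M\<close> diagonal with entries outside \<open>P\<close>; then the maximal
  minors of \<open>A\<close> cannot all lie in \<open>P\<close>.\<close>

lemma minor_cover:
  assumes P: "P \<in> Proj {..n} I"
  obtains J where "J \<in> column_sets" "max_minor J \<notin> P"
proof -
  define Q where "Q = P \<inter> polys L"
  have Q: "Q \<in> Proj L {0}" unfolding Q_def using P Proj_I by (intro Proj_IL_restrict) simp
  interpret localization L "{0}" Q by (rule localization_Q[OF Q])
  define W where "W i gc \<longleftrightarrow> fst gc \<in> denoms L Q \<and> (\<forall>j\<le>r. snd gc j \<in> polys L) \<and>
      (\<forall>i'<m. (\<Sum>j\<le>r. A $$ (i', j) * snd gc j) = (if i' = i then fst gc else 0))" for i gc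
  have "\<exists>gc. i < m \<longrightarrow> W i gc" for i
  proof (cases "i < m")
    case True
    show ?thesis
    proof (rule local_right_inverse[OF Q True])
      fix g c
      assume "g \<in> denoms L Q" "\<And>j. j \<le> r \<Longrightarrow> c j \<in> polys L"
        "\<And>i'. i' < m \<Longrightarrow> (\<Sum>j\<le>r. A $$ (i', j) * c j) = (if i' = i then g else 0)"
      then have "W i (g, c)" by (simp add: W_def)
      then show ?thesis by blast
    qed
  qed simp
  then obtain gc where gc': "\<And>i. i < m \<Longrightarrow> W i (gc i)" by metis
  define g where "g i = fst (gc i)" for i
  define c where "c i = snd (gc i)" for i
  have gc: "g i \<in> denoms L Q" "j \<le> r \<Longrightarrow> c i j \<in> polys L"
    "i' < m \<Longrightarrow> (\<Sum>j\<le>r. A $$ (i', j) * c i j) = (if i' = i then g i else 0)" if "i < m" for i i' j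
    using gc'[OF that] by (simp_all add: W_def g_def c_def)
  define M where "M = mat (Suc r) m (\<lambda>(j, i). c i j)"
  have AM: "A * M = mat m m (\<lambda>(i', i). if i' = i then g i else 0)"
  proof (rule eq_matI)
    fix i' i assume "i' < dim_row (mat m m (\<lambda>(i', i). if i' = i then g i else 0))"
      "i < dim_col (mat m m (\<lambda>(i', i). if i' = i then g i else 0))"
    then have i: "i' < m" "i < m" by auto
    have "(A * M) $$ (i', i) = (\<Sum>j\<in>{0..<Suc r}. A $$ (i', j) * c i j)"
      using i A_carrier by (simp add: M_def scalar_prod_def)
    also have "\<dots> = (\<Sum>j\<le>r. A $$ (i', j) * c i j)"
      by (rule sum.cong) auto
    finally show "(A * M) $$ (i', i) = mat m m (\<lambda>(i', i). if i' = i then g i else 0) $$ (i', i)"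
      using i gc(3) by simp
  qed (use A_carrier in \<open>auto simp: M_def\<close>)
  have "det (A * M) = prod_list (diag_mat (A * M))"
    unfolding AM by (rule det_upper_triangular) (auto intro!: upper_triangularI)
  also have "\<dots> = (\<Prod>i=0..<m. g i)"
    unfolding AM by (simp add: prod_list_diag_prod)
  also have "\<dots> \<in> denoms L Q" by (rule prod_denoms) (simp add: gc(1))
  finally have "det (A * M) \<in> denoms L Q" .
  then have "det (A * M) \<notin> P" by (auto simp: denoms_def Q_def)
  moreover have "ideal P R" using Proj_D(1)[OF P] by (rule hom_ideal_mpolyD(1))
  ultimately obtain J where "J \<subseteq> {..<Suc r}" "card J = m" "det (col_submat A J) \<notin> P"
    using exists_minor_not_in_ideal[OF A_carrier, of M "{..n}" P] A_polys gc(2)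
    by (auto simp: M_def polys_L_R less_Suc_eq_le)
  then show ?thesis using that[of J] by (simp add: column_sets_def max_minor_def lessThan_Suc_atMost)
qed

context
  fixes J assumes J: "J \<in> column_sets"
begin

lemma submat: "col_submat A J \<in> carrier_mat m m"
  "i < m \<Longrightarrow> l < m \<Longrightarrow> col_submat A J $$ (i, l) = A $$ (i, pick J l)"
  using col_submat_carrier[OF A_carrier, of J] J by (auto simp: column_sets_def lessThan_Suc_atMost)

lemma pick_le_r: "l < m \<Longrightarrow> pick J l \<le> r"
  using pick_in_set_le[of l J] J by (auto simp: column_sets_def)

lemma submat_polys: "i < m \<Longrightarrow> l < m \<Longrightarrow> col_submat A J $$ (i, l) \<in> polys L"
  and submat_homog: "i < m \<Longrightarrow> l < m \<Longrightarrow> homog (int (\<alpha> i)) (col_submat A J $$ (i, l))"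
  using submat pick_le_r A_polys A_homog by auto

lemma minor_polys: "max_minor J \<in> polys L"
  unfolding max_minor_def by (rule det_polys[OF submat(1)]) (rule submat_polys)

lemma minor_homog: "homog (\<Sum>i<m. int (\<alpha> i)) (max_minor J)"
  unfolding max_minor_def by (rule det_homog[OF submat(1)]) (rule submat_homog)

lemma adj_polys: "i < m \<Longrightarrow> l < m \<Longrightarrow> adj_mat (col_submat A J) $$ (l, i) \<in> polys L"
  by (rule adj_mat_polys[OF submat(1)]) (rule submat_polys)

lemma z_num_polys: "i < m \<Longrightarrow> z_num J i \<in> polys {..n}"
  unfolding z_num_def using pick_le_r by (intro polys_sum Var_mult_polys adj_polys) auto

lemma z_num_homog:
  assumes "i < m"
  shows "homog (1 - int (\<alpha> i) + (\<Sum>i<m. int (\<alpha> i))) (z_num J i)"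
proof -
  have "homog ((\<Sum>i<m. int (\<alpha> i)) - int (\<alpha> i)) (adj_mat (col_submat A J) $$ (l, i))" if "l < m" for l
    by (rule adj_mat_homog[OF submat(1)]) (use submat_homog that assms in auto)
  then show ?thesis
    unfolding z_num_def by (intro homog_sum homog_mult'[OF homog_Var]) auto
qed

lemma const_part_z_num: "const_part L (z_num J i) = 0"
  unfolding z_num_def const_part_sum using pick_le_r x_notin_L'
  by (intro sum.neutral) (simp add: const_part_mult const_part_Var)

text \<open>Cramer's rule, \<open>A\<^sub>J adj(A\<^sub>J) = det A\<^sub>J\<close>.\<close>

lemma conormal_z_num:
  assumes i: "i < m" and i': "i' < m"
  shows "conormal i' (z_num J i) = (if i' = i then max_minor J else 0)"
proof -
  have "conormal i' (Var (pick J l) * adj_mat (col_submat A J) $$ (l, i)) =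
      col_submat A J $$ (i', l) * adj_mat (col_submat A J) $$ (l, i)" if l: "l < m" for l
  proof -
    have "conormal i' (Var (pick J l)) = (\<Sum>j\<le>r. if j = pick J l then A $$ (i', pick J l) else 0)"
      unfolding conormal_def using pick_le_r[OF l] x_notin_L' by (intro sum.cong) (auto simp: lin_part_Var)
    also have "\<dots> = A $$ (i', pick J l)" using pick_le_r[OF l] by simp
    finally show ?thesis
      using adj_polys[OF i l] submat(2)[OF i' l] pick_le_r[OF l] x_notin_L'
      by (simp add: conormal_mult conormal_polys const_part_polys)
  qed
  then have "conormal i' (z_num J i) = (\<Sum>l<m. col_submat A J $$ (i', l) * adj_mat (col_submat A J) $$ (l, i))"
    unfolding z_num_def conormal_sum by (intro sum.cong) auto
  also have "\<dots> = (col_submat A J * adj_mat (col_submat A J)) $$ (i', i)"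
    using i i' submat(1) adj_mat(1)[OF submat(1)] by (auto simp: scalar_prod_def intro!: sum.cong)
  also have "\<dots> = (if i' = i then max_minor J else 0)"
    using adj_mat(2)[OF submat(1)] i i' by (simp add: max_minor_def)
  finally show ?thesis .
qed

lemma minor_denoms: "P \<in> Proj {..n} I \<Longrightarrow> max_minor J \<notin> P \<Longrightarrow> max_minor J \<in> denoms {..n} P"
  using minor_polys minor_homog by (auto simp: denoms_def polys_L_R)

end

text \<open>The fraction for \<open>J\<close> has the coordinates of a unit vector, so the fractions for all \<open>J\<close> agree.\<close>

lemma z_sec_germ:
  assumes P: "P \<in> Proj {..n} I" and J: "J \<in> column_sets" "max_minor J \<notin> P" and i: "i < m"
  shows "z_sec n k I A i P = germ {..n} I P (z_num J i) (max_minor J)"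
proof -
  have eq: "germ {..n} I P (z_num J i) (max_minor J) = germ {..n} I P (z_num J' i) (max_minor J')"
    if J': "J' \<in> column_sets" "max_minor J' \<notin> P" for J'
  proof (rule germ_coord[OF P])
    note d = minor_denoms[OF J(1) P J(2)] minor_denoms[OF J'(1) P J'(2)]
    show "max_minor J \<in> denoms {..n} P" "max_minor J' \<in> denoms {..n} P" by (fact d)+
    have "coord i' (z_num J i) (max_minor J) = (if i' = Suc i then 1 else 0)" if "J \<in> column_sets" "max_minor J \<noteq> 0" "i' \<le> m" for i' J
      using that i by (cases i') (auto simp: coord_simps const_part_z_num conormal_z_num const_part_polys minor_polys power2_eq_square)
    then show "coord i' (z_num J i) (max_minor J) = coord i' (z_num J' i) (max_minor J')" if "i' \<le> m" for i'
      using that J J' denoms_const_part(2)[OF P d(1)] denoms_const_part(2)[OF P d(2)]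
      by (simp add: const_part_polys minor_polys)
    show "homog (1 - int (\<alpha> i) + (\<Sum>i<m. int (\<alpha> i))) (z_num J i)" "homog (\<Sum>i<m. int (\<alpha> i)) (max_minor J)"
      "homog (1 - int (\<alpha> i) + (\<Sum>i<m. int (\<alpha> i))) (z_num J' i)" "homog (\<Sum>i<m. int (\<alpha> i)) (max_minor J')"
      by (intro z_num_homog minor_homog J J' i)+
  qed (use z_num_polys J J' i in auto)
  have cs: "J \<subseteq> {..r} \<and> card J = r + 1 - k \<and> det (col_submat A J) \<notin> P \<longleftrightarrow> J \<in> column_sets \<and> max_minor J \<notin> P" for J
    unfolding column_sets_def max_minor_def m_eq by blast
  have sums: "(\<Sum>l\<le>r - k. f l) = (\<Sum>l<m. f l :: 'k mpoly)" for f
    by (simp add: lessThan_Suc_atMost)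
  have "z_sec n k I A i P = (THE g. \<forall>J. J \<subseteq> {..r} \<and> card J = r + 1 - k \<and> det (col_submat A J) \<notin> P \<longrightarrow>
       g = germ {..n} I P (\<Sum>l\<le>r - k. Var (pick J l) * adj_mat (col_submat A J) $$ (l, i)) (det (col_submat A J)))"
    unfolding z_sec_def Let_def r_eq[symmetric] using P by (rule restrict_apply')
  also have "\<dots> = (THE g. \<forall>J. J \<in> column_sets \<and> max_minor J \<notin> P \<longrightarrow> g = germ {..n} I P (z_num J i) (max_minor J))"
    by (simp only: cs sums z_num_def max_minor_def)
  also have "\<dots> = germ {..n} I P (z_num J i) (max_minor J)"
    using J eq by (intro the_equality) blast+
  finally show ?thesis .
qed

lemma z_sec_carrier:
  assumes i: "i < m"
  shows "z_sec n k I A i \<in> carrier \<S>"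
proof -
  have "z_sec n k I A i P \<in> carrier (loc {..n} I P)" if P: "P \<in> Proj {..n} I" for P
  proof -
    interpret localization "{..n}" I P by (rule localization) fact
    obtain J where J: "J \<in> column_sets" "max_minor J \<notin> P" using minor_cover[OF P] by blast
    show ?thesis unfolding z_sec_germ[OF P J i]
      using z_num_polys[OF J(1) i] minor_denoms[OF J(1) P J(2)] by (rule loc_carrierI)
  qed
  moreover have "z_sec n k I A i P = undefined" if "P \<notin> Proj {..n} I" for P
    using that by (simp add: z_sec_def Let_def)
  ultimately show ?thesis unfolding sec_carrier by blast
qed


section \<open>Combinations of the generators\<close>

definition polys_tuples :: "(nat \<Rightarrow> 'k mpoly) set" where
  "polys_tuples = {c. \<forall>i\<le>m. c i \<in> polys L}"

definition lin_comb :: "(nat \<Rightarrow> 'k mpoly) \<Rightarrow> 'k mpoly set \<Rightarrow> ('k mpoly \<times> 'k mpoly) set" where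
  "lin_comb c = poly_sec {..n} I (c 0) \<oplus>\<^bsub>\<S>\<^esub>
    (\<Oplus>\<^bsub>\<S>\<^esub>i\<in>{..r - k}. poly_sec {..n} I (c (Suc i)) \<otimes>\<^bsub>\<S>\<^esub> z_sec n k I A i)"

text \<open>The numerator of \<open>lin_comb c\<close> over the common denominator \<open>max_minor J\<close>.\<close>

definition comb_num :: "nat set \<Rightarrow> (nat \<Rightarrow> 'k mpoly) \<Rightarrow> 'k mpoly" where
  "comb_num J c = c 0 * max_minor J + (\<Sum>i<m. c (Suc i) * z_num J i)"

text \<open>The degrees of the generators \<open>1, z\<^sub>0, z\<^sub>1, \<dots>\<close>, in this order.\<close>

definition gen_degree :: "nat \<Rightarrow> int" where
  "gen_degree i = (case i of 0 \<Rightarrow> 0 | Suc i \<Rightarrow> 1 - int (\<alpha> i))"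

definition homog_tuple :: "int \<Rightarrow> (nat \<Rightarrow> 'k mpoly) \<Rightarrow> bool" where
  "homog_tuple d c \<longleftrightarrow> (\<forall>i\<le>m. homog (d - gen_degree i) (c i))"

lemma tuple_polys: "c \<in> polys_tuples \<Longrightarrow> i \<le> m \<Longrightarrow> c i \<in> polys L"
  by (simp add: polys_tuples_def)

lemma tuple_Suc_polys: "c \<in> polys_tuples \<Longrightarrow> i < m \<Longrightarrow> c (Suc i) \<in> polys {..n}"
  by (intro polys_L_R tuple_polys) auto

lemma comb_num_polys: "c \<in> polys_tuples \<Longrightarrow> J \<in> column_sets \<Longrightarrow> comb_num J c \<in> polys {..n}"
  unfolding comb_num_def using tuple_polys minor_polys z_num_polys tuple_Suc_polys
  by (intro polys_add polys_sum polys_mult polys_L_R[of "max_minor J"] polys_L_R[of "c 0"]) auto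

lemma lin_comb_carrier:
  assumes "c \<in> polys_tuples"
  shows "lin_comb c \<in> carrier \<S>"
  unfolding lin_comb_def
proof (intro sec.add.m_closed sec.finsum_closed Pi_I sec.m_closed)
  show "poly_sec {..n} I (c 0) \<in> carrier \<S>"
    using tuple_polys[OF assms, of 0] by (intro poly_sec_carrier polys_L_R) simp
  fix i assume "i \<in> {..r - k}"
  then show "poly_sec {..n} I (c (Suc i)) \<in> carrier \<S>" "z_sec n k I A i \<in> carrier \<S>"
    using tuple_Suc_polys[OF assms, of i] by (auto intro!: z_sec_carrier poly_sec_carrier)
qed

lemma lin_comb_germ:
  assumes c: "c \<in> polys_tuples" and P: "P \<in> Proj {..n} I" and J: "J \<in> column_sets" "max_minor J \<notin> P"
  shows "lin_comb c P = germ {..n} I P (comb_num J c) (max_minor J)"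
proof -
  interpret localization "{..n}" I P by (rule localization) fact
  note d = minor_denoms[OF J(1) P J(2)]
  have c0: "c 0 \<in> polys {..n}" using tuple_polys[OF c, of 0] by (intro polys_L_R) simp
  have summand: "poly_sec {..n} I (c (Suc i)) \<otimes>\<^bsub>\<S>\<^esub> z_sec n k I A i \<in> carrier \<S>"
    "(poly_sec {..n} I (c (Suc i)) \<otimes>\<^bsub>\<S>\<^esub> z_sec n k I A i) P = germ {..n} I P (c (Suc i) * z_num J i) (max_minor J)"
    if i: "i < m" for i
  proof -
    show "poly_sec {..n} I (c (Suc i)) \<otimes>\<^bsub>\<S>\<^esub> z_sec n k I A i \<in> carrier \<S>"
      using tuple_Suc_polys[OF c i] by (intro sec_closed poly_sec_carrier z_sec_carrier[OF i])
    show "(poly_sec {..n} I (c (Suc i)) \<otimes>\<^bsub>\<S>\<^esub> z_sec n k I A i) P = germ {..n} I P (c (Suc i) * z_num J i) (max_minor J)"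
      using P tuple_Suc_polys[OF c i] z_num_polys[OF J(1) i] d
      by (simp add: sec_mult poly_sec_apply z_sec_germ[OF P J i] mult_germ)
  qed
  have "(\<Oplus>\<^bsub>\<S>\<^esub>i\<in>{..r - k}. poly_sec {..n} I (c (Suc i)) \<otimes>\<^bsub>\<S>\<^esub> z_sec n k I A i) P =
      (\<Oplus>\<^bsub>\<L>\<^esub>i\<in>{..r - k}. (poly_sec {..n} I (c (Suc i)) \<otimes>\<^bsub>\<S>\<^esub> z_sec n k I A i) P)"
    using summand(1) P by (intro finsum_sec_apply) auto
  also have "\<dots> = (\<Oplus>\<^bsub>\<L>\<^esub>i\<in>{..r - k}. germ {..n} I P (c (Suc i) * z_num J i) (max_minor J))"
  proof (rule loc.finsum_cong')
    show "(\<lambda>i. germ {..n} I P (c (Suc i) * z_num J i) (max_minor J)) \<in> {..r - k} \<rightarrow> carrier \<L>"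
      using tuple_Suc_polys[OF c] z_num_polys[OF J(1)] d by (auto intro!: loc_carrierI)
  qed (use summand(2) in auto)
  also have "\<dots> = germ {..n} I P (\<Sum>i\<le>r - k. c (Suc i) * z_num J i) (max_minor J)"
    using tuple_Suc_polys[OF c] z_num_polys[OF J(1)] d by (intro finsum_germ_same) auto
  finally have fs: "(\<Oplus>\<^bsub>\<S>\<^esub>i\<in>{..r - k}. poly_sec {..n} I (c (Suc i)) \<otimes>\<^bsub>\<S>\<^esub> z_sec n k I A i) P =
      germ {..n} I P (\<Sum>i<m. c (Suc i) * z_num J i) (max_minor J)"
    by (simp add: lessThan_Suc_atMost)
  have "(\<Sum>i<m. c (Suc i) * z_num J i) \<in> polys {..n}"
    using tuple_Suc_polys[OF c] z_num_polys[OF J(1)] by (intro polys_sum polys_mult) auto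
  then show ?thesis
    unfolding lin_comb_def comb_num_def sec_add using P d c0 by (simp add: fs poly_sec_apply add_germ)
qed

text \<open>Whatever \<open>J\<close> is, the section \<open>z\<^sub>i\<close> has the coordinates of a unit vector, and the coefficients \<open>c i\<close> behave
  as scalars, since their linear parts vanish.\<close>

lemma comb_num_coord:
  assumes c: "c \<in> polys_tuples" and J: "J \<in> column_sets" "max_minor J \<noteq> 0" and i: "i \<le> m"
  shows "coord i (comb_num J c) (max_minor J) = to_fract (c i)"
proof -
  have minor_simps: "const_part L (max_minor J) = max_minor J" "conormal i (max_minor J) = 0" for i
    using minor_polys[OF J(1)] by (simp_all add: const_part_polys conormal_polys)
  have cL: "const_part L (c i) = c i" "conormal i' (c i) = 0" if "i \<le> m" for i i'
    using tuple_polys[OF c that] by (simp_all add: const_part_polys conormal_polys)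
  show ?thesis
  proof (cases i)
    case 0
    then show ?thesis using J cL(1)[of 0]
      by (simp add: coord_simps comb_num_def const_part_mult const_part_sum const_part_z_num minor_simps)
  next
    case (Suc i')
    then have i': "i' < m" using i by simp
    have "conormal i' (\<Sum>l<m. c (Suc l) * z_num J l) = (\<Sum>l<m. if l = i' then c (Suc i') * max_minor J else 0)"
      unfolding conormal_sum using J i' cL by (intro sum.cong) (auto simp: conormal_mult conormal_z_num const_part_z_num)
    also have "\<dots> = c (Suc i') * max_minor J" using i' by simp
    finally have "conormal i' (comb_num J c) = c (Suc i') * max_minor J"
      using cL[of 0] by (simp add: comb_num_def conormal_mult minor_simps)
    then show ?thesis
      using Suc J by (simp add: coord_simps minor_simps power2_eq_square)
  qed
qed

lemma lin_comb_inject: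
  assumes c: "c \<in> polys_tuples" "c' \<in> polys_tuples" and eq: "lin_comb c = lin_comb c'" and i: "i \<le> m"
  shows "c i = c' i"
proof -
  have P: "IL \<in> Proj {..n} I" using IL_Proj Proj_I by simp
  obtain J where J: "J \<in> column_sets" "max_minor J \<notin> IL" using minor_cover[OF P] by blast
  note d = minor_denoms[OF J(1) P J(2)]
  have "max_minor J \<noteq> 0" using J(2) ideal_mpolyD(2)[OF ideal_IL] by metis
  have "germ {..n} I IL (comb_num J c) (max_minor J) = germ {..n} I IL (comb_num J c') (max_minor J)"
    using eq lin_comb_germ[OF c(1) P J] lin_comb_germ[OF c(2) P J] by simp
  then have "coord i (comb_num J c) (max_minor J) = coord i (comb_num J c') (max_minor J)"
    using comb_num_polys c J d i by (intro coord_germ[OF P]) auto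
  then show ?thesis using comb_num_coord c J \<open>max_minor J \<noteq> 0\<close> i by simp
qed

lemma lin_comb_eqI:
  assumes "c \<in> polys_tuples" "s \<in> carrier \<S>"
    and "\<And>P J. P \<in> Proj {..n} I \<Longrightarrow> J \<in> column_sets \<Longrightarrow> max_minor J \<notin> P \<Longrightarrow> s P = germ {..n} I P (comb_num J c) (max_minor J)"
  shows "lin_comb c = s"
proof (rule sec_eqI)
  fix P assume P: "P \<in> Proj {..n} I"
  obtain J where "J \<in> column_sets" "max_minor J \<notin> P" using minor_cover[OF P] by blast
  then show "lin_comb c P = s P" using assms P lin_comb_germ by simp
qed (use assms lin_comb_carrier in auto)

lemma tuple_closed:
  "c \<in> polys_tuples \<Longrightarrow> c' \<in> polys_tuples \<Longrightarrow> (\<lambda>i. c i + c' i) \<in> polys_tuples"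
  "f \<in> polys L \<Longrightarrow> c \<in> polys_tuples \<Longrightarrow> (\<lambda>i. f * c i) \<in> polys_tuples"
  "(\<lambda>i. 0) \<in> polys_tuples"
  "(\<And>x. x \<in> X \<Longrightarrow> cs x \<in> polys_tuples) \<Longrightarrow> (\<lambda>i. \<Sum>x\<in>X. cs x i) \<in> polys_tuples"
  "c \<in> polys_tuples \<Longrightarrow> (\<lambda>i. hcomp (d i) (c i)) \<in> polys_tuples"
  "(\<lambda>i. if i = j then 1 else 0) \<in> polys_tuples"
  by (auto simp: polys_tuples_def)

lemma lin_comb_cong: "(\<And>i. i \<le> m \<Longrightarrow> c i = c' i) \<Longrightarrow> c \<in> polys_tuples \<Longrightarrow> lin_comb c = lin_comb c'"
proof -
  assume eq: "\<And>i. i \<le> m \<Longrightarrow> c i = c' i" and c: "c \<in> polys_tuples"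
  have c': "c' \<in> polys_tuples" using c eq by (simp add: polys_tuples_def)
  have "comb_num J c = comb_num J c'" for J unfolding comb_num_def using eq by (intro arg_cong2[where f = "(+)"] sum.cong) auto
  then show ?thesis using c c' lin_comb_germ by (intro lin_comb_eqI lin_comb_carrier) auto
qed

lemma lin_comb_add:
  assumes c: "c \<in> polys_tuples" "c' \<in> polys_tuples"
  shows "lin_comb (\<lambda>i. c i + c' i) = lin_comb c \<oplus>\<^bsub>\<S>\<^esub> lin_comb c'"
proof (rule lin_comb_eqI)
  fix P J assume P: "P \<in> Proj {..n} I" and J: "J \<in> column_sets" "max_minor J \<notin> P"
  interpret localization "{..n}" I P by (rule localization) fact
  have "comb_num J (\<lambda>i. c i + c' i) = comb_num J c + comb_num J c'"
    by (simp add: comb_num_def algebra_simps sum.distrib)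
  then show "(lin_comb c \<oplus>\<^bsub>\<S>\<^esub> lin_comb c') P = germ {..n} I P (comb_num J (\<lambda>i. c i + c' i)) (max_minor J)"
    using P c comb_num_polys J minor_denoms[OF J(1) P J(2)]
    by (simp add: sec_add lin_comb_germ[OF _ P J] add_germ_same)
qed (use c in \<open>auto intro: tuple_closed sec_closed lin_comb_carrier\<close>)

lemma lin_comb_mult:
  assumes c: "c \<in> polys_tuples" and f: "f \<in> polys L"
  shows "lin_comb (\<lambda>i. f * c i) = poly_sec {..n} I f \<otimes>\<^bsub>\<S>\<^esub> lin_comb c"
proof (rule lin_comb_eqI)
  fix P J assume P: "P \<in> Proj {..n} I" and J: "J \<in> column_sets" "max_minor J \<notin> P"
  interpret localization "{..n}" I P by (rule localization) fact
  have "comb_num J (\<lambda>i. f * c i) = f * comb_num J c"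
    by (simp add: comb_num_def algebra_simps sum_distrib_left)
  then show "(poly_sec {..n} I f \<otimes>\<^bsub>\<S>\<^esub> lin_comb c) P = germ {..n} I P (comb_num J (\<lambda>i. f * c i)) (max_minor J)"
    using P c f comb_num_polys J minor_denoms[OF J(1) P J(2)] polys_L_R[OF f]
    by (simp add: sec_mult lin_comb_germ[OF _ P J] mult_germ poly_sec_apply)
qed (use c f polys_L_R in \<open>auto intro!: tuple_closed sec_closed lin_comb_carrier poly_sec_carrier\<close>)

lemma lin_comb_zero: "lin_comb (\<lambda>i. 0) = \<zero>\<^bsub>\<S>\<^esub>"
proof (rule lin_comb_eqI)
  fix P J assume P: "P \<in> Proj {..n} I" and J: "J \<in> column_sets" "max_minor J \<notin> P"
  interpret localization "{..n}" I P by (rule localization) fact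
  have "germ {..n} I P 0 1 = germ {..n} I P 0 (max_minor J)"
    by (rule germ_eqI) (use minor_denoms[OF J(1) P J(2)] in auto)
  then show "\<zero>\<^bsub>\<S>\<^esub> P = germ {..n} I P (comb_num J (\<lambda>i. 0)) (max_minor J)"
    using P by (simp add: comb_num_def sec_zero loc_zero)
qed (auto intro: tuple_closed sec_closed)

lemma lin_comb_sum:
  assumes "finite X" "\<And>x. x \<in> X \<Longrightarrow> cs x \<in> polys_tuples"
  shows "(\<Oplus>\<^bsub>\<S>\<^esub>x\<in>X. lin_comb (cs x)) = lin_comb (\<lambda>i. \<Sum>x\<in>X. cs x i)"
  using assms
proof (induction X)
  case (insert x X)
  then have "(\<Oplus>\<^bsub>\<S>\<^esub>x\<in>insert x X. lin_comb (cs x)) = lin_comb (cs x) \<oplus>\<^bsub>\<S>\<^esub> (\<Oplus>\<^bsub>\<S>\<^esub>x\<in>X. lin_comb (cs x))"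
    using lin_comb_carrier by (intro sec.finsum_insert) auto
  then show ?case
    using insert by (simp add: lin_comb_add[symmetric] tuple_closed(4))
qed (simp add: lin_comb_zero)

lemma lin_comb_unit0: "lin_comb (\<lambda>i. if i = 0 then 1 else 0) = poly_sec {..n} I 1"
proof (rule lin_comb_eqI)
  fix P J assume P: "P \<in> Proj {..n} I" and J: "J \<in> column_sets" "max_minor J \<notin> P"
  interpret localization "{..n}" I P by (rule localization) fact
  have "germ {..n} I P 1 1 = germ {..n} I P (max_minor J) (max_minor J)"
    by (rule germ_eqI) (use minor_denoms[OF J(1) P J(2)] denoms_polys in auto)
  then show "poly_sec {..n} I 1 P = germ {..n} I P (comb_num J (\<lambda>i. if i = 0 then 1 else 0)) (max_minor J)"
    using P by (simp add: comb_num_def poly_sec_apply)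
qed (auto intro: tuple_closed poly_sec_carrier)

lemma lin_comb_unit_Suc:
  assumes i: "i < m"
  shows "lin_comb (\<lambda>j. if j = Suc i then 1 else 0) = z_sec n k I A i"
proof (rule lin_comb_eqI)
  fix P J assume P: "P \<in> Proj {..n} I" and J: "J \<in> column_sets" "max_minor J \<notin> P"
  have "comb_num J (\<lambda>j. if j = Suc i then 1 else 0) = (\<Sum>j<m. if j = i then z_num J i else 0)"
    unfolding comb_num_def by (simp add: if_distrib[of "\<lambda>x. x * _"] cong: if_cong)
  then have "comb_num J (\<lambda>j. if j = Suc i then 1 else 0) = z_num J i" using i by simp
  then show "z_sec n k I A i P = germ {..n} I P (comb_num J (\<lambda>j. if j = Suc i then 1 else 0)) (max_minor J)"
    using z_sec_germ[OF P J i] by simp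
qed (use i in \<open>auto intro: tuple_closed z_sec_carrier\<close>)


section \<open>Global sections in a given degree\<close>

lemma comb_num_homog:
  assumes c: "homog_tuple d c" and J: "J \<in> column_sets"
  shows "homog (d + (\<Sum>i<m. int (\<alpha> i))) (comb_num J c)"
proof -
  have "homog d (c 0)" using c by (auto simp: homog_tuple_def gen_degree_def)
  then have "homog (d + (\<Sum>i<m. int (\<alpha> i))) (c 0 * max_minor J)"
    by (rule homog_mult[OF _ minor_homog[OF J]])
  moreover have "homog (d + (\<Sum>i<m. int (\<alpha> i))) (c (Suc i) * z_num J i)" if i: "i < m" for i
  proof -
    have "homog (d - gen_degree (Suc i)) (c (Suc i))" using c i unfolding homog_tuple_def by simp
    then show ?thesis by (rule homog_mult'[OF _ z_num_homog[OF J i]]) (simp add: gen_degree_def)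
  qed
  ultimately show ?thesis unfolding comb_num_def by (intro homog_add homog_sum) auto
qed

text \<open>Near a point where \<open>max_minor J\<close> does not vanish, one fraction with this denominator represents the
  whole combination.\<close>

lemma lin_comb_section:
  assumes c: "c \<in> polys_tuples" "homog_tuple d c"
  shows "lin_comb c \<in> H0 {..n} I d"
proof -
  let ?e = "\<Sum>i<m. int (\<alpha> i)"
  have stalk: "lin_comb c P \<in> stalk {..n} I d P" if P: "P \<in> Proj {..n} I" for P
  proof -
    obtain J where J: "J \<in> column_sets" "max_minor J \<notin> P" using minor_cover[OF P] by blast
    show ?thesis
      unfolding stalk_def lin_comb_germ[OF c(1) P J]
      using comb_num_polys[OF c(1) J(1)] comb_num_homog[OF c(2) J(1)] minor_homog[OF J(1)] minor_denoms[OF J(1) P J(2)] by blast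
  qed
  have "\<exists>W a f e. zariski_open {..n} I W \<and> P \<in> W \<and> W \<subseteq> Proj {..n} I \<and>
       a \<in> polys {..n} \<and> homog (d + e) a \<and> homog e f \<and>
       (\<forall>Q\<in>W. f \<in> denoms {..n} Q \<and> lin_comb c Q = germ {..n} I Q a f)" if P: "P \<in> Proj {..n} I" for P
  proof -
    obtain J where J: "J \<in> column_sets" "max_minor J \<notin> P" using minor_cover[OF P] by blast
    define W where "W = {Q \<in> Proj {..n} I. max_minor J \<notin> Q}"
    let ?E = "{max_minor J * f | f. f \<in> polys {..n}}"
    have "?E \<subseteq> Q \<longleftrightarrow> max_minor J \<in> Q" if "Q \<in> Proj {..n} I" for Q
    proof
      assume "?E \<subseteq> Q"
      moreover have "max_minor J \<in> ?E" by (intro CollectI exI[of _ 1]) auto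
      ultimately show "max_minor J \<in> Q" by blast
    next
      assume "max_minor J \<in> Q"
      then show "?E \<subseteq> Q"
        using ideal_mpolyD(5)[OF hom_ideal_mpolyD(1)[OF Proj_D(1)[OF that]]] by blast
    qed
    then have "W = {Q \<in> Proj {..n} I. \<not> ?E \<subseteq> Q}" unfolding W_def by blast
    moreover have "hom_ideal {..n} ?E"
      by (rule hom_ideal_principal[OF polys_L_R[OF minor_polys[OF J(1)]] minor_homog[OF J(1)]])
    ultimately have "zariski_open {..n} I W" unfolding zariski_open_def by blast
    moreover have "\<forall>Q\<in>W. max_minor J \<in> denoms {..n} Q \<and> lin_comb c Q = germ {..n} I Q (comb_num J c) (max_minor J)"
      using lin_comb_germ[OF c(1)] J(1) minor_denoms[OF J(1)] by (auto simp: W_def)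
    moreover have "P \<in> W" "W \<subseteq> Proj {..n} I" using P J by (auto simp: W_def)
    ultimately show ?thesis
      using comb_num_polys[OF c(1) J(1)] comb_num_homog[OF c(2) J(1)] minor_homog[OF J(1)] by blast
  qed
  moreover have "lin_comb c \<in> (\<Pi>\<^sub>E P\<in>Proj {..n} I. stalk {..n} I d P)"
    using stalk lin_comb_carrier[OF c(1)] unfolding sec_carrier by (auto simp: PiE_iff)
  ultimately show ?thesis unfolding H0_def sections_def by blast
qed

text \<open>The numerator of the \<open>i\<close>-th coordinate over the denominator \<open>(const_part L f)\<^sup>2\<close>.\<close>

definition coord_num :: "nat \<Rightarrow> 'k mpoly \<Rightarrow> 'k mpoly \<Rightarrow> 'k mpoly" where
  "coord_num i a f = (case i of
     0 \<Rightarrow> const_part L a * const_part L f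
   | Suc i \<Rightarrow> conormal i a * const_part L f - const_part L a * conormal i f)"

lemma coord_eq_num:
  "const_part L f \<noteq> 0 \<Longrightarrow> coord i a f = to_fract (coord_num i a f) / to_fract ((const_part L f)\<^sup>2)"
  by (cases i) (simp_all add: coord_simps coord_num_def power2_eq_square)

lemma coord_num_polys: "i \<le> m \<Longrightarrow> coord_num i a f \<in> polys L"
  by (cases i) (simp_all add: coord_num_def polys_conormal polys_mult polys_diff)

lemma coord_num_homog:
  assumes "i \<le> m" "homog (d + e) a" "homog e f"
  shows "homog (d - gen_degree i + 2 * e) (coord_num i a f)"
proof (cases i)
  case 0
  then show ?thesis unfolding coord_num_def gen_degree_def
    using homog_mult[OF homog_const_part[OF assms(2)] homog_const_part[OF assms(3)]] by (simp add: algebra_simps)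
next
  case (Suc i')
  then have "i' < m" using assms(1) by simp
  then have "homog (d - gen_degree i + 2 * e) (conormal i' a * const_part L f)"
    "homog (d - gen_degree i + 2 * e) (const_part L a * conormal i' f)"
    using homog_mult[OF homog_conormal[OF _ assms(2)] homog_const_part[OF assms(3)], of i']
      homog_mult[OF homog_const_part[OF assms(2)] homog_conormal[OF _ assms(3)], of i']
    by (simp_all add: Suc gen_degree_def algebra_simps)
  then show ?thesis by (simp add: coord_num_def Suc homog_diff)
qed

text \<open>The open set on which a fraction represents \<open>s\<close> near \<open>P\<close> also contains the generic point \<open>IL\<close>, because an
  ideal that is not contained in \<open>P\<close> is not contained in \<open>IL \<subseteq> P\<close> either.\<close>

lemma section_local:
  assumes s: "s \<in> H0 {..n} I d" and P: "P \<in> Proj {..n} I"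
  obtains a f e where "a \<in> polys {..n}" "homog (d + e) a" "homog e f" "f \<in> denoms {..n} P"
    "s P = germ {..n} I P a f" "f \<in> denoms {..n} IL" "s IL = germ {..n} I IL a f"
proof -
  have "\<exists>W a f e. zariski_open {..n} I W \<and> P \<in> W \<and> W \<subseteq> Proj {..n} I \<and>
      a \<in> polys {..n} \<and> homog (d + e) a \<and> homog e f \<and>
      (\<forall>Q\<in>W. f \<in> denoms {..n} Q \<and> s Q = germ {..n} I Q a f)"
    by (rule s[unfolded H0_def sections_def, THEN CollectD, THEN conjunct2, THEN bspec, OF P])
  then obtain W a f e where W: "zariski_open {..n} I W" "P \<in> W"
    and a: "a \<in> polys {..n}" "homog (d + e) a" "homog e f"
    and eq: "\<forall>Q\<in>W. f \<in> denoms {..n} Q \<and> s Q = germ {..n} I Q a f"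
    by (elim exE conjE) (rule that)
  obtain E where E: "W = {P \<in> Proj {..n} I. \<not> E \<subseteq> P}"
    using W(1) unfolding zariski_open_def by (elim exE conjE) (rule that)
  have "IL \<subseteq> P" using P unfolding Proj_I by (rule Proj_D(3))
  moreover have "\<not> E \<subseteq> P" "IL \<in> Proj {..n} I"
    using W(2) IL_Proj unfolding E by (simp_all add: Proj_I)
  ultimately have "IL \<in> W" unfolding E by blast
  show ?thesis
    by (rule that[OF a]) (use eq W(2) \<open>IL \<in> W\<close> in simp_all)
qed

text \<open>By comparison at the generic point, all local fractions for \<open>s\<close> have the same coordinates.  At each
  point one of them has no pole, so the coordinates are polynomials; they are the coefficients of \<open>s\<close>.\<close>

lemma section_lin_comb:
  assumes s: "s \<in> H0 {..n} I d"
  obtains c where "c \<in> polys_tuples" "homog_tuple d c" "s = lin_comb c"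
proof -
  have IL: "IL \<in> Proj {..n} I" using IL_Proj Proj_I by simp
  obtain a0 f0 e0 where a0: "a0 \<in> polys {..n}" "homog (d + e0) a0" and f0: "homog e0 f0" "f0 \<in> denoms {..n} IL"
    and s0: "s IL = germ {..n} I IL a0 f0"
    by (rule section_local[OF s IL]) blast
  define p where "p i = coord_num i a0 f0" for i
  define q where "q = (const_part L f0)\<^sup>2"
  have "q \<noteq> 0" using denoms_const_part(2)[OF IL f0(2)] by (simp add: q_def)
  have q: "q \<in> polys L" "homog (2 * e0) q"
    unfolding q_def using homog_power[OF homog_const_part[OF f0(1)], of 2] by simp_all
  have same: "coord i a f = to_fract (p i) / to_fract q"
    if "a \<in> polys {..n}" "f \<in> denoms {..n} IL" "s IL = germ {..n} I IL a f" "i \<le> m" for a f i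
  proof -
    have "coord i a f = coord i a0 f0"
      using that a0 f0 s0 by (intro coord_germ[OF IL]) auto
    then show ?thesis
      using coord_eq_num[OF denoms_const_part(2)[OF IL f0(2)]] by (simp add: p_def q_def)
  qed
  have ex: "\<exists>x. x \<in> polys L \<and> p i = x * q" if i: "i \<le> m" for i
  proof (rule regular_fraction_polynomial[of "p i" "d - gen_degree i + 2 * e0" q "2 * e0"])
    show "p i \<in> polys L" unfolding p_def by (rule coord_num_polys[OF i])
    show "homog (d - gen_degree i + 2 * e0) (p i)" unfolding p_def by (rule coord_num_homog[OF i a0(2) f0(1)])
    show "\<exists>h\<in>polys L. h \<notin> P \<and> (\<exists>x\<in>polys L. h * p i = x * q)" if "P \<in> Proj {..n} IL" for P
    proof -
      have P: "P \<in> Proj {..n} I" using that Proj_I by simp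
      obtain a f e where af: "a \<in> polys {..n}" "homog (d + e) a" "homog e f" "f \<in> denoms {..n} P"
        "s P = germ {..n} I P a f" "f \<in> denoms {..n} IL" "s IL = germ {..n} I IL a f"
        by (rule section_local[OF s P])
      define h where "h = (const_part L f)\<^sup>2"
      note nz = denoms_const_part[OF P af(4)]
      have "const_part L f \<in> polys {..n}" by (intro polys_L_R) auto
      then have "h \<notin> P"
        using nz Proj_D(2)[OF P] unfolding primeideal_mpoly_iff h_def power2_eq_square by blast
      moreover have "to_fract (coord_num i a f) / to_fract h = to_fract (p i) / to_fract q"
        using same[OF af(1,6,7) i] coord_eq_num[OF nz(2)] by (simp add: h_def)
      then have "to_fract (h * p i) = to_fract (coord_num i a f * q)"
        using nz(2) \<open>q \<noteq> 0\<close> by (simp add: h_def field_simps)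
      then have "h * p i = coord_num i a f * q" by (simp only: to_fract_eq_iff)
      ultimately show ?thesis using coord_num_polys[OF i] by (auto simp: h_def)
    qed
  qed (use q \<open>q \<noteq> 0\<close> in auto)
  define c where "c i = (SOME x. x \<in> polys L \<and> p i = x * q)" for i
  have c: "c i \<in> polys L" "p i = c i * q" if "i \<le> m" for i
    using someI_ex[OF ex[OF that]] by (simp_all add: c_def)
  have tup: "c \<in> polys_tuples" using c by (simp add: polys_tuples_def)
  have hom: "homog_tuple d c"
    unfolding homog_tuple_def
  proof (intro allI impI)
    fix i assume i: "i \<le> m"
    have "homog (d - gen_degree i + 2 * e0) (q * c i)"
      using coord_num_homog[OF i a0(2) f0(1)] c(2)[OF i] by (simp add: p_def mult.commute)
    then have "q * c i = hcomp (d - gen_degree i + 2 * e0) (q * c i)" by (simp add: homog_iff)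
    also have "\<dots> = q * hcomp (d - gen_degree i) (c i)" by (simp add: hcomp_mult_homog[OF q(2)])
    finally have "c i = hcomp (d - gen_degree i) (c i)" using \<open>q \<noteq> 0\<close> by simp
    then show "homog (d - gen_degree i) (c i)" by (simp add: homog_iff)
  qed
  have "lin_comb c = s"
  proof (rule lin_comb_eqI[OF tup])
    have "s \<in> (\<Pi>\<^sub>E P\<in>Proj {..n} I. stalk {..n} I d P)" using s by (auto simp: H0_def sections_def)
    moreover have "stalk {..n} I d P \<subseteq> carrier (loc {..n} I P)" for P
      by (auto simp: stalk_def loc_def)
    ultimately show "s \<in> carrier \<S>" unfolding sec_carrier by blast
    fix P J assume P: "P \<in> Proj {..n} I" and J: "J \<in> column_sets" "max_minor J \<notin> P"
    note d = minor_denoms[OF J(1) P J(2)]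
    have "max_minor J \<noteq> 0" using denoms_const_part(2)[OF P d] by auto
    obtain a f e where af: "a \<in> polys {..n}" "homog (d + e) a" "homog e f" "f \<in> denoms {..n} P"
      "s P = germ {..n} I P a f" "f \<in> denoms {..n} IL" "s IL = germ {..n} I IL a f"
      by (rule section_local[OF s P])
    have "coord i a f = coord i (comb_num J c) (max_minor J)" if i: "i \<le> m" for i
    proof -
      have "to_fract (p i) / to_fract q = to_fract (c i)" using c(2)[OF i] \<open>q \<noteq> 0\<close> by simp
      then show ?thesis
        using same[OF af(1,6,7) i] comb_num_coord[OF tup J(1) \<open>max_minor J \<noteq> 0\<close> i] by simp
    qed
    then show "s P = germ {..n} I P (comb_num J c) (max_minor J)"
      unfolding af(5) using comb_num_polys[OF tup J(1)] comb_num_homog[OF hom J(1)] minor_homog[OF J(1)] af d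
      by (intro germ_coord[OF P, where d = d and e = e and e' = "\<Sum>i<m. int (\<alpha> i)"]) auto
  qed
  then show ?thesis using that tup hom by blast
qed

lemma H0_explicit:
  "H0 {..n} I d =
     {poly_sec {..n} I P \<oplus>\<^bsub>\<S>\<^esub> (\<Oplus>\<^bsub>\<S>\<^esub>i\<in>{..r - k}. poly_sec {..n} I (Q i) \<otimes>\<^bsub>\<S>\<^esub> z_sec n k I A i) | P Q.
        P \<in> polys L \<and> homog d P \<and> (\<forall>i\<le>r - k. Q i \<in> polys L \<and> homog (d + int (\<alpha> i) - 1) (Q i))}"
  (is "_ = ?X")
proof (intro equalityI subsetI)
  fix s assume "s \<in> H0 {..n} I d"
  then obtain c where c: "c \<in> polys_tuples" "homog_tuple d c" "s = lin_comb c" by (rule section_lin_comb)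
  have "c 0 \<in> polys L" "homog d (c 0)"
    using tuple_polys[OF c(1), of 0] c(2) by (auto simp: homog_tuple_def gen_degree_def)
  moreover have "c (Suc i) \<in> polys L \<and> homog (d + int (\<alpha> i) - 1) (c (Suc i))" if "i \<le> r - k" for i
  proof -
    have "homog (d - gen_degree (Suc i)) (c (Suc i))" using c(2) that unfolding homog_tuple_def by simp
    then show ?thesis using tuple_polys[OF c(1), of "Suc i"] that by (simp add: gen_degree_def algebra_simps)
  qed
  ultimately show "s \<in> ?X"
    unfolding c(3) lin_comb_def by (intro CollectI exI[of _ "c 0"] exI[of _ "\<lambda>i. c (Suc i)"]) auto
next
  fix s assume "s \<in> ?X"
  then obtain P Q where s: "s = poly_sec {..n} I P \<oplus>\<^bsub>\<S>\<^esub>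
      (\<Oplus>\<^bsub>\<S>\<^esub>i\<in>{..r - k}. poly_sec {..n} I (Q i) \<otimes>\<^bsub>\<S>\<^esub> z_sec n k I A i)"
    and P: "P \<in> polys L" "homog d P"
    and Q: "\<And>i. i \<le> r - k \<Longrightarrow> Q i \<in> polys L \<and> homog (d + int (\<alpha> i) - 1) (Q i)" by blast
  have "case_nat P Q i \<in> polys L \<and> homog (d - gen_degree i) (case_nat P Q i)" if "i \<le> m" for i
    using P Q that by (cases i) (auto simp: gen_degree_def algebra_simps)
  then have "case_nat P Q \<in> polys_tuples" "homog_tuple d (case_nat P Q)"
    by (auto simp: polys_tuples_def homog_tuple_def)
  then have "lin_comb (case_nat P Q) \<in> H0 {..n} I d" by (rule lin_comb_section)
  then show "s \<in> H0 {..n} I d" by (simp add: s lin_comb_def)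
qed


section \<open>The graded module of sections\<close>

abbreviation "\<M> \<equiv> H0star {..n} I"

lemma M_add: "s \<oplus>\<^bsub>\<M>\<^esub> s' = (\<lambda>d. s d \<oplus>\<^bsub>\<S>\<^esub> s' d)"
  and M_zero: "\<zero>\<^bsub>\<M>\<^esub> = (\<lambda>d. \<zero>\<^bsub>\<S>\<^esub>)"
  and M_smult: "f \<odot>\<^bsub>\<M>\<^esub> s = (\<lambda>d. \<Oplus>\<^bsub>\<S>\<^esub>e\<in>{e. hom_comp e f \<noteq> 0}.
      poly_sec {..n} I (hom_comp e f) \<otimes>\<^bsub>\<S>\<^esub> s (d - int e))"
  and M_carrier: "s \<in> carrier \<M> \<longleftrightarrow> (\<forall>d. s d \<in> H0 {..n} I d) \<and> finite {d. s d \<noteq> \<zero>\<^bsub>\<S>\<^esub>}"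
  by (simp_all add: H0star_def)

text \<open>The family of sections whose coefficients are the components of the polynomials \<open>c i\<close> in the fitting
  degrees.  It will be seen to be \<open>\<Sum>\<^sub>i c i \<odot> basis i\<close>, and all module laws are transferred along it.\<close>

definition graded_comb :: "(nat \<Rightarrow> 'k mpoly) \<Rightarrow> int \<Rightarrow> 'k mpoly set \<Rightarrow> ('k mpoly \<times> 'k mpoly) set" where
  "graded_comb c = (\<lambda>d. lin_comb (\<lambda>i. hcomp (d - gen_degree i) (c i)))"

lemma graded_comb_carrier:
  assumes c: "c \<in> polys_tuples"
  shows "graded_comb c \<in> carrier \<M>"
proof -
  have "graded_comb c d \<in> H0 {..n} I d" for d
    unfolding graded_comb_def using c by (intro lin_comb_section tuple_closed) (auto simp: homog_tuple_def)
  moreover have "{d. graded_comb c d \<noteq> \<zero>\<^bsub>\<S>\<^esub>} \<subseteq> (\<Union>i\<le>m. (\<lambda>w. int (mdeg w) + gen_degree i) ` supp (c i))"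
  proof (rule subsetI, rule ccontr)
    fix d assume d: "d \<in> {d. graded_comb c d \<noteq> \<zero>\<^bsub>\<S>\<^esub>}"
      and no: "d \<notin> (\<Union>i\<le>m. (\<lambda>w. int (mdeg w) + gen_degree i) ` supp (c i))"
    have "hcomp (d - gen_degree i) (c i) = 0" if i: "i \<le> m" for i
    proof (rule poly_mapping_eqI)
      fix w
      have "coef (c i) w = 0" if "int (mdeg w) = d - gen_degree i"
      proof (rule ccontr)
        assume "coef (c i) w \<noteq> 0"
        then have "w \<in> supp (c i)" by (simp add: in_keys_iff)
        then show False using no i that by force
      qed
      then show "coef (hcomp (d - gen_degree i) (c i)) w = coef 0 w" by simp
    qed
    then have "graded_comb c d = lin_comb (\<lambda>i. 0)"
      unfolding graded_comb_def using c by (intro lin_comb_cong tuple_closed) auto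
    with d show False by (simp add: lin_comb_zero)
  qed
  then have "finite {d. graded_comb c d \<noteq> \<zero>\<^bsub>\<S>\<^esub>}" by (rule finite_subset) auto
  ultimately show ?thesis by (simp add: M_carrier)
qed

lemma graded_comb_cong: "(\<And>i. i \<le> m \<Longrightarrow> c i = c' i) \<Longrightarrow> c \<in> polys_tuples \<Longrightarrow> graded_comb c = graded_comb c'"
  unfolding graded_comb_def by (intro ext lin_comb_cong tuple_closed) auto

lemma graded_comb_inject:
  assumes c: "c \<in> polys_tuples" "c' \<in> polys_tuples" and eq: "graded_comb c = graded_comb c'" and i: "i \<le> m"
  shows "c i = c' i"
proof (rule poly_mapping_eqI)
  fix w
  define d where "d = int (mdeg w) + gen_degree i"
  have "lin_comb (\<lambda>i. hcomp (d - gen_degree i) (c i)) = lin_comb (\<lambda>i. hcomp (d - gen_degree i) (c' i))"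
    using fun_cong[OF eq, of d] by (simp add: graded_comb_def)
  then have "hcomp (d - gen_degree i) (c i) = hcomp (d - gen_degree i) (c' i)"
    using lin_comb_inject[OF tuple_closed(5)[OF c(1), of "\<lambda>i. d - gen_degree i"]
      tuple_closed(5)[OF c(2), of "\<lambda>i. d - gen_degree i"] _ i] by blast
  then have "coef (hcomp (d - gen_degree i) (c i)) w = coef (hcomp (d - gen_degree i) (c' i)) w" by simp
  then show "coef (c i) w = coef (c' i) w" by (simp add: d_def)
qed

text \<open>The coefficients of \<open>s d\<close> are homogeneous, of degrees that differ for different \<open>d\<close>; adding them up over
  all \<open>d\<close> loses no information.\<close>

lemma graded_comb_surj:
  assumes s: "s \<in> carrier \<M>"
  obtains c where "c \<in> polys_tuples" "s = graded_comb c"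
proof -
  define X where "X = {d. s d \<noteq> \<zero>\<^bsub>\<S>\<^esub>}"
  have fin: "finite X" and H: "\<And>d. s d \<in> H0 {..n} I d" using s by (auto simp: M_carrier X_def)
  have "\<exists>c. c \<in> polys_tuples \<and> homog_tuple d c \<and> s d = lin_comb c" for d
    using section_lin_comb[OF H, of d] by metis
  then obtain cs where cs: "\<And>d. cs d \<in> polys_tuples" "\<And>d. homog_tuple d (cs d)" "\<And>d. s d = lin_comb (cs d)"
    by metis
  define c where "c i = (\<Sum>d\<in>X. cs d i)" for i
  have c: "c \<in> polys_tuples" unfolding c_def using cs(1) by (intro tuple_closed)
  have comp: "hcomp (d - gen_degree i) (c i) = cs d i" if i: "i \<le> m" for d i
  proof -
    have "hcomp (d - gen_degree i) (c i) = (\<Sum>d'\<in>X. if d' = d then cs d i else 0)"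
      unfolding c_def hcomp_sum
    proof (intro sum.cong refl)
      fix d'
      have "homog (d' - gen_degree i) (cs d' i)" using cs(2) i by (simp add: homog_tuple_def)
      then show "hcomp (d - gen_degree i) (cs d' i) = (if d' = d then cs d i else 0)"
        by (auto simp: hcomp_homog)
    qed
    also have "\<dots> = cs d i"
    proof (cases "d \<in> X")
      case False
      then have "lin_comb (cs d) = lin_comb (\<lambda>i. 0)" using cs(3)[of d] by (simp add: X_def lin_comb_zero)
      then have "cs d i = 0" using lin_comb_inject[OF cs(1) tuple_closed(3) _ i] by blast
      then show ?thesis by (auto intro!: sum.neutral)
    qed (use fin in simp)
    finally show ?thesis .
  qed
  have "s = graded_comb c"
  proof
    fix d
    show "s d = graded_comb c d"
      unfolding graded_comb_def cs(3) using comp cs(1) by (intro lin_comb_cong) auto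
  qed
  with c show ?thesis by (rule that)
qed

lemma graded_comb_add: "c \<in> polys_tuples \<Longrightarrow> c' \<in> polys_tuples \<Longrightarrow> graded_comb c \<oplus>\<^bsub>\<M>\<^esub> graded_comb c' = graded_comb (\<lambda>i. c i + c' i)"
  unfolding graded_comb_def M_add by (simp add: lin_comb_add tuple_closed(5))

lemma graded_comb_zero: "\<zero>\<^bsub>\<M>\<^esub> = graded_comb (\<lambda>i. 0)"
  by (simp add: graded_comb_def M_zero lin_comb_zero)

text \<open>Both sides have the coefficients \<open>hcomp (d - gen_degree i) (f * c i)\<close>, by the convolution formula
  \<open>hcomp_mult\<close>.\<close>

lemma graded_comb_smult:
  assumes c: "c \<in> polys_tuples" and f: "f \<in> polys L"
  shows "f \<odot>\<^bsub>\<M>\<^esub> graded_comb c = graded_comb (\<lambda>i. f * c i)"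
proof
  fix d
  let ?E = "{e. hom_comp e f \<noteq> 0}"
  have "(f \<odot>\<^bsub>\<M>\<^esub> graded_comb c) d = (\<Oplus>\<^bsub>\<S>\<^esub>e\<in>?E. lin_comb (\<lambda>i. hom_comp e f * hcomp (d - int e - gen_degree i) (c i)))"
    unfolding M_smult graded_comb_def using c f by (simp add: lin_comb_mult tuple_closed(5))
  also have "\<dots> = lin_comb (\<lambda>i. \<Sum>e\<in>?E. hom_comp e f * hcomp (d - int e - gen_degree i) (c i))"
    using c f by (intro lin_comb_sum) (auto intro!: tuple_closed)
  also have "(\<lambda>i. \<Sum>e\<in>?E. hom_comp e f * hcomp (d - int e - gen_degree i) (c i)) =
      (\<lambda>i. hcomp (d - gen_degree i) (f * c i))"
    by (simp add: hcomp_mult algebra_simps)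
  finally show "(f \<odot>\<^bsub>\<M>\<^esub> graded_comb c) d = graded_comb (\<lambda>i. f * c i) d" by (simp add: graded_comb_def)
qed

lemma M_abelian_group: "abelian_group \<M>"
proof (rule abelian_groupI)
  fix x y assume "x \<in> carrier \<M>" "y \<in> carrier \<M>"
  then show "x \<oplus>\<^bsub>\<M>\<^esub> y \<in> carrier \<M>" "x \<oplus>\<^bsub>\<M>\<^esub> y = y \<oplus>\<^bsub>\<M>\<^esub> x"
    by (auto elim!: graded_comb_surj simp: graded_comb_add add.commute intro!: graded_comb_carrier tuple_closed)
next
  fix x y z assume "x \<in> carrier \<M>" "y \<in> carrier \<M>" "z \<in> carrier \<M>"
  then show "x \<oplus>\<^bsub>\<M>\<^esub> y \<oplus>\<^bsub>\<M>\<^esub> z = x \<oplus>\<^bsub>\<M>\<^esub> (y \<oplus>\<^bsub>\<M>\<^esub> z)"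
    by (auto elim!: graded_comb_surj simp: graded_comb_add tuple_closed add.assoc)
next
  show "\<zero>\<^bsub>\<M>\<^esub> \<in> carrier \<M>" unfolding graded_comb_zero by (intro graded_comb_carrier tuple_closed)
next
  fix x assume "x \<in> carrier \<M>"
  then obtain c where c: "c \<in> polys_tuples" "x = graded_comb c" by (rule graded_comb_surj)
  show "\<zero>\<^bsub>\<M>\<^esub> \<oplus>\<^bsub>\<M>\<^esub> x = x" using c by (simp add: graded_comb_zero graded_comb_add tuple_closed)
  have c': "(\<lambda>i. - c i) \<in> polys_tuples" using c by (simp add: polys_tuples_def)
  then have "graded_comb (\<lambda>i. - c i) \<oplus>\<^bsub>\<M>\<^esub> x = \<zero>\<^bsub>\<M>\<^esub>" using c by (simp add: graded_comb_zero graded_comb_add)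
  then show "\<exists>y\<in>carrier \<M>. y \<oplus>\<^bsub>\<M>\<^esub> x = \<zero>\<^bsub>\<M>\<^esub>" using graded_comb_carrier[OF c'] by blast
qed

lemma M_module: "Module.module (mpoly_ring L) \<M>"
proof (rule Module.moduleI)
  show "cring (mpoly_ring L)" by (rule cring_mpoly_ring)
  show "abelian_group \<M>" by (rule M_abelian_group)
next
  fix a :: "'k mpoly" and x assume "a \<in> polys L" "x \<in> carrier \<M>"
  then show "a \<odot>\<^bsub>\<M>\<^esub> x \<in> carrier \<M>"
    by (auto elim!: graded_comb_surj simp: graded_comb_smult intro!: graded_comb_carrier tuple_closed)
next
  fix a b :: "'k mpoly" and x assume "a \<in> polys L" "b \<in> polys L" "x \<in> carrier \<M>"
  then show "(a \<oplus>\<^bsub>mpoly_ring L\<^esub> b) \<odot>\<^bsub>\<M>\<^esub> x = a \<odot>\<^bsub>\<M>\<^esub> x \<oplus>\<^bsub>\<M>\<^esub> b \<odot>\<^bsub>\<M>\<^esub> x"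
    "(a \<otimes>\<^bsub>mpoly_ring L\<^esub> b) \<odot>\<^bsub>\<M>\<^esub> x = a \<odot>\<^bsub>\<M>\<^esub> (b \<odot>\<^bsub>\<M>\<^esub> x)"
    by (auto elim!: graded_comb_surj simp: graded_comb_smult graded_comb_add tuple_closed distrib_right mult.assoc)
next
  fix a :: "'k mpoly" and x y assume "a \<in> polys L" "x \<in> carrier \<M>" "y \<in> carrier \<M>"
  then show "a \<odot>\<^bsub>\<M>\<^esub> (x \<oplus>\<^bsub>\<M>\<^esub> y) = a \<odot>\<^bsub>\<M>\<^esub> x \<oplus>\<^bsub>\<M>\<^esub> a \<odot>\<^bsub>\<M>\<^esub> y"
    by (auto elim!: graded_comb_surj simp: graded_comb_smult graded_comb_add tuple_closed distrib_left)
next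
  fix x assume "x \<in> carrier \<M>"
  then show "\<one>\<^bsub>mpoly_ring L\<^esub> \<odot>\<^bsub>\<M>\<^esub> x = x"
    by (auto elim!: graded_comb_surj simp: graded_comb_smult)
qed

definition basis :: "nat \<Rightarrow> int \<Rightarrow> 'k mpoly set \<Rightarrow> ('k mpoly \<times> 'k mpoly) set" where
  "basis j = (case j of
     0 \<Rightarrow> in_degree {..n} I 0 (poly_sec {..n} I 1)
   | Suc i \<Rightarrow> in_degree {..n} I (1 - int (\<alpha> i)) (z_sec n k I A i))"

lemma basis_graded_comb:
  assumes j: "j \<le> m"
  shows "basis j = graded_comb (\<lambda>i. if i = j then 1 else 0)"
proof -
  have "graded_comb (\<lambda>i. if i = j then 1 else 0) = in_degree {..n} I (gen_degree j) (lin_comb (\<lambda>i. if i = j then 1 else 0))"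
  proof
    fix d
    have "(\<lambda>i. hcomp (d - gen_degree i) (if i = j then 1 else 0)) =
        (\<lambda>i. if d = gen_degree j then (if i = j then 1 else 0) else 0)"
      by (auto simp: hcomp_homog[OF homog_one])
    then have "graded_comb (\<lambda>i. if i = j then 1 else 0) d =
        lin_comb (\<lambda>i. if d = gen_degree j then (if i = j then 1 else 0) else 0)"
      unfolding graded_comb_def by (rule arg_cong)
    then show "graded_comb (\<lambda>i. if i = j then 1 else 0) d =
        in_degree {..n} I (gen_degree j) (lin_comb (\<lambda>i. if i = j then 1 else 0)) d"
      by (simp add: in_degree_def lin_comb_zero)
  qed
  also have "\<dots> = basis j"
    using j by (cases j) (simp_all add: basis_def gen_degree_def lin_comb_unit0 lin_comb_unit_Suc)
  finally show ?thesis by simp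
qed

lemma graded_comb_finsum:
  assumes "finite X" "\<And>x. x \<in> X \<Longrightarrow> cs x \<in> polys_tuples"
  shows "(\<Oplus>\<^bsub>\<M>\<^esub>x\<in>X. graded_comb (cs x)) = graded_comb (\<lambda>i. \<Sum>x\<in>X. cs x i)"
proof -
  interpret M: abelian_group \<M> by (rule M_abelian_group)
  show ?thesis using assms
  proof (induction X)
    case (insert x X)
    then have "(\<Oplus>\<^bsub>\<M>\<^esub>x\<in>insert x X. graded_comb (cs x)) = graded_comb (cs x) \<oplus>\<^bsub>\<M>\<^esub> (\<Oplus>\<^bsub>\<M>\<^esub>x\<in>X. graded_comb (cs x))"
      using graded_comb_carrier by (intro M.finsum_insert) auto
    then show ?case using insert by (simp add: graded_comb_add tuple_closed(4))
  qed (simp add: graded_comb_zero)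
qed

lemma basis_combination:
  assumes c: "c \<in> {..m} \<rightarrow> polys L"
  shows "(\<Oplus>\<^bsub>\<M>\<^esub>j\<in>{..m}. c j \<odot>\<^bsub>\<M>\<^esub> basis j) = graded_comb c"
proof -
  interpret M: abelian_group \<M> by (rule M_abelian_group)
  let ?u = "\<lambda>j i. if i = j then 1 else (0 :: 'k mpoly)"
  have cj: "c j \<odot>\<^bsub>\<M>\<^esub> basis j = graded_comb (\<lambda>i. c j * ?u j i)" if "j \<le> m" for j
    using that c by (simp add: basis_graded_comb graded_comb_smult tuple_closed(6) Pi_iff)
  have tup: "(\<lambda>i. c j * ?u j i) \<in> polys_tuples" if "j \<le> m" for j
    using that c by (intro tuple_closed) auto
  have "(\<Oplus>\<^bsub>\<M>\<^esub>j\<in>{..m}. c j \<odot>\<^bsub>\<M>\<^esub> basis j) = (\<Oplus>\<^bsub>\<M>\<^esub>j\<in>{..m}. graded_comb (\<lambda>i. c j * ?u j i))"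
    using cj tup graded_comb_carrier by (intro M.finsum_cong') auto
  also have "\<dots> = graded_comb (\<lambda>i. \<Sum>j\<in>{..m}. c j * ?u j i)"
    using tup by (intro graded_comb_finsum) auto
  also have "\<dots> = graded_comb c"
  proof (rule graded_comb_cong)
    show "(\<lambda>i. \<Sum>j\<in>{..m}. c j * ?u j i) \<in> polys_tuples" using tup by (intro tuple_closed(4)) auto
    fix i assume "i \<le> m"
    have "(\<Sum>j\<in>{..m}. c j * ?u j i) = (\<Sum>j\<in>{..m}. if j = i then c i else 0)"
      by (intro sum.cong) auto
    with \<open>i \<le> m\<close> show "(\<Sum>j\<in>{..m}. c j * ?u j i) = c i" by simp
  qed
  finally show ?thesis .
qed

lemma M_free_basis: "free_basis (mpoly_ring L) \<M> {..m} basis"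
  unfolding free_basis_def
proof (intro conjI ballI)
  show "finite {..m}" by simp
  show "basis \<in> {..m} \<rightarrow> carrier \<M>"
    by (auto simp: basis_graded_comb intro!: graded_comb_carrier tuple_closed)
  fix x assume "x \<in> carrier \<M>"
  then obtain c where c: "c \<in> polys_tuples" "x = graded_comb c" by (rule graded_comb_surj)
  have tup: "c' \<in> polys_tuples" if "c' \<in> {..m} \<rightarrow>\<^sub>E polys L" for c'
    using that by (auto simp: polys_tuples_def)
  show "\<exists>!c. c \<in> {..m} \<rightarrow>\<^sub>E polys L \<and> x = (\<Oplus>\<^bsub>\<M>\<^esub>i\<in>{..m}. c i \<odot>\<^bsub>\<M>\<^esub> basis i)"
  proof (rule ex1I[of _ "restrict c {..m}"], intro conjI)
    show mem: "restrict c {..m} \<in> {..m} \<rightarrow>\<^sub>E polys L" using c(1) by (auto simp: polys_tuples_def)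
    have "graded_comb c = graded_comb (restrict c {..m})" using c(1) by (intro graded_comb_cong) auto
    then show "x = (\<Oplus>\<^bsub>\<M>\<^esub>i\<in>{..m}. restrict c {..m} i \<odot>\<^bsub>\<M>\<^esub> basis i)"
      using mem by (subst basis_combination) (auto simp: c(2) PiE_iff)
    fix c' assume c': "c' \<in> {..m} \<rightarrow>\<^sub>E polys L \<and> x = (\<Oplus>\<^bsub>\<M>\<^esub>i\<in>{..m}. c' i \<odot>\<^bsub>\<M>\<^esub> basis i)"
    then have "graded_comb c' = graded_comb c" using basis_combination[of c'] by (auto simp: c(2) PiE_iff)
    then have "c' i = c i" if "i \<le> m" for i using graded_comb_inject[OF tup c(1) _ that] c' by blast
    then show "c' = restrict c {..m}" using c' by (intro PiE_ext[OF _ mem]) auto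
  qed
qed

end

theorem theorem4p5:
  fixes n k r :: nat
    and I :: "'k::field mpoly set"
    and A B :: "'k mpoly mat"
    and \<alpha> \<beta> :: "nat \<Rightarrow> nat"
  assumes "n \<ge> 3" and "r = n - 2" and "1 \<le> k" and "k \<le> n - 2"
    and "rope n (n - k) I"
    and "rope_matrices n k I A B \<alpha> \<beta>"
  shows "(\<forall>d::int. H0 {..n} I d =
           {poly_sec {..n} I P \<oplus>\<^bsub>sec_ring {..n} I\<^esub>
              (\<Oplus>\<^bsub>sec_ring {..n} I\<^esub>i\<in>{..r - k}.
                 poly_sec {..n} I (Q i) \<otimes>\<^bsub>sec_ring {..n} I\<^esub> z_sec n k I A i) | P Q.
            P \<in> carrier (mpoly_ring (line_vars n)) \<and> homog d P \<and>
            (\<forall>i\<le>r - k. Q i \<in> carrier (mpoly_ring (line_vars n)) \<and> homog (d + int (\<alpha> i) - 1) (Q i))})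
       \<and> Module.module (mpoly_ring (line_vars n)) (H0star {..n} I)
       \<and> free_basis (mpoly_ring (line_vars n)) (H0star {..n} I) {..r - k + 1}
           (\<lambda>j. case j of
              0 \<Rightarrow> in_degree {..n} I 0 (poly_sec {..n} I 1)
            | Suc i \<Rightarrow> in_degree {..n} I (1 - int (\<alpha> i)) (z_sec n k I A i))"
proof -
  interpret rope_with_matrices n k r I A B \<alpha> \<beta>
    using assms by unfold_locales auto
  have "basis = (\<lambda>j. case j of
              0 \<Rightarrow> in_degree {..n} I 0 (poly_sec {..n} I 1)
            | Suc i \<Rightarrow> in_degree {..n} I (1 - int (\<alpha> i)) (z_sec n k I A i))"
    by (rule ext) (simp add: basis_def)
  with M_free_basis M_module H0_explicit show ?thesis by simp
qed

end
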